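(* Consider a GRW spacetime $(I\times F,g^f=-d\tau^2+f^2g)$, $I=(a,b)$, with weakly convex fiber, such that for some $c\in(a,b)$ the "non-escape" equalities $$\int_a^cf^{-2}\Big(\frac1{f^2}+1\Big)^{-1/2}d\tau=\infty,\qquad \int_c^bf^{-2}\Big(\frac1{f^2}+1\Big)^{-1/2}d\tau=\infty$$ hold. Then the spacetime is geodesically connected, and any causal geodesic $\gamma(t)=(\tau(t),\gamma_F(t))$ starting at a point $z_0$ has conjugate points (to $z_0$) in bijective correspondence (including multiplicities) with the conjugate points of the inextendible geodesic $\hat\gamma_F(r)$ obtained from the projection $\gamma_F(t)$ on the fiber.
   Context: $(F,g)$ is a connected Riemannian manifold, $I=(a,b)\subseteq\mathbb{R}$ an open interval ($-\infty\le a<b\le\infty$), $f:I\to(0,\infty)$ smooth. The GRW spacetime is $I\times F$ with Lorentz metric $g^f=-d\tau^2+f(\tau)^2g$. $(F,g)$ is weakly convex if any two of its points can be joined by a geodesic which minimizes the distance. Geodesically connected means that each two points can be joined by a geodesic. Geodesics are assumed inextendible (with maximal domain). For a geodesic $\gamma=(\tau,\gamma_F)$ of $g^f$, $\gamma_F$ is a pregeodesic of $(F,g)$, and $\hat\gamma_F$ denotes the $F$-geodesic obtained by reparametrizing $\gamma_F$ and extending it maximally; conjugate points of $\hat\gamma_F$ are those conjugate to its starting point (the projection of $z_0$). A constant $\hat\gamma_F$ is considered to have no conjugate points. Causal means $g^f(\gamma',\gamma')\le0$. *)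

theory Defs
  imports "HOL-Analysis.Analysis" "HOL-Library.Function_Algebras"
begin

section \<open>Smooth maps\<close>

text \<open>For open \<open>S\<close> only, as two-sided derivatives are used. Fixing the direction \<open>v\<close>
  loses nothing on finite-dimensional spaces.\<close>

primrec Ck_on :: "nat \<Rightarrow> ('a::real_normed_vector \<Rightarrow> 'b::real_normed_vector) \<Rightarrow> 'a set \<Rightarrow> bool" where
  "Ck_on 0 f S \<longleftrightarrow> continuous_on S f"
| "Ck_on (Suc k) f S \<longleftrightarrow>
     (\<forall>x\<in>S. f differentiable (at x)) \<and>
     (\<forall>v. Ck_on k (\<lambda>x. frechet_derivative f (at x) v) S)"

definition smooth_on :: "'a::real_normed_vector set \<Rightarrow> ('a \<Rightarrow> 'b::real_normed_vector) \<Rightarrow> bool" where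
  "smooth_on S f \<longleftrightarrow> (\<forall>k. Ck_on k f S)"

section \<open>Manifolds with a metric tensor, given by an atlas\<close>

text \<open>The manifold is the union of the patches, an open subset of the type \<open>'p\<close>, with the
  topology of \<open>'p\<close>; it is modelled on the Euclidean space \<open>'e\<close>. Charts are
  labelled by indices. The metric tensor is given by its components: \<open>metric M i x v w\<close> is
  the product of the vectors with components \<open>v\<close>, \<open>w\<close> in chart \<open>i\<close>, at the point whose
  \<open>i\<close>-coordinates are \<open>x\<close>. Values outside of the patches and their images are junk.\<close>

record ('i, 'p, 'e) mfd =
  idx :: "'i set"
  patch :: "'i \<Rightarrow> 'p set"
  coord :: "'i \<Rightarrow> 'p \<Rightarrow> 'e"
  metric :: "'i \<Rightarrow> 'e \<Rightarrow> 'e \<Rightarrow> 'e \<Rightarrow> real"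

definition points :: "('i, 'p, 'e) mfd \<Rightarrow> 'p set" where
  "points M = (\<Union>i\<in>idx M. patch M i)"

definition transition :: "('i, 'p, 'e) mfd \<Rightarrow> 'i \<Rightarrow> 'i \<Rightarrow> 'e \<Rightarrow> 'e" where
  "transition M i j = coord M j \<circ> inv_into (patch M i) (coord M i)"

definition smooth_atlas :: "('i, 'p::topological_space, 'e::euclidean_space) mfd \<Rightarrow> bool" where
  "smooth_atlas M \<longleftrightarrow>
     (\<forall>i\<in>idx M. open (patch M i) \<and> open (coord M i ` patch M i) \<and>
        homeomorphism (patch M i) (coord M i ` patch M i)
          (coord M i) (inv_into (patch M i) (coord M i))) \<and>
     (\<forall>i\<in>idx M. \<forall>j\<in>idx M.
        smooth_on (coord M i ` (patch M i \<inter> patch M j)) (transition M i j))"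

definition riemannian_manifold :: "('i, 'p::topological_space, 'e::euclidean_space) mfd \<Rightarrow> bool" where
  "riemannian_manifold M \<longleftrightarrow> smooth_atlas M \<and>
     (\<forall>i\<in>idx M.
        (\<forall>v w. smooth_on (coord M i ` patch M i) (\<lambda>x. metric M i x v w)) \<and>
        (\<forall>x\<in>coord M i ` patch M i.
           bilinear (metric M i x) \<and>
           (\<forall>v w. metric M i x v w = metric M i x w v) \<and>
           (\<forall>v. v \<noteq> 0 \<longrightarrow> metric M i x v v > 0))) \<and>
     (\<forall>i\<in>idx M. \<forall>j\<in>idx M. \<forall>p\<in>patch M i \<inter> patch M j.
        let D = frechet_derivative (transition M i j) (at (coord M i p)) in
        \<forall>v w. metric M i (coord M i p) v w = metric M j (coord M j p) (D v) (D w))"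

text \<open>The Levi-Civita connection: the Koszul formula for the (commuting) constant vector
  fields of a chart, so that \<open>christoffel M i x v w\<close> is \<open>\<nabla>\<^sub>v w\<close> for constant \<open>v\<close>, \<open>w\<close>.\<close>

definition christoffel ::
    "('i, 'p, 'e::euclidean_space) mfd \<Rightarrow> 'i \<Rightarrow> 'e \<Rightarrow> 'e \<Rightarrow> 'e \<Rightarrow> 'e" where
  "christoffel M i x v w =
     (let D = (\<lambda>u a b. frechet_derivative (\<lambda>y. metric M i y a b) (at x) u) in
      THE z. \<forall>u. metric M i x z u = (D v w u + D w v u - D u v w) / 2)"

text \<open>Sign convention: \<open>R(u,v)w = \<nabla>\<^sub>u \<nabla>\<^sub>v w - \<nabla>\<^sub>v \<nabla>\<^sub>u w\<close> for constant fields.\<close>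

definition curvature ::
    "('i, 'p, 'e::euclidean_space) mfd \<Rightarrow> 'i \<Rightarrow> 'e \<Rightarrow> 'e \<Rightarrow> 'e \<Rightarrow> 'e \<Rightarrow> 'e" where
  "curvature M i x u v w =
     (let \<Gamma> = christoffel M i in
      frechet_derivative (\<lambda>y. \<Gamma> y v w) (at x) u - frechet_derivative (\<lambda>y. \<Gamma> y u w) (at x) v
      + \<Gamma> x u (\<Gamma> x v w) - \<Gamma> x v (\<Gamma> x u w))"

section \<open>Geodesics\<close>

definition velocity ::
    "('i, 'p, 'e::euclidean_space) mfd \<Rightarrow> (real \<Rightarrow> 'p) \<Rightarrow> 'i \<Rightarrow> real \<Rightarrow> 'e" where
  "velocity M \<gamma> i t = vector_derivative (coord M i \<circ> \<gamma>) (at t)"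

text \<open>A vector field along a curve is represented by its components \<open>V i t\<close>.\<close>

definition covariant_derivative ::
    "('i, 'p, 'e::euclidean_space) mfd \<Rightarrow> (real \<Rightarrow> 'p) \<Rightarrow> ('i \<Rightarrow> real \<Rightarrow> 'e) \<Rightarrow> 'i \<Rightarrow> real \<Rightarrow> 'e" where
  "covariant_derivative M \<gamma> V i t =
     vector_derivative (V i) (at t) + christoffel M i (coord M i (\<gamma> t)) (velocity M \<gamma> i t) (V i t)"

definition geodesic ::
    "('i, 'p::topological_space, 'e::euclidean_space) mfd \<Rightarrow> (real \<Rightarrow> 'p) \<Rightarrow> real set \<Rightarrow> bool" where
  "geodesic M \<gamma> J \<longleftrightarrow>
     open J \<and> connected J \<and> J \<noteq> {} \<and> continuous_on J \<gamma> \<and> \<gamma> ` J \<subseteq> points M \<and>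
     (\<forall>i\<in>idx M. \<forall>t\<in>J. \<gamma> t \<in> patch M i \<longrightarrow>
        (coord M i \<circ> \<gamma>) differentiable (at t) \<and>
        velocity M \<gamma> i differentiable (at t) \<and>
        covariant_derivative M \<gamma> (velocity M \<gamma>) i t = 0)"

definition inextendible_geodesic ::
    "('i, 'p::topological_space, 'e::euclidean_space) mfd \<Rightarrow> (real \<Rightarrow> 'p) \<Rightarrow> real set \<Rightarrow> bool" where
  "inextendible_geodesic M \<gamma> J \<longleftrightarrow> geodesic M \<gamma> J \<and>
     (\<forall>\<sigma> K. geodesic M \<sigma> K \<and> J \<subseteq> K \<and> (\<forall>t\<in>J. \<sigma> t = \<gamma> t) \<longrightarrow> K = J)"

definition geodesically_connected ::
    "('i, 'p::topological_space, 'e::euclidean_space) mfd \<Rightarrow> bool" where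
  "geodesically_connected M \<longleftrightarrow>
     (\<forall>p\<in>points M. \<forall>q\<in>points M. \<exists>\<gamma> J. inextendible_geodesic M \<gamma> J \<and>
        (\<exists>s\<in>J. \<exists>t\<in>J. \<gamma> s = p \<and> \<gamma> t = q))"

definition causal_curve ::
    "('i, 'p, 'e::euclidean_space) mfd \<Rightarrow> (real \<Rightarrow> 'p) \<Rightarrow> real set \<Rightarrow> bool" where
  "causal_curve M \<gamma> J \<longleftrightarrow>
     (\<forall>i\<in>idx M. \<forall>t\<in>J. \<gamma> t \<in> patch M i \<longrightarrow>
        metric M i (coord M i (\<gamma> t)) (velocity M \<gamma> i t) (velocity M \<gamma> i t) \<le> 0)"

section \<open>Riemannian distance and weak convexity\<close>

definition C1_curve ::
    "('i, 'p::topological_space, 'e::euclidean_space) mfd \<Rightarrow> (real \<Rightarrow> 'p) \<Rightarrow> real \<Rightarrow> real \<Rightarrow> bool" where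
  "C1_curve M c s t \<longleftrightarrow>
     s < t \<and> continuous_on {s..t} c \<and> c ` {s..t} \<subseteq> points M \<and>
     (\<forall>i\<in>idx M. \<forall>u\<in>{s..t}. c u \<in> patch M i \<longrightarrow>
        (coord M i \<circ> c) differentiable (at u within {s..t}) \<and>
        continuous (at u within {s..t})
          (\<lambda>r. vector_derivative (coord M i \<circ> c) (at r within {s..t})))"

inductive piecewise_C1_curve ::
    "('i, 'p::topological_space, 'e::euclidean_space) mfd \<Rightarrow> (real \<Rightarrow> 'p) \<Rightarrow> real \<Rightarrow> real \<Rightarrow> bool"
  for M c where
  single: "C1_curve M c s t \<Longrightarrow> piecewise_C1_curve M c s t"
| append: "piecewise_C1_curve M c s t \<Longrightarrow> C1_curve M c t u \<Longrightarrow> piecewise_C1_curve M c s u"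

text \<open>Independent of the chosen chart, by the transformation law of the metric.\<close>

definition speed :: "('i, 'p, 'e::euclidean_space) mfd \<Rightarrow> (real \<Rightarrow> 'p) \<Rightarrow> real \<Rightarrow> real" where
  "speed M c t =
     (let i = (SOME i. i \<in> idx M \<and> c t \<in> patch M i) in
      sqrt (metric M i (coord M i (c t)) (velocity M c i t) (velocity M c i t)))"

definition arc_length :: "('i, 'p, 'e::euclidean_space) mfd \<Rightarrow> (real \<Rightarrow> 'p) \<Rightarrow> real \<Rightarrow> real \<Rightarrow> real" where
  "arc_length M c s t = integral {s..t} (speed M c)"

definition riemannian_distance ::
    "('i, 'p::topological_space, 'e::euclidean_space) mfd \<Rightarrow> 'p \<Rightarrow> 'p \<Rightarrow> real" where
  "riemannian_distance M p q =
     Inf {arc_length M c s t | c s t. piecewise_C1_curve M c s t \<and> c s = p \<and> c t = q}"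

definition weakly_convex :: "('i, 'p::topological_space, 'e::euclidean_space) mfd \<Rightarrow> bool" where
  "weakly_convex M \<longleftrightarrow>
     (\<forall>p\<in>points M. \<forall>q\<in>points M. \<exists>\<gamma> J. inextendible_geodesic M \<gamma> J \<and>
        (\<exists>s\<in>J. \<exists>t\<in>J. s \<le> t \<and> \<gamma> s = p \<and> \<gamma> t = q \<and>
           arc_length M \<gamma> s t = riemannian_distance M p q))"

section \<open>Jacobi fields and conjugate points\<close>

text \<open>Components are set to \<open>0\<close> where they are meaningless, so that a field along the curve is
  represented by exactly one function.\<close>

definition field_along ::
    "('i, 'p, 'e::euclidean_space) mfd \<Rightarrow> (real \<Rightarrow> 'p) \<Rightarrow> real set \<Rightarrow> ('i \<Rightarrow> real \<Rightarrow> 'e) \<Rightarrow> bool" where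
  "field_along M \<gamma> J V \<longleftrightarrow>
     (\<forall>i t. \<not> (i \<in> idx M \<and> t \<in> J \<and> \<gamma> t \<in> patch M i) \<longrightarrow> V i t = 0) \<and>
     (\<forall>i\<in>idx M. \<forall>j\<in>idx M. \<forall>t\<in>J. \<gamma> t \<in> patch M i \<inter> patch M j \<longrightarrow>
        V j t = frechet_derivative (transition M i j) (at (coord M i (\<gamma> t))) (V i t))"

definition jacobi_field ::
    "('i, 'p, 'e::euclidean_space) mfd \<Rightarrow> (real \<Rightarrow> 'p) \<Rightarrow> real set \<Rightarrow> ('i \<Rightarrow> real \<Rightarrow> 'e) \<Rightarrow> bool" where
  "jacobi_field M \<gamma> J V \<longleftrightarrow> field_along M \<gamma> J V \<and>
     (\<forall>i\<in>idx M. \<forall>t\<in>J. \<gamma> t \<in> patch M i \<longrightarrow>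
        V i differentiable (at t) \<and>
        covariant_derivative M \<gamma> V i differentiable (at t) \<and>
        covariant_derivative M \<gamma> (covariant_derivative M \<gamma> V) i t
        + curvature M i (coord M i (\<gamma> t)) (V i t) (velocity M \<gamma> i t) (velocity M \<gamma> i t) = 0)"

definition jacobi_fields_vanishing_at ::
    "('i, 'p, 'e::euclidean_space) mfd \<Rightarrow> (real \<Rightarrow> 'p) \<Rightarrow> real set \<Rightarrow> real \<Rightarrow> real \<Rightarrow>
     ('i \<Rightarrow> real \<Rightarrow> 'e) set" where
  "jacobi_fields_vanishing_at M \<gamma> J t0 t =
     {V. jacobi_field M \<gamma> J V \<and> (\<forall>i. V i t0 = 0) \<and> (\<forall>i. V i t = 0)}"

definition scale_field :: "real \<Rightarrow> ('i \<Rightarrow> real \<Rightarrow> 'e::real_vector) \<Rightarrow> 'i \<Rightarrow> real \<Rightarrow> 'e" where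
  "scale_field r V = (\<lambda>i t. r *\<^sub>R V i t)"

lemma vector_space_scale_field: "vector_space scale_field"
  by standard (simp_all add: scale_field_def fun_eq_iff algebra_simps)

text \<open>Conjugate points of \<open>\<gamma>\<close> to its starting point \<open>\<gamma> t0\<close> are recorded by their parameters, since
  \<open>\<gamma>\<close> may pass through the same point several times.\<close>

definition conjugate_params ::
    "('i, 'p, 'e::euclidean_space) mfd \<Rightarrow> (real \<Rightarrow> 'p) \<Rightarrow> real set \<Rightarrow> real \<Rightarrow> real set" where
  "conjugate_params M \<gamma> J t0 =
     {t\<in>J. t0 < t \<and> (\<exists>V\<in>jacobi_fields_vanishing_at M \<gamma> J t0 t. V \<noteq> 0)}"

definition conjugate_multiplicity ::
    "('i, 'p, 'e::euclidean_space) mfd \<Rightarrow> (real \<Rightarrow> 'p) \<Rightarrow> real set \<Rightarrow> real \<Rightarrow> real \<Rightarrow> nat" where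
  "conjugate_multiplicity M \<gamma> J t0 t =
     vector_space.dim scale_field (jacobi_fields_vanishing_at M \<gamma> J t0 t)"

section \<open>Generalized Robertson-Walker spacetimes\<close>

definition grw ::
    "real set \<Rightarrow> (real \<Rightarrow> real) \<Rightarrow> ('i, 'p, 'e) mfd \<Rightarrow> ('i, real \<times> 'p, real \<times> 'e) mfd" where
  "grw I f M = \<lparr>
     idx = idx M,
     patch = (\<lambda>i. I \<times> patch M i),
     coord = (\<lambda>i (\<tau>, p). (\<tau>, coord M i p)),
     metric = (\<lambda>i (\<tau>, x) (\<alpha>, v) (\<beta>, w). - (\<alpha> * \<beta>) + (f \<tau>)\<^sup>2 * metric M i x v w) \<rparr>"

text \<open>\<open>\<sigma>\<close>, with maximal domain \<open>K\<close>, is the geodesic of the fiber \<open>M\<close> obtained from the projection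
  of \<open>\<gamma>\<close> by the orientation preserving change of parameter \<open>r = h t\<close> and maximal extension.\<close>

definition fiber_geodesic_of ::
    "('i, 'p::topological_space, 'e::euclidean_space) mfd \<Rightarrow> (real \<Rightarrow> real \<times> 'p) \<Rightarrow> real set \<Rightarrow>
     (real \<Rightarrow> 'p) \<Rightarrow> real set \<Rightarrow> (real \<Rightarrow> real) \<Rightarrow> bool" where
  "fiber_geodesic_of M \<gamma> J \<sigma> K h \<longleftrightarrow>
     inextendible_geodesic M \<sigma> K \<and> smooth_on J h \<and>
     (\<forall>t\<in>J. deriv h t > 0 \<and> h t \<in> K \<and> \<sigma> (h t) = snd (\<gamma> t))"

end

theory Submission
  imports Defs
begin

text \<open>Along a geodesic, the fiber component is \<open>\<sigma> \<circ> h\<close> for a geodesic \<open>\<sigma>\<close> of the fiber, with \<open>h' = l / f\<^sup>2\<close>, and the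
  time component satisfies \<open>(\<tau>')\<^sup>2 = s l\<^sup>2 / f\<^sup>2 + D\<close> with \<open>s\<close> the squared speed of \<open>\<sigma>\<close>. For a causal geodesic
  \<open>D \<ge> 0\<close>, so that the time component is strictly monotone and both \<open>t\<close> and \<open>h\<close> are quadratures in \<open>\<tau>\<close>; the
  non-escape equalities say that the one for \<open>h\<close> takes all real values, hence \<open>h\<close> is onto the domain of \<open>\<sigma>\<close>.
  Let \<open>(\<alpha>, U \<circ> h)\<close> be a Jacobi field which vanishes at two parameters, and let \<open>v\<close> be the inner product
  of \<open>U\<close> with the velocity of \<open>\<sigma>\<close>. Its product with the velocity of the geodesic, \<open>l v - \<tau>' \<alpha>\<close>, is affine,
  hence \<open>0\<close>. Then \<open>v / (\<tau>')\<^sup>2\<close> is monotone and vanishes twice. So \<open>v = 0\<close>, \<open>\<alpha> = 0\<close>, and \<open>U\<close> is a Jacobi field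
  along \<open>\<sigma>\<close>; conversely, every Jacobi field along \<open>\<sigma>\<close> which vanishes twice lifts in this way.

  For the connectedness, the points are joined above a geodesic of the fiber. With respect to the parameter of
  this geodesic and to \<open>\<theta> = \<integral> d\<tau> / f\<close>, the geodesic equation is \<open>\<theta>'' = D (f\<^sup>2)' / 2\<close>, where \<open>(\<theta>')\<^sup>2 = s + D f\<^sup>2\<close>.
  By the non-escape equalities, all of its solutions are defined for all times, so that shooting
  and the intermediate value theorem solve the boundary value problem.\<close>

section \<open>Smooth maps\<close>

text \<open>The manifold is given by charts only, whereas the argument needs functions on whole
  parameter intervals. So the connections of the fiber and of the warped metric are computed in a
  chart, and only scalars independent of the chart are followed globally: \<open>vprod\<close> and
  the time component of a Jacobi field. That \<open>l v - \<tau>' \<alpha>\<close> vanishes only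
  ties \<open>\<alpha>\<close> to \<open>v\<close>. The monotonicity needs another first integral:
  with \<open>p\<close> the derivative of \<open>v\<close> in the parameter of
  \<open>\<sigma>\<close>, the sum \<open>p + 2 s (f' / f) \<alpha>\<close> is a constant
  \<open>c\<close>, and then the derivative of \<open>v / (\<tau>')\<^sup>2\<close> is
  \<open>c h' / (\<tau>')\<^sup>2\<close>. If \<open>s = 0\<close>, \<open>h\<close> is arbitrary
  and there is no \<open>l\<close>; that case is settled separately, as neither side has conjugate
  parameters. The weight in the non-escape equalities is, up to constants, the least of the
  integrands that occur: \<open>h' / \<tau>'\<close> has the modulus
  \<open>(l / f\<^sup>2) / sqrt (s l\<^sup>2 / f\<^sup>2 + D)\<close>, and the radicand is at most
  \<open>max (s l\<^sup>2) D\<close> times \<open>1 / f\<^sup>2 + 1\<close>. In the variable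
  \<open>\<theta>\<close> the weight is \<open>1 / sqrt (1 + f\<^sup>2)\<close>, which controls
  \<open>\<theta>'\<close> for every sign of \<open>D\<close>.\<close>

lemma smooth_on_imp_differentiable:
  "smooth_on S f \<Longrightarrow> x \<in> S \<Longrightarrow> f differentiable (at x)"
  unfolding smooth_on_def by (metis Ck_on.simps(2))

lemma smooth_on_imp_continuous_on: "smooth_on S f \<Longrightarrow> continuous_on S f"
  unfolding smooth_on_def by (metis Ck_on.simps(1))

lemma smooth_on_frechet_derivative:
  "smooth_on S f \<Longrightarrow> smooth_on S (\<lambda>x. frechet_derivative f (at x) v)"
  unfolding smooth_on_def by (metis Ck_on.simps(2))

lemma frechet_derivative_real_eq_deriv:
  fixes f :: "real \<Rightarrow> real"
  assumes "f differentiable (at x)"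
  shows "frechet_derivative f (at x) v = deriv f x * v"
proof -
  have "(f has_field_derivative deriv f x) (at x)"
    using assms DERIV_deriv_iff_real_differentiable by blast
  then have "(f has_derivative (\<lambda>v. deriv f x * v)) (at x)"
    by (simp add: has_field_derivative_def)
  then show ?thesis using frechet_derivative_at by metis
qed

lemma smooth_on_real_has_field_derivative:
  fixes f :: "real \<Rightarrow> real"
  assumes "smooth_on S f" "x \<in> S"
  shows "(f has_field_derivative deriv f x) (at x)"
  using assms DERIV_deriv_iff_real_differentiable smooth_on_imp_differentiable by blast

lemma Ck_on_cong:
  assumes "open S" "\<And>x. x \<in> S \<Longrightarrow> f x = g x" "Ck_on k f S"
  shows "Ck_on k g S"
  using assms(2,3)
proof (induction k arbitrary: f g)
  case 0
  then show ?case using continuous_on_cong by fastforce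
next
  case (Suc k)
  have *: "g differentiable (at x)" "frechet_derivative g (at x) = frechet_derivative f (at x)"
    if "x \<in> S" for x
  proof -
    have "f differentiable (at x)" using Suc that by simp
    then have "(f has_derivative frechet_derivative f (at x)) (at x)"
      using frechet_derivative_works by blast
    then have "(g has_derivative frechet_derivative f (at x)) (at x)"
      by (rule has_derivative_transform_within_open[OF _ \<open>open S\<close> that Suc(2)])
    then show "g differentiable (at x)" "frechet_derivative g (at x) = frechet_derivative f (at x)"
      by (auto simp: differentiable_def dest: frechet_derivative_at)
  qed
  have "Ck_on k (\<lambda>x. frechet_derivative g (at x) v) S" for v
    by (rule Suc.IH[of "\<lambda>x. frechet_derivative f (at x) v"]) (use * Suc in auto)
  then show ?case using * by simp
qed

lemma smooth_on_deriv:
  fixes f :: "real \<Rightarrow> real"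
  assumes "smooth_on S f" "open S"
  shows "smooth_on S (deriv f)"
proof -
  have "deriv f x = frechet_derivative f (at x) 1" if "x \<in> S" for x
    using frechet_derivative_real_eq_deriv[of f x 1] smooth_on_imp_differentiable[OF assms(1) that] by simp
  moreover have "smooth_on S (\<lambda>x. frechet_derivative f (at x) 1)"
    by (rule smooth_on_frechet_derivative[OF assms(1)])
  ultimately show ?thesis
    using Ck_on_cong[OF assms(2)] unfolding smooth_on_def by metis
qed

section \<open>Symmetry of second derivatives\<close>

lemma has_field_derivative_along_line:
  fixes \<phi> :: "'a::real_normed_vector \<Rightarrow> real"
  assumes "\<phi> differentiable (at (y + s *\<^sub>R u))"
  shows "((\<lambda>s. \<phi> (y + s *\<^sub>R u)) has_field_derivative frechet_derivative \<phi> (at (y + s *\<^sub>R u)) u) (at s)"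
proof -
  let ?D = "frechet_derivative \<phi> (at (y + s *\<^sub>R u))"
  have "((\<lambda>s. y + s *\<^sub>R u) has_derivative (\<lambda>h. h *\<^sub>R u)) (at s)"
    by (auto intro!: derivative_eq_intros)
  moreover have D: "(\<phi> has_derivative ?D) (at (y + s *\<^sub>R u))"
    using assms frechet_derivative_works by blast
  ultimately have "((\<lambda>s. \<phi> (y + s *\<^sub>R u)) has_derivative (\<lambda>h. ?D (h *\<^sub>R u))) (at s)"
    by (rule has_derivative_compose)
  moreover have "?D (h *\<^sub>R u) = ?D u * h" for h
    using linear_cmul[OF has_derivative_linear[OF D]] by simp
  ultimately show ?thesis by (simp add: has_field_derivative_def)
qed

text \<open>The second difference over a parallelogram is symmetric in \<open>u\<close> and
  \<open>v\<close>; two applications of the mean value theorem, one in each direction, express it by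
  one mixed derivative at an unspecified point of the parallelogram.\<close>

lemma mixed_difference_mvt:
  fixes \<phi> :: "'a::real_normed_vector \<Rightarrow> real"
  assumes "0 < h"
    and dom: "\<And>s t. s \<in> {0..h} \<Longrightarrow> t \<in> {0..h} \<Longrightarrow> x + s *\<^sub>R u + t *\<^sub>R v \<in> S"
    and d1: "\<And>y. y \<in> S \<Longrightarrow> \<phi> differentiable (at y)"
    and d2: "\<And>y. y \<in> S \<Longrightarrow> (\<lambda>y. frechet_derivative \<phi> (at y) u) differentiable (at y)"
  obtains s t where "s \<in> {0..h}" "t \<in> {0..h}"
    "\<phi> (x + h *\<^sub>R u + h *\<^sub>R v) - \<phi> (x + h *\<^sub>R u) - \<phi> (x + h *\<^sub>R v) + \<phi> x =
       h * h * frechet_derivative (\<lambda>y. frechet_derivative \<phi> (at y) u) (at (x + s *\<^sub>R u + t *\<^sub>R v)) v"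
proof -
  let ?a = "\<lambda>y. frechet_derivative \<phi> (at y) u"
  have "\<exists>s>0. s < h \<and> (\<phi> (x + h *\<^sub>R v + h *\<^sub>R u) - \<phi> (x + h *\<^sub>R u)) - (\<phi> (x + h *\<^sub>R v + 0 *\<^sub>R u) - \<phi> (x + 0 *\<^sub>R u))
      = (h - 0) * (?a (x + h *\<^sub>R v + s *\<^sub>R u) - ?a (x + s *\<^sub>R u))"
  proof (rule MVT2[OF \<open>0 < h\<close>])
    fix s assume "0 \<le> s" "s \<le> h"
    then have "x + s *\<^sub>R u + h *\<^sub>R v \<in> S" "x + s *\<^sub>R u + 0 *\<^sub>R v \<in> S"
      using dom[of s h] dom[of s 0] \<open>0 < h\<close> by auto
    then have "x + h *\<^sub>R v + s *\<^sub>R u \<in> S" "x + s *\<^sub>R u \<in> S"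
      by (simp_all add: algebra_simps)
    then show "((\<lambda>s. \<phi> (x + h *\<^sub>R v + s *\<^sub>R u) - \<phi> (x + s *\<^sub>R u)) has_real_derivative
        ?a (x + h *\<^sub>R v + s *\<^sub>R u) - ?a (x + s *\<^sub>R u)) (at s)"
      using has_field_derivative_along_line d1 by (intro DERIV_diff) blast+
  qed
  then obtain s where s: "0 < s" "s < h"
    and es: "\<phi> (x + h *\<^sub>R v + h *\<^sub>R u) - \<phi> (x + h *\<^sub>R u) - \<phi> (x + h *\<^sub>R v) + \<phi> x
      = h * (?a (x + h *\<^sub>R v + s *\<^sub>R u) - ?a (x + s *\<^sub>R u))" by auto
  have "\<exists>t>0. t < h \<and> ?a (x + s *\<^sub>R u + h *\<^sub>R v) - ?a (x + s *\<^sub>R u + 0 *\<^sub>R v)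
      = (h - 0) * frechet_derivative ?a (at (x + s *\<^sub>R u + t *\<^sub>R v)) v"
  proof (rule MVT2[OF \<open>0 < h\<close>])
    fix t assume "0 \<le> t" "t \<le> h"
    then have "x + s *\<^sub>R u + t *\<^sub>R v \<in> S" using dom[of s t] s by auto
    then show "((\<lambda>t. ?a (x + s *\<^sub>R u + t *\<^sub>R v)) has_real_derivative
        frechet_derivative ?a (at (x + s *\<^sub>R u + t *\<^sub>R v)) v) (at t)"
      using has_field_derivative_along_line d2 by blast
  qed
  then obtain t where t: "0 < t" "t < h"
    and et: "?a (x + s *\<^sub>R u + h *\<^sub>R v) - ?a (x + s *\<^sub>R u) = h * frechet_derivative ?a (at (x + s *\<^sub>R u + t *\<^sub>R v)) v"
    by auto
  have c: "x + s *\<^sub>R u + h *\<^sub>R v = x + h *\<^sub>R v + s *\<^sub>R u" "x + h *\<^sub>R u + h *\<^sub>R v = x + h *\<^sub>R v + h *\<^sub>R u"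
    by (simp_all add: algebra_simps)
  show ?thesis
    by (rule that[of s t]) (use s t es et c in \<open>auto simp: algebra_simps\<close>)
qed

text \<open>Schwarz's theorem. By \<open>mixed_difference_mvt\<close>, also with \<open>u\<close>
  and \<open>v\<close> exchanged, the two mixed derivatives agree at a pair of points, both as close
  to \<open>x\<close> as desired; continuity transfers this to \<open>x\<close>.\<close>

lemma smooth_on_mixed_derivatives_commute:
  fixes \<phi> :: "'a::real_normed_vector \<Rightarrow> real"
  assumes sm: "smooth_on S \<phi>" and S: "open S" "x \<in> S"
  shows "frechet_derivative (\<lambda>y. frechet_derivative \<phi> (at y) u) (at x) v
       = frechet_derivative (\<lambda>y. frechet_derivative \<phi> (at y) v) (at x) u"
proof -
  define A where "A = (\<lambda>y. frechet_derivative (\<lambda>y. frechet_derivative \<phi> (at y) u) (at y) v)"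
  define B where "B = (\<lambda>y. frechet_derivative (\<lambda>y. frechet_derivative \<phi> (at y) v) (at y) u)"
  have contAB: "isCont A x" "isCont B x"
    unfolding A_def B_def
    using S smooth_on_imp_continuous_on smooth_on_frechet_derivative[OF smooth_on_frechet_derivative[OF sm]]
      continuous_on_eq_continuous_at by blast+
  have "\<bar>A x - B x\<bar> \<le> e" if "0 < e" for e
  proof -
    obtain d1 where d1: "d1 > 0" "\<And>y. dist y x < d1 \<Longrightarrow> dist (A y) (A x) < e/2"
      using contAB(1) \<open>0 < e\<close> unfolding continuous_at_eps_delta by (metis half_gt_zero)
    obtain d2 where d2: "d2 > 0" "\<And>y. dist y x < d2 \<Longrightarrow> dist (B y) (B x) < e/2"
      using contAB(2) \<open>0 < e\<close> unfolding continuous_at_eps_delta by (metis half_gt_zero)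
    obtain d3 where d3: "d3 > 0" "ball x d3 \<subseteq> S" using S open_contains_ball by blast
    define d where "d = min d1 (min d2 d3)"
    \<comment> \<open>The summand 1 makes \<open>N\<close> positive even if both directions vanish,
      and \<open>h * N = d / 2\<close> keeps the parallelogram within distance \<open>d\<close> of
      \<open>x\<close>.\<close>
    define N where "N = norm u + norm v + 1"
    define h where "h = d / (2 * N)"
    have d0: "d > 0" using d1 d2 d3 by (simp add: d_def)
    have n0: "N > 0" by (simp add: N_def add_nonneg_pos)
    have h0: "h > 0" using d0 n0 by (simp add: h_def)
    have close: "dist (x + s *\<^sub>R u + t *\<^sub>R v) x < d" if "s \<in> {0..h}" "t \<in> {0..h}" for s t
    proof -
      have "dist (x + s *\<^sub>R u + t *\<^sub>R v) x = norm (s *\<^sub>R u + t *\<^sub>R v)"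
        by (simp add: dist_norm algebra_simps)
      also have "\<dots> \<le> s * norm u + t * norm v"
        using norm_triangle_ineq[of "s *\<^sub>R u" "t *\<^sub>R v"] that by simp
      also have "\<dots> \<le> h * norm u + h * norm v"
        using that by (intro add_mono mult_right_mono) auto
      also have "\<dots> \<le> h * N" using h0 by (simp add: N_def algebra_simps)
      also have "\<dots> = d / 2" using n0 by (simp add: h_def N_def[symmetric] del: distrib_left_numeral)
    finally show ?thesis using d0 by simp
    qed
    have inS: "x + s *\<^sub>R u + t *\<^sub>R v \<in> S" if "s \<in> {0..h}" "t \<in> {0..h}" for s t
      using close[OF that] d3 by (auto simp: d_def dist_commute)
    obtain s t where st: "s \<in> {0..h}" "t \<in> {0..h}"
      "\<phi> (x + h *\<^sub>R u + h *\<^sub>R v) - \<phi> (x + h *\<^sub>R u) - \<phi> (x + h *\<^sub>R v) + \<phi> x = h * h * A (x + s *\<^sub>R u + t *\<^sub>R v)"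
      unfolding A_def using mixed_difference_mvt[OF h0 inS smooth_on_imp_differentiable[OF sm]
        smooth_on_imp_differentiable[OF smooth_on_frechet_derivative[OF sm]]] by metis
    have inS': "x + s *\<^sub>R v + t *\<^sub>R u \<in> S" if "s \<in> {0..h}" "t \<in> {0..h}" for s t
      using inS[OF that(2,1)] by (simp add: algebra_simps)
    obtain s' t' where st': "s' \<in> {0..h}" "t' \<in> {0..h}"
      "\<phi> (x + h *\<^sub>R v + h *\<^sub>R u) - \<phi> (x + h *\<^sub>R v) - \<phi> (x + h *\<^sub>R u) + \<phi> x = h * h * B (x + s' *\<^sub>R v + t' *\<^sub>R u)"
      unfolding B_def using mixed_difference_mvt[OF h0 inS' smooth_on_imp_differentiable[OF sm]
        smooth_on_imp_differentiable[OF smooth_on_frechet_derivative[OF sm]]] by metis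
    have "h * h * A (x + s *\<^sub>R u + t *\<^sub>R v) = h * h * B (x + s' *\<^sub>R v + t' *\<^sub>R u)"
      using st(3) st'(3) by (simp add: algebra_simps)
    then have AB: "A (x + s *\<^sub>R u + t *\<^sub>R v) = B (x + s' *\<^sub>R v + t' *\<^sub>R u)"
      using h0 by simp
    have "dist (A (x + s *\<^sub>R u + t *\<^sub>R v)) (A x) < e/2"
      using close[OF st(1,2)] by (intro d1) (simp add: d_def)
    moreover have "dist (B (x + s' *\<^sub>R v + t' *\<^sub>R u)) (B x) < e/2"
      using close[OF st'(2,1)] by (intro d2) (simp add: d_def algebra_simps)
    ultimately show ?thesis using AB unfolding dist_real_def by linarith
  qed
  then have "A x = B x" by (metis abs_ge_zero eq_iff_diff_eq_0 abs_eq_0 dense_ge order_antisym)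
  then show ?thesis by (simp add: A_def B_def)
qed

section \<open>Fields of bilinear maps\<close>

text \<open>Reduces a field of bilinear maps to finitely many coefficient functions, from which the
  product rule below is obtained.\<close>

lemma bilinear_Basis_expand:
  fixes B :: "'v::euclidean_space \<Rightarrow> 'w::euclidean_space \<Rightarrow> 'z::real_vector"
  assumes "bilinear B"
  shows "B v w = (\<Sum>b\<in>Basis. \<Sum>c\<in>Basis. ((v \<bullet> b) * (w \<bullet> c)) *\<^sub>R B b c)"
proof -
  have l: "linear (B v)" "linear (\<lambda>v. B v w)" for v w using assms by (auto simp: bilinear_def)
  have 1: "B v w = (\<Sum>b\<in>Basis. (v \<bullet> b) *\<^sub>R B b w)" for v
    using linear_sum[OF l(2), of "\<lambda>b. (v \<bullet> b) *\<^sub>R b" Basis w] linear_cmul[OF l(2)]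
    by (simp add: euclidean_representation)
  have 2: "B v w = (\<Sum>c\<in>Basis. (w \<bullet> c) *\<^sub>R B v c)" for v
    using linear_sum[OF l(1), of v "\<lambda>b. (w \<bullet> b) *\<^sub>R b" Basis] linear_cmul[OF l(1)]
    by (simp add: euclidean_representation)
  show ?thesis by (subst 1, subst 2) (simp add: scaleR_sum_right)
qed

text \<open>Covers at once the metric of the fiber and the Christoffel symbols of both the fiber and
  the spacetime; hence the general target space. Differentiability is demanded for fixed arguments,
  which is the form that smoothness of the metric has in \<open>riemannian_manifold\<close>.\<close>

locale bilinear_field =
  fixes S :: "'e::euclidean_space set"
    and B :: "'e \<Rightarrow> 'v::euclidean_space \<Rightarrow> 'w::euclidean_space \<Rightarrow> 'z::real_normed_vector"
  assumes open_domain: "open S"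
    and bilinear: "x \<in> S \<Longrightarrow> bilinear (B x)"
    and differentiable: "x \<in> S \<Longrightarrow> (\<lambda>y. B y v w) differentiable (at x)"
begin

abbreviation "dB \<equiv> \<lambda>x u v w. frechet_derivative (\<lambda>y. B y v w) (at x) u"

lemma linear_right: "x \<in> S \<Longrightarrow> linear (B x v)"
  and linear_left: "x \<in> S \<Longrightarrow> linear (\<lambda>v. B x v w)"
  using bilinear unfolding bilinear_def by auto

lemmas add_right = linear_add[OF linear_right]
  and add_left = linear_add[OF linear_left]
  and diff_right = linear_diff[OF linear_right]
  and diff_left = linear_diff[OF linear_left]
  and neg_right = linear_neg[OF linear_right]
  and neg_left = linear_neg[OF linear_left]
  and scale_right = linear_cmul[OF linear_right]
  and scale_left = linear_cmul[OF linear_left]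
  and zero_right = linear_0[OF linear_right]
  and zero_left = linear_0[OF linear_left]

lemma has_derivative: "x \<in> S \<Longrightarrow> ((\<lambda>y. B y v w) has_derivative (\<lambda>u. dB x u v w)) (at x)"
  using differentiable frechet_derivative_works by blast

lemma linear_direction: "x \<in> S \<Longrightarrow> linear (\<lambda>u. dB x u v w)"
  using has_derivative has_derivative_linear by blast

lemma derivative_transform:
  assumes "x \<in> S" "\<And>y. y \<in> S \<Longrightarrow> f y = g y" "(f has_derivative f') (at x)"
  shows "frechet_derivative g (at x) u = f' u"
  using has_derivative_transform_within_open[OF assms(3) open_domain assms(1,2)] frechet_derivative_at
  by metis

lemma bilinear_derivative: assumes "x \<in> S" shows "bilinear (dB x u)"
  unfolding bilinear_def
proof (intro conjI allI linearI)
  fix v w w' and r :: real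
  show "dB x u v (w + w') = dB x u v w + dB x u v w'"
    by (rule derivative_transform[OF assms _ has_derivative_add[OF has_derivative has_derivative, OF assms assms]])
       (simp add: add_right)
  show "dB x u v (r *\<^sub>R w) = r *\<^sub>R dB x u v w"
    by (rule derivative_transform[OF assms _ has_derivative_scaleR_right[OF has_derivative, OF assms]])
       (simp add: scale_right)
next
  fix v v' w and r :: real
  show "dB x u (v + v') w = dB x u v w + dB x u v' w"
    by (rule derivative_transform[OF assms _ has_derivative_add[OF has_derivative has_derivative, OF assms assms]])
       (simp add: add_left)
  show "dB x u (r *\<^sub>R v) w = r *\<^sub>R dB x u v w"
    by (rule derivative_transform[OF assms _ has_derivative_scaleR_right[OF has_derivative, OF assms]])
       (simp add: scale_left)
qed

text \<open>The product rule when the base point and both arguments move: after expansion in the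
  basis, every summand is a product of real functions with a coefficient composed with
  \<open>x\<close>.\<close>

lemma has_vector_derivative_along:
  assumes x: "(x has_vector_derivative x') (at t)" and v: "(v has_vector_derivative v') (at t)"
    and w: "(w has_vector_derivative w') (at t)" and S: "x t \<in> S"
  shows "((\<lambda>t. B (x t) (v t) (w t)) has_vector_derivative
     dB (x t) x' (v t) (w t) + B (x t) v' (w t) + B (x t) (v t) w') (at t)"
proof -
  have comp: "((\<lambda>t. B (x t) b c) has_vector_derivative dB (x t) x' b c) (at t)" for b c
    using vector_derivative_diff_chain_within[OF x has_derivative_at_withinI[OF has_derivative[OF S]], of b c]
    by (simp add: comp_def)
  have vb: "((\<lambda>t. v t \<bullet> b) has_vector_derivative v' \<bullet> b) (at t)" for b
    using v bounded_linear.has_vector_derivative[OF bounded_linear_inner_left] by blast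
  have wb: "((\<lambda>t. w t \<bullet> b) has_vector_derivative w' \<bullet> b) (at t)" for b
    using w bounded_linear.has_vector_derivative[OF bounded_linear_inner_left] by blast
  have vw: "((\<lambda>t. (v t \<bullet> b) * (w t \<bullet> c)) has_vector_derivative (v' \<bullet> b) * (w t \<bullet> c) + (v t \<bullet> b) * (w' \<bullet> c)) (at t)"
    for b c using has_vector_derivative_mult[OF vb wb] by (simp add: add.commute)
  have "((\<lambda>t. \<Sum>b\<in>Basis. \<Sum>c\<in>Basis. ((v t \<bullet> b) * (w t \<bullet> c)) *\<^sub>R B (x t) b c) has_vector_derivative
     (\<Sum>b\<in>Basis. \<Sum>c\<in>Basis. ((v t \<bullet> b) * (w t \<bullet> c)) *\<^sub>R dB (x t) x' b c
        + ((v' \<bullet> b) * (w t \<bullet> c) + (v t \<bullet> b) * (w' \<bullet> c)) *\<^sub>R B (x t) b c)) (at t)"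
    by (intro has_vector_derivative_sum has_vector_derivative_scaleR comp
          vw[unfolded has_real_derivative_iff_has_vector_derivative[symmetric]])
  moreover have "(\<Sum>b\<in>Basis. \<Sum>c\<in>Basis. ((v t \<bullet> b) * (w t \<bullet> c)) *\<^sub>R dB (x t) x' b c
        + ((v' \<bullet> b) * (w t \<bullet> c) + (v t \<bullet> b) * (w' \<bullet> c)) *\<^sub>R B (x t) b c)
     = dB (x t) x' (v t) (w t) + B (x t) v' (w t) + B (x t) (v t) w'"
    unfolding bilinear_Basis_expand[OF bilinear_derivative[OF S], of "v t" "w t"]
        bilinear_Basis_expand[OF bilinear[OF S], of v' "w t"]
        bilinear_Basis_expand[OF bilinear[OF S], of "v t" w']
    by (simp add: scaleR_add_left sum.distrib)
  ultimately have *: "((\<lambda>t. \<Sum>b\<in>Basis. \<Sum>c\<in>Basis. ((v t \<bullet> b) * (w t \<bullet> c)) *\<^sub>R B (x t) b c) has_vector_derivative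
     dB (x t) x' (v t) (w t) + B (x t) v' (w t) + B (x t) (v t) w') (at t)" by simp
  \<comment> \<open>Bilinearity, and with it the expansion, is known only while \<open>x s\<close>
    lies in \<open>S\<close>; by continuity, this holds near \<open>t\<close>.\<close>
  have "isCont x t" using x has_vector_derivative_continuous by blast
  then have "(x \<longlongrightarrow> x t) (nhds t)" by (simp add: isCont_def tendsto_at_iff_tendsto_nhds)
  then have "\<forall>\<^sub>F s in nhds t. x s \<in> S" using open_domain S by (rule topological_tendstoD)
  then obtain U where U: "open U" "t \<in> U" "\<And>s. s \<in> U \<Longrightarrow> x s \<in> S"
    unfolding eventually_nhds by blast
  show ?thesis
  proof (rule has_vector_derivative_transform_within_open[OF * U(1,2)])
    fix s assume "s \<in> U"
    show "(\<Sum>b\<in>Basis. \<Sum>c\<in>Basis. ((v s \<bullet> b) * (w s \<bullet> c)) *\<^sub>R B (x s) b c) = B (x s) (v s) (w s)"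
      by (rule bilinear_Basis_expand[OF bilinear[OF U(3)[OF \<open>s \<in> U\<close>]], symmetric])
  qed
qed

end

section \<open>The Levi-Civita connection in a chart\<close>

text \<open>The formula of \<open>christoffel\<close>, detached from the atlas so that it can be
  applied to any field of forms in a chart, in particular to the warped metric.\<close>

definition koszul_christoffel :: "('e::euclidean_space \<Rightarrow> 'e \<Rightarrow> 'e \<Rightarrow> real) \<Rightarrow> 'e \<Rightarrow> 'e \<Rightarrow> 'e \<Rightarrow> 'e" where
  "koszul_christoffel g x v w =
     (let D = (\<lambda>u a b. frechet_derivative (\<lambda>y. g y a b) (at x) u) in
      THE z. \<forall>u. g x z u = (D v w u + D w v u - D u v w) / 2)"

lemma christoffel_eq: "christoffel M i = koszul_christoffel (metric M i)"
  by (simp add: fun_eq_iff christoffel_def koszul_christoffel_def)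

text \<open>The map which sends \<open>z\<close> to the vector of the values \<open>B z b\<close> on
  the basis is injective by nondegeneracy, hence surjective by dimension.\<close>

lemma bilinear_nondegenerate_representation:
  fixes B :: "'e::euclidean_space \<Rightarrow> 'e \<Rightarrow> real"
  assumes "bilinear B" and nondeg: "\<And>z. (\<And>u. B z u = 0) \<Longrightarrow> z = 0" and "linear l"
  obtains z where "\<And>u. B z u = l u"
proof -
  have lB: "linear (B v)" "linear (\<lambda>v. B v w)" for v w using assms(1) by (auto simp: bilinear_def)
  have ex: "k u = (\<Sum>b\<in>Basis. (u \<bullet> b) *\<^sub>R k b)" if "linear k" for k :: "'e \<Rightarrow> real" and u
  proof -
    have "k u = k (\<Sum>b\<in>Basis. (u \<bullet> b) *\<^sub>R b)" by (simp add: euclidean_representation)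
    also have "\<dots> = (\<Sum>b\<in>Basis. k ((u \<bullet> b) *\<^sub>R b))" by (rule linear_sum[OF that])
    finally show ?thesis by (simp add: linear_cmul[OF that])
  qed
  define A where "A z = (\<Sum>b\<in>Basis. B z b *\<^sub>R b)" for z
  have A: "A z \<bullet> b = B z b" if "b \<in> Basis" for z b
    using that by (simp add: A_def inner_sum_left inner_Basis if_distrib cong: if_cong)
  have "linear A" unfolding A_def
    by (rule linearI) (simp_all add: linear_add[OF lB(2)] linear_cmul[OF lB(2)] scaleR_add_left sum.distrib scaleR_sum_right)
  moreover have "inj A"
  proof (rule injI)
    fix y z assume "A y = A z"
    then have "B y b = B z b" if "b \<in> Basis" for b using A that by metis
    then have "B (y - z) u = 0" for u
      using ex[OF lB(1), of y u] ex[OF lB(1), of z u] linear_diff[OF lB(2), of y z u] by simp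
    then show "y = z" using nondeg[of "y - z"] by simp
  qed
  ultimately have "surj A" by (rule linear_inj_imp_surj)
  then obtain z where z: "A z = (\<Sum>b\<in>Basis. l b *\<^sub>R b)" by (metis surjD)
  have "B z b = l b" if "b \<in> Basis" for b
    using A[OF that, of z] that unfolding z
    by (simp add: inner_sum_left inner_Basis if_distrib cong: if_cong)
  then have "B z u = l u" for u
    using ex[OF lB(1), of z u] ex[OF \<open>linear l\<close>, of u] by simp
  then show ?thesis by (rule that)
qed

text \<open>Nondegeneracy gives uniqueness in the definite description. Stated in these terms so as
  to serve both the Riemannian metric and the Lorentzian metric \<open>wg\<close>.\<close>

lemma koszul_christoffelI:
  fixes g :: "'e::euclidean_space \<Rightarrow> 'e \<Rightarrow> 'e \<Rightarrow> real"
  assumes "bilinear (g x)" and "\<And>z. (\<And>u. g x z u = 0) \<Longrightarrow> z = 0"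
    and "\<And>u. g x z u = (frechet_derivative (\<lambda>y. g y w u) (at x) v + frechet_derivative (\<lambda>y. g y v u) (at x) w
        - frechet_derivative (\<lambda>y. g y v w) (at x) u) / 2"
  shows "koszul_christoffel g x v w = z"
  unfolding koszul_christoffel_def Let_def
proof (rule the_equality)
  have l: "linear (\<lambda>v. g x v w)" for w using assms(1) by (auto simp: bilinear_def)
  fix z' assume z': "\<forall>u. g x z' u = (frechet_derivative (\<lambda>y. g y w u) (at x) v + frechet_derivative (\<lambda>y. g y v u) (at x) w
        - frechet_derivative (\<lambda>y. g y v w) (at x) u) / 2"
  have "g x z' u = g x z u" for u using spec[OF z', of u] assms(3)[of u] by simp
  then have "g x (z' - z) u = 0" for u using linear_diff[OF l] by simp
  then show "z' = z" using assms(2)[of "z' - z"] by simp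
qed (use assms in simp)

locale riemannian_chart =
  fixes S :: "'e::euclidean_space set" and g :: "'e \<Rightarrow> 'e \<Rightarrow> 'e \<Rightarrow> real"
  assumes open_chart: "open S"
    and smooth: "smooth_on S (\<lambda>x. g x v w)"
    and g_bilinear: "x \<in> S \<Longrightarrow> bilinear (g x)"
    and g_sym: "x \<in> S \<Longrightarrow> g x v w = g x w v"
    and g_pos: "x \<in> S \<Longrightarrow> v \<noteq> 0 \<Longrightarrow> g x v v > 0"
begin

sublocale G: bilinear_field S g
  by unfold_locales (auto intro: open_chart g_bilinear smooth_on_imp_differentiable[OF smooth])

abbreviation "\<Gamma> \<equiv> koszul_christoffel g"
abbreviation "dg \<equiv> \<lambda>x u v w. frechet_derivative (\<lambda>y. g y v w) (at x) u"

lemma g_nondegenerate: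
  assumes "x \<in> S" "\<And>u. g x z u = 0" shows "z = 0"
  using g_pos[OF assms(1), of z] assms(2)[of z] by auto

lemma g_cong: assumes "x \<in> S" "\<And>u. g x z u = g x z' u" shows "z = z'"
  using g_nondegenerate[OF assms(1), of "z - z'"] assms by (simp add: G.diff_left)

lemma dg_sym: assumes "x \<in> S" shows "dg x u v w = dg x u w v"
  by (rule G.derivative_transform[OF assms _ G.has_derivative[OF assms]]) (simp add: g_sym)

lemma dg_linear:
  assumes "x \<in> S"
  shows "linear (dg x u v)" "linear (\<lambda>v. dg x u v w)" "linear (\<lambda>u. dg x u v w)"
  using G.bilinear_derivative[OF assms] G.linear_direction[OF assms] unfolding bilinear_def by auto

lemmas dg_linear_simps =
  linear_add[OF dg_linear(1)] linear_add[OF dg_linear(2)] linear_add[OF dg_linear(3)]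
  linear_cmul[OF dg_linear(1)] linear_cmul[OF dg_linear(2)] linear_cmul[OF dg_linear(3)]

definition koszul where "koszul x v w u = (dg x v w u + dg x w v u - dg x u v w) / 2"

lemma linear_koszul: assumes "x \<in> S" shows "linear (koszul x v w)"
  unfolding koszul_def by (rule linearI) (simp_all add: dg_linear_simps assms field_simps)

lemma koszul_formula: assumes x: "x \<in> S" shows "g x (\<Gamma> x v w) u = koszul x v w u"
proof -
  obtain z where z: "\<And>u. g x z u = koszul x v w u"
    using bilinear_nondegenerate_representation[OF g_bilinear[OF x] g_nondegenerate[OF x] linear_koszul[OF x]]
    by blast
  have "\<Gamma> x v w = z"
    by (rule koszul_christoffelI) (use x z g_bilinear g_nondegenerate in \<open>auto simp: koszul_def\<close>)
  then show ?thesis using z by simp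
qed

lemma \<Gamma>_sym: assumes "x \<in> S" shows "\<Gamma> x v w = \<Gamma> x w v"
  by (rule g_cong[OF assms]) (simp add: koszul_formula[OF assms] koszul_def dg_sym[OF assms])

lemma \<Gamma>_linear: assumes "x \<in> S" shows "linear (\<Gamma> x v)"
proof (rule linearI)
  show "\<Gamma> x v (w + w') = \<Gamma> x v w + \<Gamma> x v w'" for w w'
    by (rule g_cong[OF assms])
       (simp add: G.add_left koszul_formula koszul_def dg_linear_simps assms field_simps)
  show "\<Gamma> x v (r *\<^sub>R w) = r *\<^sub>R \<Gamma> x v w" for r w
    by (rule g_cong[OF assms])
       (simp add: G.scale_left koszul_formula koszul_def dg_linear_simps assms field_simps)
qed

lemma \<Gamma>_bilinear: assumes "x \<in> S" shows "bilinear (\<Gamma> x)"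
  using \<Gamma>_linear[OF assms] \<Gamma>_sym[OF assms] unfolding bilinear_def by simp

lemma koszul_differentiable:
  assumes "x \<in> S" shows "(\<lambda>y. koszul y v w u) differentiable (at x)"
  unfolding koszul_def
  by (intro derivative_intros smooth_on_imp_differentiable[OF smooth_on_frechet_derivative[OF smooth] assms]) auto

section \<open>Differentiability of the Christoffel symbols\<close>

lemma dual_basis:
  assumes x: "x \<in> S" obtains d where "\<And>z. g x z d = z \<bullet> b"
proof -
  obtain d where "\<And>z. g x d z = b \<bullet> z"
    using bilinear_nondegenerate_representation[OF g_bilinear[OF x] g_nondegenerate[OF x], of "\<lambda>z. b \<bullet> z"]
      bounded_linear_inner_right[THEN bounded_linear.linear] by blast
  then show ?thesis using that g_sym[OF x] by (metis inner_commute)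
qed

end

text \<open>As \<open>q\<close> vanishes at \<open>x\<close>, the deviation of \<open>p\<close> from
  \<open>p x\<close> contributes the product of a null function and one of order
  \<open>norm h\<close>; therefore continuity of \<open>p\<close> takes the place of
  differentiability.\<close>

lemma has_derivative_mult_vanishing:
  fixes p q :: "'a::real_normed_vector \<Rightarrow> real"
  assumes p: "isCont p x" and q: "(q has_derivative q') (at x)" and "q x = 0"
  shows "((\<lambda>y. p y * q y) has_derivative (\<lambda>h. p x * q' h)) (at x)"
proof -
  have bl: "bounded_linear q'" using q by (rule has_derivative_bounded_linear)
  then obtain K where K: "\<And>h. norm (q' h) \<le> norm h * K" using bounded_linear.bounded by metis
  have lq: "((\<lambda>h. norm (q (x + h) - q x - q' h) / norm h) \<longlongrightarrow> 0) (at 0)"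
    using q by (simp add: has_derivative_at)
  have lp: "((\<lambda>h. \<bar>p (x + h) - p x\<bar>) \<longlongrightarrow> 0) (at 0)"
    using p by (simp add: isCont_iff LIM_zero tendsto_rabs_zero)
  have "((\<lambda>h. (p (x + h) - p x) * q (x + h) / norm h) \<longlongrightarrow> 0) (at 0)"
  proof (rule Lim_null_comparison)
    show "((\<lambda>h. \<bar>p (x + h) - p x\<bar> * (norm (q (x + h) - q x - q' h) / norm h + K)) \<longlongrightarrow> 0) (at 0)"
      using tendsto_mult[OF lp tendsto_add[OF lq tendsto_const[of K]]] by simp
    show "\<forall>\<^sub>F h in at 0. norm ((p (x + h) - p x) * q (x + h) / norm h)
        \<le> \<bar>p (x + h) - p x\<bar> * (norm (q (x + h) - q x - q' h) / norm h + K)"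
    proof (rule eventually_at_topological[THEN iffD2], intro exI[of _ UNIV] conjI ballI impI)
      fix h :: 'a assume "h \<noteq> 0"
      then have n: "norm h > 0" by simp
      have "\<bar>q (x + h)\<bar> \<le> norm (q (x + h) - q x - q' h) + norm h * K"
        using K[of h] \<open>q x = 0\<close> by simp
      then have "\<bar>q (x + h)\<bar> / norm h \<le> (norm (q (x + h) - q x - q' h) + norm h * K) / norm h"
        using n by (simp add: divide_right_mono)
      also have "\<dots> = norm (q (x + h) - q x - q' h) / norm h + K" using n by (simp add: add_divide_distrib)
      finally show "norm ((p (x + h) - p x) * q (x + h) / norm h)
        \<le> \<bar>p (x + h) - p x\<bar> * (norm (q (x + h) - q x - q' h) / norm h + K)"
        by (simp add: abs_mult mult_left_mono flip: times_divide_eq_right)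
    qed auto
  qed
  then have "((\<lambda>h. norm ((p (x + h) - p x) * q (x + h) - (p x - p x) * q x - 0) / norm h) \<longlongrightarrow> 0) (at 0)"
    by (drule_tac tendsto_rabs_zero) (simp add: abs_divide)
  then have 1: "((\<lambda>y. (p y - p x) * q y) has_derivative (\<lambda>h. 0)) (at x)"
    by (simp add: has_derivative_at bounded_linear_zero)
  have "((\<lambda>y. p x * q y + (p y - p x) * q y) has_derivative (\<lambda>h. p x * q' h + 0)) (at x)"
    by (rule has_derivative_add[OF has_derivative_mult_right[OF q] 1])
  then show ?thesis by (simp add: algebra_simps)
qed

context riemannian_chart
begin

text \<open>The Koszul formula determines \<open>\<Gamma>\<close> only implicitly, through the
  metric at the moving point. Pairing with the vectors \<open>d b\<close>, dual to the basis with
  respect to the metric frozen at \<open>x\<close>, turns it into the identity \<open>key\<close>,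
  whose perturbation \<open>e\<close> vanishes at \<open>x\<close>. From this follow, in turn,
  boundedness, continuity and differentiability.\<close>

lemma \<Gamma>_differentiable:
  assumes x: "x \<in> S"
  shows "(\<lambda>y. \<Gamma> y v w) differentiable (at x)"
proof -
  have "\<exists>d. \<forall>z. g x z d = z \<bullet> b" for b using dual_basis[OF x, of b] by metis
  then obtain d where d: "\<And>z b. g x z (d b) = z \<bullet> b" by metis
  define z where "z y = \<Gamma> y v w" for y
  define e where "e c b y = g y c (d b) - g x c (d b)" for c b y
  define k where "k b y = koszul y v w (d b)" for b y
  have expand: "g y' (z y) u = (\<Sum>c\<in>Basis. (z y \<bullet> c) * g y' c u)" if "y' \<in> S" for y y' u
    using linear_sum[OF G.linear_left[OF that], of "\<lambda>b. (z y \<bullet> b) *\<^sub>R b" Basis u]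
    by (simp add: euclidean_representation G.scale_left[OF that])
  have key: "z y \<bullet> b = k b y - (\<Sum>c\<in>Basis. (z y \<bullet> c) * e c b y)" if "y \<in> S" for y b
  proof -
    have "k b y = g y (z y) (d b)" unfolding z_def k_def using koszul_formula[OF that] by simp
    then show ?thesis
      using expand[OF x, of y "d b"] expand[OF that, of y "d b"] d
      by (simp add: e_def right_diff_distrib sum_subtractf)
  qed
  have e_diff: "e c b differentiable (at x)" for c b
    unfolding e_def by (intro derivative_intros G.differentiable x)
  have e_cont: "isCont (e c b) x" and e_x: "e c b x = 0" for c b
    using differentiable_imp_continuous_within[OF e_diff] by (auto simp: e_def)
  have k_cont: "isCont (k b) x" for b
    unfolding k_def using koszul_differentiable[OF x] differentiable_imp_continuous_within by blast
  define N where "N y = (\<Sum>b\<in>Basis. \<bar>z y \<bullet> b\<bar>)" for y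
  define K where "K y = (\<Sum>b\<in>Basis. \<bar>k b y\<bar>)" for y
  define E where "E y = (\<Sum>b\<in>Basis. \<Sum>c\<in>Basis. \<bar>e c b y\<bar>)" for y
  have N0: "N y \<ge> 0" for y by (auto simp: N_def intro: sum_nonneg)
  have E_lim: "(E \<longlongrightarrow> 0) (at x)"
  proof -
    have "(E \<longlongrightarrow> (\<Sum>b::'e\<in>Basis. \<Sum>c::'e\<in>Basis. \<bar>e c b x\<bar>)) (at x)" unfolding E_def
      by (intro tendsto_sum tendsto_rabs) (use e_cont in \<open>simp add: isCont_def\<close>)
    then show ?thesis by (simp add: e_x)
  qed
  have K_lim: "(K \<longlongrightarrow> K x) (at x)" unfolding K_def
    by (intro tendsto_sum tendsto_rabs) (use k_cont in \<open>simp add: isCont_def\<close>)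
  have le_N: "\<bar>\<Sum>c\<in>Basis. (z y \<bullet> c) * e c b y\<bar> \<le> (\<Sum>c\<in>Basis. N y * \<bar>e c b y\<bar>)" for y b
  proof (rule order_trans[OF sum_abs], rule sum_mono)
    fix c :: 'e assume "c \<in> Basis"
    then have "\<bar>z y \<bullet> c\<bar> \<le> N y" unfolding N_def by (intro member_le_sum) auto
    then show "\<bar>z y \<bullet> c * e c b y\<bar> \<le> N y * \<bar>e c b y\<bar>" by (simp add: abs_mult mult_right_mono)
  qed
  have le_NE: "\<bar>\<Sum>c\<in>Basis. (z y \<bullet> c) * e c b y\<bar> \<le> N y * E y" if "b \<in> Basis" for y b
  proof -
    have "(\<Sum>c\<in>Basis. N y * \<bar>e c b y\<bar>) \<le> N y * E y"
      unfolding E_def sum_distrib_left[symmetric]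
      by (intro mult_left_mono N0 member_le_sum[of b Basis "\<lambda>b. \<Sum>c\<in>Basis. \<bar>e c b y\<bar>"] that sum_nonneg) auto
    then show ?thesis using le_N[where y=y and b=b] by linarith
  qed
  \<comment> \<open>Near \<open>x\<close> the factor \<open>E y\<close> is less than 1/2, so that
    the last term can be absorbed in the left-hand side: this bounds \<open>N\<close> by
    \<open>2 * K\<close>.\<close>
  have N_le: "N y \<le> K y + N y * E y" if "y \<in> S" for y
  proof -
    have "N y \<le> (\<Sum>b\<in>Basis. \<bar>k b y\<bar> + (\<Sum>c\<in>Basis. N y * \<bar>e c b y\<bar>))" unfolding N_def
    proof (rule sum_mono)
      fix b :: 'e
      show "\<bar>z y \<bullet> b\<bar> \<le> \<bar>k b y\<bar> + (\<Sum>c\<in>Basis. (\<Sum>b\<in>Basis. \<bar>z y \<bullet> b\<bar>) * \<bar>e c b y\<bar>)"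
        using key[OF that, of b] le_N[where y=y and b=b] unfolding N_def by linarith
    qed
    then show ?thesis by (simp add: sum.distrib K_def E_def sum_distrib_left)
  qed
  have "\<forall>\<^sub>F y in at x. E y < 1/2" using E_lim by (rule order_tendstoD) simp
  moreover have inS: "\<forall>\<^sub>F y in at x. y \<in> S" using open_chart x by (simp add: eventually_at_in_open')
  ultimately have bound: "\<forall>\<^sub>F y in at x. N y \<le> 2 * K y"
  proof eventually_elim
    case (elim y)
    have "N y * E y \<le> N y * (1/2)" using elim N0 by (intro mult_left_mono) auto
    then show ?case using N_le[OF elim(2)] by linarith
  qed
  have cont: "isCont (\<lambda>y. z y \<bullet> b) x" if "b \<in> Basis" for b
  proof -
    have "((\<lambda>y. \<Sum>c\<in>Basis. (z y \<bullet> c) * e c b y) \<longlongrightarrow> 0) (at x)"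
    proof (rule Lim_null_comparison)
      show "\<forall>\<^sub>F y in at x. norm (\<Sum>c\<in>Basis. z y \<bullet> c * e c b y) \<le> 2 * K y * E y"
        using bound
      proof eventually_elim
        case (elim y)
        have "E y \<ge> 0" by (auto simp: E_def intro!: sum_nonneg)
        then show ?case using le_NE[OF that, of y] mult_right_mono[OF elim, of "E y"] by simp
      qed
      show "((\<lambda>y. 2 * K y * E y) \<longlongrightarrow> 0) (at x)"
        using tendsto_mult[OF tendsto_mult[OF tendsto_const[of 2] K_lim] E_lim] by simp
    qed
    then have "((\<lambda>y. k b y - (\<Sum>c\<in>Basis. (z y \<bullet> c) * e c b y)) \<longlongrightarrow> k b x - 0) (at x)"
      by (intro tendsto_diff) (use k_cont in \<open>simp_all add: isCont_def\<close>)
    moreover have "k b x = z x \<bullet> b" using key[OF x, of b] by (simp add: e_x)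
    ultimately have "((\<lambda>y. k b y - (\<Sum>c\<in>Basis. (z y \<bullet> c) * e c b y)) \<longlongrightarrow> z x \<bullet> b) (at x)" by simp
    then show ?thesis unfolding isCont_def
      by (rule Lim_transform_eventually) (use inS key in \<open>auto elim!: eventually_mono\<close>)
  qed
  \<comment> \<open>\<open>e\<close> is differentiable and vanishes at \<open>x\<close>, and
    \<open>z\<close> is now known to be continuous there, so that
    \<open>has_derivative_mult_vanishing\<close> applies to the products in
    \<open>key\<close>.\<close>
  have "(\<lambda>y. z y \<bullet> b) differentiable (at x)" if "b \<in> Basis" for b
  proof -
    have "(\<lambda>y. (z y \<bullet> c) * e c b y) differentiable (at x)" if "c \<in> Basis" for c
      using has_derivative_mult_vanishing[OF cont[OF that] e_diff[unfolded frechet_derivative_works] e_x]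
      unfolding differentiable_def by blast
    then have "(\<lambda>y. k b y - (\<Sum>c\<in>Basis. (z y \<bullet> c) * e c b y)) differentiable (at x)"
      unfolding k_def by (intro differentiable_diff differentiable_sum koszul_differentiable x) auto
    then obtain D where "((\<lambda>y. k b y - (\<Sum>c\<in>Basis. (z y \<bullet> c) * e c b y)) has_derivative D) (at x)"
      unfolding differentiable_def by blast
    then have "((\<lambda>y. z y \<bullet> b) has_derivative D) (at x)"
      by (rule has_derivative_transform_within_open[OF _ open_chart x]) (simp add: key)
    then show ?thesis unfolding differentiable_def by blast
  qed
  then have "z differentiable (at x)" by (subst differentiable_componentwise_within) simp
  then show ?thesis by (simp add: z_def[abs_def])
qed

sublocale C: bilinear_field S \<Gamma>
  by unfold_locales (auto intro: open_chart \<Gamma>_bilinear \<Gamma>_differentiable)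

lemma metric_compatible:
  assumes "x \<in> S" shows "dg x u v w = g x (\<Gamma> x u v) w + g x v (\<Gamma> x u w)"
proof -
  have "g x v (\<Gamma> x u w) = koszul x u w v" using g_sym[OF assms] koszul_formula[OF assms] by simp
  then show ?thesis
    unfolding koszul_formula[OF assms] koszul_def
    using dg_sym[OF assms, where u = u and v = v and w = w] by (simp add: field_simps)
qed

end

section \<open>Skew symmetry of the curvature\<close>

definition chart_curvature ::
    "('e::euclidean_space \<Rightarrow> 'e \<Rightarrow> 'e \<Rightarrow> 'e) \<Rightarrow> 'e \<Rightarrow> 'e \<Rightarrow> 'e \<Rightarrow> 'e \<Rightarrow> 'e" where
  "chart_curvature \<Gamma> x u v w =
      frechet_derivative (\<lambda>y. \<Gamma> y v w) (at x) u - frechet_derivative (\<lambda>y. \<Gamma> y u w) (at x) v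
      + \<Gamma> x u (\<Gamma> x v w) - \<Gamma> x v (\<Gamma> x u w)"

lemma curvature_eq: "curvature M i = chart_curvature (christoffel M i)"
  by (simp add: fun_eq_iff curvature_def chart_curvature_def Let_def)

text \<open>By metric compatibility there remain the second derivatives of \<open>g x w w\<close> in
  both orders, which agree, and two products of Christoffel terms, which cancel by the symmetry of
  \<open>g\<close>. This makes the curvature term of the Jacobi equation orthogonal to the
  velocity.\<close>

lemma (in riemannian_chart) curvature_skew:
  assumes x: "x \<in> S"
  shows "g x (chart_curvature \<Gamma> x u v w) w = 0"
proof -
  \<comment> \<open>Obtained by differentiating \<open>g (\<Gamma> v w) w\<close> in the direction
    \<open>u\<close>, once by the product rule and once as \<open>dg v w w / 2\<close>, which it is
    by the Koszul formula with the argument \<open>w\<close> repeated.\<close>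
  have *: "g x (frechet_derivative (\<lambda>y. \<Gamma> y v w) (at x) u) w =
      frechet_derivative (\<lambda>y. dg y v w w) (at x) u / 2 - dg x u (\<Gamma> x v w) w" for u v
  proof -
    define c where "c t = x + t *\<^sub>R u" for t
    have c: "(c has_vector_derivative u) (at 0)" unfolding c_def by (auto intro!: derivative_eq_intros)
    have c0: "c 0 = x" by (simp add: c_def)
    have "((\<lambda>t. \<Gamma> (c t) v w) has_vector_derivative frechet_derivative (\<lambda>y. \<Gamma> y v w) (at x) u) (at 0)"
      using C.has_vector_derivative_along[OF c has_vector_derivative_const has_vector_derivative_const, of v w]
      by (simp add: c0 x C.zero_left C.zero_right)
    from G.has_vector_derivative_along[OF c this has_vector_derivative_const, of w]
    have 1: "((\<lambda>t. g (c t) (\<Gamma> (c t) v w) w) has_vector_derivative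
       dg x u (\<Gamma> x v w) w + g x (frechet_derivative (\<lambda>y. \<Gamma> y v w) (at x) u) w) (at 0)"
      by (simp add: c0 x G.zero_right)
    have "isCont c 0" using c has_vector_derivative_continuous by blast
    then have "(c \<longlongrightarrow> c 0) (nhds 0)" by (simp add: isCont_def tendsto_at_iff_tendsto_nhds)
    then have "\<forall>\<^sub>F s in nhds 0. c s \<in> S" by (rule topological_tendstoD) (use x c0 open_chart in auto)
    then obtain U where U: "open U" "0 \<in> U" "\<And>s. s \<in> U \<Longrightarrow> c s \<in> S" unfolding eventually_nhds by blast
    have 2: "((\<lambda>t. dg (c t) v w w / 2) has_vector_derivative
       dg x u (\<Gamma> x v w) w + g x (frechet_derivative (\<lambda>y. \<Gamma> y v w) (at x) u) w) (at 0)"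
      by (rule has_vector_derivative_transform_within_open[OF 1 U(1,2)])
         (simp add: koszul_formula[OF U(3)] koszul_def)
    have "((\<lambda>y. dg y v w w) has_derivative frechet_derivative (\<lambda>y. dg y v w w) (at x)) (at (c 0))"
      using smooth_on_imp_differentiable[OF smooth_on_frechet_derivative[OF smooth] x]
        frechet_derivative_works c0 by metis
    from vector_derivative_diff_chain_within[OF c has_derivative_at_withinI[OF this]]
    have "((\<lambda>t. dg (c t) v w w) has_vector_derivative frechet_derivative (\<lambda>y. dg y v w w) (at x) u) (at 0)"
      by (simp add: comp_def)
    then have "((\<lambda>t. dg (c t) v w w / 2) has_vector_derivative frechet_derivative (\<lambda>y. dg y v w w) (at x) u / 2) (at 0)"
      by (rule has_vector_derivative_divide)
    from vector_derivative_unique_at[OF 2 this] show ?thesis by simp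
  qed
  show ?thesis
    unfolding chart_curvature_def
    by (simp add: G.add_left G.diff_left x * metric_compatible
        smooth_on_mixed_derivatives_commute[OF smooth open_chart x, of w w v u])
       (simp add: g_sym[OF x])
qed

section \<open>The Jacobi equation in a chart\<close>

text \<open>A torsion-free connection in a chart. The fiber and the spacetime, whose metrics differ
  in signature, share the geodesic and Jacobi equations through this locale.\<close>

locale connection_chart = bilinear_field S \<Gamma>
  for S :: "'e::euclidean_space set" and \<Gamma> :: "'e \<Rightarrow> 'e \<Rightarrow> 'e \<Rightarrow> 'e" +
  assumes sym: "x \<in> S \<Longrightarrow> \<Gamma> x v w = \<Gamma> x w v"
begin

lemma dB_sym: assumes "x \<in> S" shows "dB x u v w = dB x u w v"
  by (rule derivative_transform[OF assms _ has_derivative[OF assms]]) (simp add: sym)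

definition covd :: "(real \<Rightarrow> 'e) \<Rightarrow> (real \<Rightarrow> 'e) \<Rightarrow> (real \<Rightarrow> 'e) \<Rightarrow> real \<Rightarrow> 'e" where
  "covd x v V t = vector_derivative V (at t) + \<Gamma> (x t) (v t) (V t)"

definition geodesic_on :: "(real \<Rightarrow> 'e) \<Rightarrow> (real \<Rightarrow> 'e) \<Rightarrow> real set \<Rightarrow> bool" where
  "geodesic_on x v T \<longleftrightarrow> (\<forall>t\<in>T. x t \<in> S \<and> (x has_vector_derivative v t) (at t) \<and>
     (v has_vector_derivative - \<Gamma> (x t) (v t) (v t)) (at t))"

text \<open>Along a geodesic, the curvature term of the Jacobi equation cancels against the derivatives of
  the Christoffel symbols which come from the second covariant derivative.\<close>

definition jacobi_on ::
    "(real \<Rightarrow> 'e) \<Rightarrow> (real \<Rightarrow> 'e) \<Rightarrow> (real \<Rightarrow> 'e) \<Rightarrow> (real \<Rightarrow> 'e) \<Rightarrow> (real \<Rightarrow> 'e) \<Rightarrow> real set \<Rightarrow> bool" where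
  "jacobi_on x v \<phi> V V' T \<longleftrightarrow> (\<forall>t\<in>T. (V has_vector_derivative V' t) (at t) \<and>
     (V' has_vector_derivative \<phi> t - 2 *\<^sub>R \<Gamma> (x t) (v t) (V' t) - dB (x t) (V t) (v t) (v t)) (at t))"

lemma has_vector_derivative_connection:
  assumes "geodesic_on x v T" "t \<in> T" "(V has_vector_derivative V') (at t)"
  shows "((\<lambda>t. \<Gamma> (x t) (v t) (V t)) has_vector_derivative
    dB (x t) (v t) (v t) (V t) - \<Gamma> (x t) (\<Gamma> (x t) (v t) (v t)) (V t) + \<Gamma> (x t) (v t) V') (at t)"
proof -
  have g: "x t \<in> S" "(x has_vector_derivative v t) (at t)" "(v has_vector_derivative - \<Gamma> (x t) (v t) (v t)) (at t)"
    using assms by (auto simp: geodesic_on_def)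
  show ?thesis
    using has_vector_derivative_along[OF g(2,3) assms(3) g(1)] by (simp add: neg_left g(1))
qed

text \<open>The source \<open>\<phi>\<close> is carried along because the fiber part of a spacetime
  Jacobi field solves the Jacobi equation of the fiber only up to a multiple of the
  velocity.\<close>

lemma covariant_derivative_jacobi:
  assumes geo: "geodesic_on x v T" and jac: "jacobi_on x v \<phi> V V' T" and t: "t \<in> T"
  shows "((\<lambda>t. V' t + \<Gamma> (x t) (v t) (V t)) has_vector_derivative
    \<phi> t - chart_curvature \<Gamma> (x t) (V t) (v t) (v t) - \<Gamma> (x t) (v t) (V' t + \<Gamma> (x t) (v t) (V t))) (at t)"
proof -
  have S: "x t \<in> S" using geo t by (auto simp: geodesic_on_def)
  have J: "(V has_vector_derivative V' t) (at t)"
    "(V' has_vector_derivative \<phi> t - 2 *\<^sub>R \<Gamma> (x t) (v t) (V' t) - dB (x t) (V t) (v t) (v t)) (at t)"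
    using jac t by (auto simp: jacobi_on_def)
  have "((\<lambda>t. V' t + \<Gamma> (x t) (v t) (V t)) has_vector_derivative
     (\<phi> t - 2 *\<^sub>R \<Gamma> (x t) (v t) (V' t) - dB (x t) (V t) (v t) (v t)) +
     (dB (x t) (v t) (v t) (V t) - \<Gamma> (x t) (\<Gamma> (x t) (v t) (v t)) (V t) + \<Gamma> (x t) (v t) (V' t))) (at t)"
    by (rule has_vector_derivative_add[OF J(2) has_vector_derivative_connection[OF geo t J(1)]])
  moreover have "(\<phi> t - 2 *\<^sub>R \<Gamma> (x t) (v t) (V' t) - dB (x t) (V t) (v t) (v t)) +
     (dB (x t) (v t) (v t) (V t) - \<Gamma> (x t) (\<Gamma> (x t) (v t) (v t)) (V t) + \<Gamma> (x t) (v t) (V' t))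
    = \<phi> t - chart_curvature \<Gamma> (x t) (V t) (v t) (v t) - \<Gamma> (x t) (v t) (V' t + \<Gamma> (x t) (v t) (V t))"
    unfolding chart_curvature_def add_right[OF S] sym[OF S, of "V t" "\<Gamma> (x t) (v t) (v t)"]
      sym[OF S, of "V t" "v t"] dB_sym[OF S, where u = "v t" and v = "V t" and w = "v t"]
    by (simp add: algebra_simps scaleR_2)
  ultimately show ?thesis by simp
qed

text \<open>Replaces iterated covariant derivatives by ordinary ones, so that changes of the
  parameter and the splitting into time and fiber components become plain calculus.\<close>

lemma jacobi_equation_iff:
  assumes geo: "geodesic_on x v T" and T: "open T"
  shows "(\<forall>t\<in>T. V differentiable (at t) \<and> covd x v V differentiable (at t) \<and>
      covd x v (covd x v V) t + chart_curvature \<Gamma> (x t) (V t) (v t) (v t) = 0)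
    \<longleftrightarrow> (\<exists>V'. jacobi_on x v (\<lambda>t. 0) V V' T)" (is "?L \<longleftrightarrow> ?R")
proof
  assume L: ?L
  define V' where "V' t = vector_derivative V (at t)" for t
  have "(V' has_vector_derivative 0 - 2 *\<^sub>R \<Gamma> (x t) (v t) (V' t) - dB (x t) (V t) (v t) (v t)) (at t)"
    if t: "t \<in> T" for t
  proof -
    have S: "x t \<in> S" using geo t by (auto simp: geodesic_on_def)
    have V: "(V has_vector_derivative V' t) (at t)"
      using L t by (simp add: V'_def vector_derivative_works[symmetric])
    have "(covd x v V has_vector_derivative vector_derivative (covd x v V) (at t)) (at t)"
      using L t vector_derivative_works by blast
    from has_vector_derivative_diff[OF this has_vector_derivative_connection[OF geo t V]]
    have "(V' has_vector_derivative vector_derivative (covd x v V) (at t) -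
       (dB (x t) (v t) (v t) (V t) - \<Gamma> (x t) (\<Gamma> (x t) (v t) (v t)) (V t) + \<Gamma> (x t) (v t) (V' t))) (at t)"
      by (simp add: covd_def V'_def[abs_def])
    moreover have "vector_derivative (covd x v V) (at t) = - \<Gamma> (x t) (v t) (V' t + \<Gamma> (x t) (v t) (V t))
        - chart_curvature \<Gamma> (x t) (V t) (v t) (v t)"
      using L t unfolding covd_def[of x v "covd x v V"] by (auto simp: covd_def V'_def algebra_simps eq_neg_iff_add_eq_0)
    moreover have "- \<Gamma> (x t) (v t) (V' t + \<Gamma> (x t) (v t) (V t)) - chart_curvature \<Gamma> (x t) (V t) (v t) (v t)
       - (dB (x t) (v t) (v t) (V t) - \<Gamma> (x t) (\<Gamma> (x t) (v t) (v t)) (V t) + \<Gamma> (x t) (v t) (V' t))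
       = 0 - 2 *\<^sub>R \<Gamma> (x t) (v t) (V' t) - dB (x t) (V t) (v t) (v t)"
      unfolding chart_curvature_def add_right[OF S] sym[OF S, of "V t" "\<Gamma> (x t) (v t) (v t)"]
        sym[OF S, of "V t" "v t"] dB_sym[OF S, where u = "v t" and v = "V t" and w = "v t"]
      by (simp add: algebra_simps scaleR_2)
    ultimately show ?thesis by simp
  qed
  moreover have "(V has_vector_derivative V' t) (at t)" if "t \<in> T" for t
    using L that by (simp add: V'_def vector_derivative_works[symmetric])
  ultimately show ?R unfolding jacobi_on_def by blast
next
  assume ?R
  then obtain V' where J: "jacobi_on x v (\<lambda>t. 0) V V' T" by blast
  have V: "(V has_vector_derivative V' t) (at t)" if "t \<in> T" for t
    using J that by (auto simp: jacobi_on_def)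
  have e: "covd x v V t = V' t + \<Gamma> (x t) (v t) (V t)" if "t \<in> T" for t
    using V[OF that] by (simp add: covd_def vector_derivative_at)
  have D: "(covd x v V has_vector_derivative
    0 - chart_curvature \<Gamma> (x t) (V t) (v t) (v t) - \<Gamma> (x t) (v t) (V' t + \<Gamma> (x t) (v t) (V t))) (at t)"
    if "t \<in> T" for t
    by (rule has_vector_derivative_transform_within_open[OF covariant_derivative_jacobi[OF geo J that] T that])
       (simp add: e)
  show ?L
  proof (intro ballI conjI)
    fix t assume t: "t \<in> T"
    show "V differentiable (at t)" using V[OF t] differentiableI_vector by blast
    show "covd x v V differentiable (at t)" using D[OF t] differentiableI_vector by blast
    show "covd x v (covd x v V) t + chart_curvature \<Gamma> (x t) (V t) (v t) (v t) = 0"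
      unfolding covd_def[of x v "covd x v V"] e[OF t] vector_derivative_at[OF D[OF t]] by simp
  qed
qed

end

sublocale riemannian_chart \<subseteq> connection_chart S \<Gamma>
  by unfold_locales (rule \<Gamma>_sym)

context riemannian_chart
begin

text \<open>The velocity is parallel and the curvature term is orthogonal to it by
  \<open>curvature_skew\<close>; thus only the source remains in the second derivative.\<close>

lemma inner_jacobi:
  assumes geo: "geodesic_on x v T" and jac: "jacobi_on x v \<phi> V V' T" and t: "t \<in> T"
  shows "((\<lambda>t. g (x t) (v t) (V t)) has_vector_derivative
      g (x t) (v t) (V' t + \<Gamma> (x t) (v t) (V t))) (at t)" (is ?A)
    and "((\<lambda>t. g (x t) (v t) (V' t + \<Gamma> (x t) (v t) (V t))) has_vector_derivative
      g (x t) (v t) (\<phi> t)) (at t)" (is ?B)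
proof -
  have g: "x t \<in> S" "(x has_vector_derivative v t) (at t)" "(v has_vector_derivative - \<Gamma> (x t) (v t) (v t)) (at t)"
    using geo t by (auto simp: geodesic_on_def)
  have V: "(V has_vector_derivative V' t) (at t)" using jac t by (auto simp: jacobi_on_def)
  show ?A
    using G.has_vector_derivative_along[OF g(2,3) V g(1)]
    by (simp add: metric_compatible G.neg_left G.add_right g(1) algebra_simps)
  have "g (x t) (v t) (chart_curvature \<Gamma> (x t) (V t) (v t) (v t)) = 0"
    using curvature_skew[OF g(1)] g_sym[OF g(1)] by metis
  then show ?B
    using G.has_vector_derivative_along[OF g(2,3) covariant_derivative_jacobi[OF geo jac t] g(1)]
    by (simp add: metric_compatible G.neg_left G.diff_right g(1))
qed

lemma speed_constant:
  assumes geo: "geodesic_on x v T" and t: "t \<in> T"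
  shows "((\<lambda>t. g (x t) (v t) (v t)) has_vector_derivative 0) (at t)"
proof -
  have g: "x t \<in> S" "(x has_vector_derivative v t) (at t)" "(v has_vector_derivative - \<Gamma> (x t) (v t) (v t)) (at t)"
    using geo t by (auto simp: geodesic_on_def)
  show ?thesis
    using G.has_vector_derivative_along[OF g(2,3) g(3) g(1)]
    by (simp add: metric_compatible G.neg_left G.neg_right g(1))
qed

end

section \<open>The connection of a warped product\<close>

lemma has_derivative_comp_fst: assumes "(h has_field_derivative d) (at (fst z))"
  shows "((\<lambda>y. h (fst y)) has_derivative (\<lambda>\<nu>. d * fst \<nu>)) (at z)"
  using has_derivative_compose[OF has_derivative_fst[OF has_derivative_ident] assms[unfolded has_field_derivative_def]]
  by simp

lemma has_derivative_comp_snd: assumes "(h has_derivative d) (at (snd z))"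
  shows "((\<lambda>y. h (snd y)) has_derivative (\<lambda>\<nu>. d (snd \<nu>))) (at z)"
  using has_derivative_compose[OF has_derivative_snd[OF has_derivative_ident] assms]
  by simp

lemma has_vector_derivative_Pair_iff:
  "((\<lambda>t. (a t, b t)) has_vector_derivative (a', b')) (at t) \<longleftrightarrow>
     (a has_vector_derivative a') (at t) \<and> (b has_vector_derivative b') (at t)"
  using bounded_linear.has_vector_derivative[OF bounded_linear_fst, of "\<lambda>t. (a t, b t)" "(a', b')" "at t"]
    bounded_linear.has_vector_derivative[OF bounded_linear_snd, of "\<lambda>t. (a t, b t)" "(a', b')" "at t"]
  by (auto intro: has_vector_derivative_Pair)

text \<open>Half the derivative of \<open>f\<^sup>2\<close>. Together with
  \<open>warp_\<eta>\<close>, the derivative of \<open>ln f\<close>, it is how the warping enters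
  the connection; the primed functions are their derivatives and occur in the Jacobi
  equation.\<close>

definition warp_\<psi> :: "(real \<Rightarrow> real) \<Rightarrow> real \<Rightarrow> real" where
  "warp_\<psi> f \<tau> = f \<tau> * deriv f \<tau>"

definition warp_\<psi>' :: "(real \<Rightarrow> real) \<Rightarrow> real \<Rightarrow> real" where
  "warp_\<psi>' f \<tau> = (deriv f \<tau>)\<^sup>2 + f \<tau> * deriv (deriv f) \<tau>"

definition warp_\<eta> :: "(real \<Rightarrow> real) \<Rightarrow> real \<Rightarrow> real" where
  "warp_\<eta> f \<tau> = deriv f \<tau> / f \<tau>"

definition warp_\<eta>' :: "(real \<Rightarrow> real) \<Rightarrow> real \<Rightarrow> real" where
  "warp_\<eta>' f \<tau> = deriv (deriv f) \<tau> / f \<tau> - (deriv f \<tau>)\<^sup>2 / (f \<tau>)\<^sup>2"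

lemmas warp_defs = warp_\<psi>_def warp_\<psi>'_def warp_\<eta>_def warp_\<eta>'_def

locale grw_chart = riemannian_chart S g
  for S :: "'e::euclidean_space set" and g +
  fixes I :: "real set" and f :: "real \<Rightarrow> real"
  assumes open_I: "open I" and f_smooth: "smooth_on I f" and f_pos: "\<tau> \<in> I \<Longrightarrow> f \<tau> > 0"
begin

abbreviation "\<psi> \<equiv> warp_\<psi> f"
abbreviation "\<psi>' \<equiv> warp_\<psi>' f"
abbreviation "\<eta> \<equiv> warp_\<eta> f"
abbreviation "\<eta>' \<equiv> warp_\<eta>' f"

lemma f_deriv: "\<tau> \<in> I \<Longrightarrow> (f has_field_derivative deriv f \<tau>) (at \<tau>)"
  "\<tau> \<in> I \<Longrightarrow> (deriv f has_field_derivative deriv (deriv f) \<tau>) (at \<tau>)"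
  using smooth_on_real_has_field_derivative f_smooth smooth_on_deriv[OF f_smooth open_I] by blast+

lemma \<psi>_deriv: "\<tau> \<in> I \<Longrightarrow> (\<psi> has_field_derivative \<psi>' \<tau>) (at \<tau>)"
  unfolding warp_defs by (auto intro!: derivative_eq_intros f_deriv simp: power2_eq_square)

lemma \<eta>_deriv: "\<tau> \<in> I \<Longrightarrow> (\<eta> has_field_derivative \<eta>' \<tau>) (at \<tau>)"
  unfolding warp_defs using f_pos[of \<tau>]
  by (auto intro!: derivative_eq_intros f_deriv simp: power2_eq_square field_simps)

definition wg :: "real \<times> 'e \<Rightarrow> real \<times> 'e \<Rightarrow> real \<times> 'e \<Rightarrow> real" where
  "wg z \<xi> \<zeta> = - (fst \<xi> * fst \<zeta>) + (f (fst z))\<^sup>2 * g (snd z) (snd \<xi>) (snd \<zeta>)"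

text \<open>The classical connection of a warped product over a negative definite base: pairs of
  fiber vectors acquire a time component with factor \<open>\<psi>\<close>, and mixed pairs are
  multiplied by \<open>\<eta>\<close>.\<close>

definition w\<Gamma> :: "real \<times> 'e \<Rightarrow> real \<times> 'e \<Rightarrow> real \<times> 'e \<Rightarrow> real \<times> 'e" where
  "w\<Gamma> z \<xi> \<zeta> = (\<psi> (fst z) * g (snd z) (snd \<xi>) (snd \<zeta>),
     \<Gamma> (snd z) (snd \<xi>) (snd \<zeta>) + \<eta> (fst z) *\<^sub>R (fst \<xi> *\<^sub>R snd \<zeta> + fst \<zeta> *\<^sub>R snd \<xi>))"

lemma wg_derivative:
  assumes "z \<in> I \<times> S"
  shows "frechet_derivative (\<lambda>y. wg y \<xi> \<zeta>) (at z) \<nu> =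
    2 * \<psi> (fst z) * fst \<nu> * g (snd z) (snd \<xi>) (snd \<zeta>) + (f (fst z))\<^sup>2 * dg (snd z) (snd \<nu>) (snd \<xi>) (snd \<zeta>)"
proof -
  have z: "fst z \<in> I" "snd z \<in> S" using assms by auto
  have f2: "((\<lambda>\<tau>. (f \<tau>)\<^sup>2) has_field_derivative 2 * \<psi> (fst z)) (at (fst z))"
    by (auto intro!: derivative_eq_intros f_deriv z simp: warp_defs)
  have "((\<lambda>y. wg y \<xi> \<zeta>) has_derivative (\<lambda>\<nu>. 0 + ((f (fst z))\<^sup>2 * dg (snd z) (snd \<nu>) (snd \<xi>) (snd \<zeta>)
      + 2 * \<psi> (fst z) * fst \<nu> * g (snd z) (snd \<xi>) (snd \<zeta>)))) (at z)"
    unfolding wg_def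
    by (intro has_derivative_add has_derivative_const has_derivative_mult has_derivative_comp_fst[OF f2]
        has_derivative_comp_snd[OF G.has_derivative] z)
  from frechet_derivative_at[OF this, symmetric] show ?thesis by simp
qed

lemma wg_christoffel:
  assumes "z \<in> I \<times> S"
  shows "koszul_christoffel wg z \<xi> \<zeta> = w\<Gamma> z \<xi> \<zeta>"
proof (rule koszul_christoffelI)
  have z: "fst z \<in> I" "snd z \<in> S" using assms by auto
  show "bilinear (wg z)" unfolding bilinear_def
    by (intro conjI allI linearI)
       (simp_all add: wg_def G.add_left G.add_right G.scale_left G.scale_right z algebra_simps)
  show "\<zeta> = 0" if "\<And>u. wg z \<zeta> u = 0" for \<zeta>
  proof -
    \<comment> \<open>The warped metric is block diagonal, so that testing with purely temporal and
      purely spatial vectors suffices.\<close>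
    have "fst \<zeta> = 0" using that[of "(1, 0)"] by (simp add: wg_def G.zero_right z)
    moreover have "snd \<zeta> = 0"
      by (rule g_nondegenerate[OF z(2)]) (use that[of "(0, _)"] f_pos[OF z(1)] in \<open>simp add: wg_def\<close>)
    ultimately show ?thesis by (simp add: prod_eq_iff)
  qed
  fix u
  have f0: "f (fst z) > 0" using f_pos z by blast
  have e: "(f (fst z))\<^sup>2 * (\<eta> (fst z) * a) = \<psi> (fst z) * a" for a
    using f0 by (simp add: warp_defs power2_eq_square)
  show "wg z (w\<Gamma> z \<xi> \<zeta>) u = (frechet_derivative (\<lambda>y. wg y \<zeta> u) (at z) \<xi> + frechet_derivative (\<lambda>y. wg y \<xi> u) (at z) \<zeta>
        - frechet_derivative (\<lambda>y. wg y \<xi> \<zeta>) (at z) u) / 2"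
    unfolding wg_derivative[OF assms]
    by (simp add: wg_def w\<Gamma>_def G.add_left G.scale_left z koszul_formula koszul_def distrib_left e
        g_sym[OF z(2), of "snd \<xi>" "snd \<zeta>"])
      (simp add: field_simps)
qed

lemma w\<Gamma>_derivative:
  assumes "z \<in> I \<times> S"
  shows "((\<lambda>y. w\<Gamma> y \<xi> \<zeta>) has_derivative (\<lambda>\<nu>.
    (\<psi> (fst z) * dg (snd z) (snd \<nu>) (snd \<xi>) (snd \<zeta>) + \<psi>' (fst z) * fst \<nu> * g (snd z) (snd \<xi>) (snd \<zeta>),
     C.dB (snd z) (snd \<nu>) (snd \<xi>) (snd \<zeta>) + (\<eta>' (fst z) * fst \<nu>) *\<^sub>R (fst \<xi> *\<^sub>R snd \<zeta> + fst \<zeta> *\<^sub>R snd \<xi>)))) (at z)"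
proof -
  have z: "fst z \<in> I" "snd z \<in> S" using assms by auto
  show ?thesis unfolding w\<Gamma>_def
    by (intro has_derivative_Pair has_derivative_add has_derivative_mult has_derivative_scaleR_left
       has_derivative_comp_fst[OF \<psi>_deriv] has_derivative_comp_fst[OF \<eta>_deriv]
        has_derivative_comp_snd[OF G.has_derivative] has_derivative_comp_snd[OF C.has_derivative] z)
qed

sublocale W: connection_chart "I \<times> S" "koszul_christoffel wg"
proof
  show op: "open (I \<times> S)" using open_I open_chart by (rule open_Times)
  fix z v w assume "z \<in> I \<times> S"
  then have z: "fst z \<in> I" "snd z \<in> S" by auto
  show "bilinear (koszul_christoffel wg z)" unfolding bilinear_def
    by (intro conjI allI linearI)
       (simp_all add: wg_christoffel \<open>z \<in> I \<times> S\<close> w\<Gamma>_def G.add_left G.add_right G.scale_left G.scale_right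
         C.add_left C.add_right C.scale_left C.scale_right z algebra_simps)
  have "((\<lambda>y. koszul_christoffel wg y v w) has_derivative (\<lambda>\<nu>.
    (\<psi> (fst z) * dg (snd z) (snd \<nu>) (snd v) (snd w) + \<psi>' (fst z) * fst \<nu> * g (snd z) (snd v) (snd w),
     C.dB (snd z) (snd \<nu>) (snd v) (snd w) + (\<eta>' (fst z) * fst \<nu>) *\<^sub>R (fst v *\<^sub>R snd w + fst w *\<^sub>R snd v)))) (at z)"
    by (rule has_derivative_transform_within_open[OF w\<Gamma>_derivative op]) (auto simp: wg_christoffel \<open>z \<in> I \<times> S\<close>)
  then show "(\<lambda>y. koszul_christoffel wg y v w) differentiable (at z)"
    unfolding differentiable_def by blast
  show "koszul_christoffel wg z v w = koszul_christoffel wg z w v"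
    by (simp add: wg_christoffel \<open>z \<in> I \<times> S\<close> w\<Gamma>_def g_sym[OF z(2), of "snd v"] \<Gamma>_sym[OF z(2), of "snd v"] add.commute)
qed

lemma W_derivative:
  assumes "z \<in> I \<times> S"
  shows "W.dB z \<nu> \<xi> \<zeta> =
    (\<psi> (fst z) * dg (snd z) (snd \<nu>) (snd \<xi>) (snd \<zeta>) + \<psi>' (fst z) * fst \<nu> * g (snd z) (snd \<xi>) (snd \<zeta>),
     C.dB (snd z) (snd \<nu>) (snd \<xi>) (snd \<zeta>) + (\<eta>' (fst z) * fst \<nu>) *\<^sub>R (fst \<xi> *\<^sub>R snd \<zeta> + fst \<zeta> *\<^sub>R snd \<xi>))"
  by (rule W.derivative_transform[OF assms _ w\<Gamma>_derivative[OF assms]]) (simp add: wg_christoffel)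

lemma W_geodesic_on_iff:
  "W.geodesic_on (\<lambda>t. (\<tau> t, x t)) (\<lambda>t. (\<tau>' t, v t)) T \<longleftrightarrow>
    (\<forall>t\<in>T. \<tau> t \<in> I \<and> x t \<in> S \<and>
      (\<tau> has_vector_derivative \<tau>' t) (at t) \<and> (x has_vector_derivative v t) (at t) \<and>
      (\<tau>' has_vector_derivative - (\<psi> (\<tau> t) * g (x t) (v t) (v t))) (at t) \<and>
      (v has_vector_derivative - \<Gamma> (x t) (v t) (v t) - (2 * \<eta> (\<tau> t) * \<tau>' t) *\<^sub>R v t) (at t))"
proof -
  have "- koszul_christoffel wg (\<tau> t, x t) (\<tau>' t, v t) (\<tau>' t, v t) =
    (- (\<psi> (\<tau> t) * g (x t) (v t) (v t)), - \<Gamma> (x t) (v t) (v t) - (2 * \<eta> (\<tau> t) * \<tau>' t) *\<^sub>R v t)"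
    if "(\<tau> t, x t) \<in> I \<times> S" for t
    using wg_christoffel[OF that] by (simp add: w\<Gamma>_def scaleR_add_right scaleR_2[symmetric])
  then show ?thesis
    unfolding W.geodesic_on_def by (auto simp: has_vector_derivative_Pair_iff)
qed

lemma W_jacobi_on_iff:
  assumes "\<And>t. t \<in> T \<Longrightarrow> \<tau> t \<in> I \<and> x t \<in> S"
  shows "W.jacobi_on (\<lambda>t. (\<tau> t, x t)) (\<lambda>t. (\<tau>' t, v t)) (\<lambda>t. 0) (\<lambda>t. (\<alpha> t, V t)) (\<lambda>t. (\<alpha>' t, V' t)) T \<longleftrightarrow>
    (\<forall>t\<in>T. (\<alpha> has_vector_derivative \<alpha>' t) (at t) \<and> (V has_vector_derivative V' t) (at t) \<and>
     (\<alpha>' has_vector_derivative - 2 * \<psi> (\<tau> t) * g (x t) (v t) (V' t + \<Gamma> (x t) (v t) (V t))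
        - \<psi>' (\<tau> t) * \<alpha> t * g (x t) (v t) (v t)) (at t) \<and>
     (V' has_vector_derivative - 2 *\<^sub>R \<Gamma> (x t) (v t) (V' t) - C.dB (x t) (V t) (v t) (v t)
       - (2 * \<eta> (\<tau> t) * \<tau>' t) *\<^sub>R V' t
       - (2 * (\<eta> (\<tau> t) * \<alpha>' t + \<eta>' (\<tau> t) * \<tau>' t * \<alpha> t)) *\<^sub>R v t) (at t))"
proof -
  have "0 - 2 *\<^sub>R koszul_christoffel wg (\<tau> t, x t) (\<tau>' t, v t) (\<alpha>' t, V' t)
      - W.dB (\<tau> t, x t) (\<alpha> t, V t) (\<tau>' t, v t) (\<tau>' t, v t) =
    (- 2 * \<psi> (\<tau> t) * g (x t) (v t) (V' t + \<Gamma> (x t) (v t) (V t)) - \<psi>' (\<tau> t) * \<alpha> t * g (x t) (v t) (v t),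
     - 2 *\<^sub>R \<Gamma> (x t) (v t) (V' t) - C.dB (x t) (V t) (v t) (v t)
       - (2 * \<eta> (\<tau> t) * \<tau>' t) *\<^sub>R V' t
       - (2 * (\<eta> (\<tau> t) * \<alpha>' t + \<eta>' (\<tau> t) * \<tau>' t * \<alpha> t)) *\<^sub>R v t)"
    if "t \<in> T" for t
  proof -
    have z: "(\<tau> t, x t) \<in> I \<times> S" "x t \<in> S" using assms[OF that] by auto
    \<comment> \<open>Compatibility rewrites the derivative of the metric as a Christoffel term,
      which completes \<open>V'\<close> to the covariant derivative of the fiber component.\<close>
    have 2: "dg (x t) (V t) (v t) (v t) = 2 * g (x t) (v t) (\<Gamma> (x t) (v t) (V t))"
      unfolding metric_compatible[OF z(2)]
      using g_sym[OF z(2), of "\<Gamma> (x t) (V t) (v t)" "v t"] \<Gamma>_sym[OF z(2), of "V t" "v t"] by simp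
    show ?thesis
      unfolding wg_christoffel[OF z(1)] W_derivative[OF z(1)] fst_conv snd_conv 2
      by (simp add: w\<Gamma>_def G.add_right z algebra_simps scaleR_2)
        (simp add: scaleR_add_left[symmetric] algebra_simps)
  qed
  then show ?thesis
    unfolding W.jacobi_on_def by (auto simp: has_vector_derivative_Pair_iff)
qed

end

section \<open>Geodesics and Jacobi fields in charts\<close>

abbreviation chart_image :: "('i, 'p, 'e) mfd \<Rightarrow> 'i \<Rightarrow> 'e set" where
  "chart_image M i \<equiv> coord M i ` patch M i"

definition times_in :: "('i, 'p, 'e) mfd \<Rightarrow> (real \<Rightarrow> 'p) \<Rightarrow> real set \<Rightarrow> 'i \<Rightarrow> real set" where
  "times_in M \<gamma> J i = {t \<in> J. \<gamma> t \<in> patch M i}"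

text \<open>Weaker than \<open>riemannian_manifold\<close>, so that the Lorentzian spacetime is
  covered as well as the fiber.\<close>

definition connection_mfd :: "('i, 'p::topological_space, 'e::euclidean_space) mfd \<Rightarrow> bool" where
  "connection_mfd M \<longleftrightarrow> (\<forall>i\<in>idx M. open (patch M i) \<and> connection_chart (chart_image M i) (christoffel M i))"

lemma open_times_in:
  assumes "connection_mfd M" "open J" "continuous_on J \<gamma>" "i \<in> idx M"
  shows "open (times_in M \<gamma> J i)"
proof -
  have "open (patch M i)" using assms by (auto simp: connection_mfd_def)
  then have "open (J \<inter> \<gamma> -` patch M i)"
    using assms continuous_open_preimage by blast
  then show ?thesis by (simp add: times_in_def Collect_conj_eq vimage_def)
qed

lemma geodesic_iff:
  assumes "connection_mfd M"
  shows "geodesic M \<gamma> J \<longleftrightarrow>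
     open J \<and> connected J \<and> J \<noteq> {} \<and> continuous_on J \<gamma> \<and> \<gamma> ` J \<subseteq> points M \<and>
     (\<forall>i\<in>idx M. connection_chart.geodesic_on (chart_image M i) (christoffel M i)
        (\<lambda>t. coord M i (\<gamma> t)) (velocity M \<gamma> i) (times_in M \<gamma> J i))"
proof -
  have "((coord M i \<circ> \<gamma>) differentiable (at t) \<and> velocity M \<gamma> i differentiable (at t) \<and>
        covariant_derivative M \<gamma> (velocity M \<gamma>) i t = 0) \<longleftrightarrow>
    ((\<lambda>t. coord M i (\<gamma> t)) has_vector_derivative velocity M \<gamma> i t) (at t) \<and>
     (velocity M \<gamma> i has_vector_derivative - christoffel M i (coord M i (\<gamma> t)) (velocity M \<gamma> i t) (velocity M \<gamma> i t)) (at t)"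
    for i t
  proof -
    have "(coord M i \<circ> \<gamma>) differentiable (at t) \<longleftrightarrow>
      ((\<lambda>t. coord M i (\<gamma> t)) has_vector_derivative velocity M \<gamma> i t) (at t)"
      by (simp add: velocity_def vector_derivative_works comp_def)
    moreover have "velocity M \<gamma> i differentiable (at t) \<and> covariant_derivative M \<gamma> (velocity M \<gamma>) i t = 0 \<longleftrightarrow>
      (velocity M \<gamma> i has_vector_derivative - christoffel M i (coord M i (\<gamma> t)) (velocity M \<gamma> i t) (velocity M \<gamma> i t)) (at t)"
      (is "?d \<and> ?z \<longleftrightarrow> ?v")
    proof
      assume a: "?d \<and> ?z"
      then have "vector_derivative (velocity M \<gamma> i) (at t) = - christoffel M i (coord M i (\<gamma> t)) (velocity M \<gamma> i t) (velocity M \<gamma> i t)"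
        by (simp add: covariant_derivative_def eq_neg_iff_add_eq_0)
      then show ?v using a vector_derivative_works by metis
    next
      assume v: ?v
      show "?d \<and> ?z"
        using differentiableI_vector[OF v] by (simp add: covariant_derivative_def vector_derivative_at[OF v])
    qed
    ultimately show ?thesis by blast
  qed
  then show ?thesis
    using assms unfolding geodesic_def connection_mfd_def times_in_def
    by (auto simp: connection_chart.geodesic_on_def)
qed

text \<open>For constructed curves: the velocity may be supplied by an explicit formula
  \<open>v\<close>, correct only at the times in the chart. These form an open set, so that
  \<open>v\<close> and \<open>velocity\<close> have the same derivatives there.\<close>

lemma geodesicI:
  assumes M: "connection_mfd M" and "open J" "connected J" "J \<noteq> {}" "continuous_on J \<gamma>" "\<gamma> ` J \<subseteq> points M"
    and "\<And>i. i \<in> idx M \<Longrightarrow> connection_chart.geodesic_on (chart_image M i) (christoffel M i)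
        (\<lambda>t. coord M i (\<gamma> t)) (v i) (times_in M \<gamma> J i)"
  shows "geodesic M \<gamma> J"
    and "\<And>i t. i \<in> idx M \<Longrightarrow> t \<in> times_in M \<gamma> J i \<Longrightarrow> velocity M \<gamma> i t = v i t"
proof -
  have ccc: "connection_chart (chart_image M i) (christoffel M i)" if "i \<in> idx M" for i
    using M that by (auto simp: connection_mfd_def)
  note go = connection_chart.geodesic_on_def[OF ccc]
  show v: "velocity M \<gamma> i t = v i t" if i: "i \<in> idx M" and "t \<in> times_in M \<gamma> J i" for i t
    using assms(7)[OF i] that unfolding go[OF i] velocity_def comp_def by (auto intro: vector_derivative_at)
  have "connection_chart.geodesic_on (chart_image M i) (christoffel M i)
        (\<lambda>t. coord M i (\<gamma> t)) (velocity M \<gamma> i) (times_in M \<gamma> J i)" if i: "i \<in> idx M" for i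
    unfolding go[OF i]
  proof (intro ballI conjI)
    fix t assume t: "t \<in> times_in M \<gamma> J i"
    have *: "coord M i (\<gamma> t) \<in> chart_image M i" "((\<lambda>t. coord M i (\<gamma> t)) has_vector_derivative v i t) (at t)"
     "(v i has_vector_derivative - christoffel M i (coord M i (\<gamma> t)) (v i t) (v i t)) (at t)"
      using assms(7)[OF i] t unfolding go[OF i] by auto
    show "coord M i (\<gamma> t) \<in> chart_image M i" by (rule *)
    show "((\<lambda>t. coord M i (\<gamma> t)) has_vector_derivative velocity M \<gamma> i t) (at t)" using * v[OF i t] by simp
    show "(velocity M \<gamma> i has_vector_derivative - christoffel M i (coord M i (\<gamma> t)) (velocity M \<gamma> i t) (velocity M \<gamma> i t)) (at t)"
      by (rule has_vector_derivative_transform_within_open[OF _ open_times_in[OF M \<open>open J\<close> \<open>continuous_on J \<gamma>\<close> i] t])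
         (use * v[OF i] t in auto)
  qed
  then show "geodesic M \<gamma> J" using assms geodesic_iff by blast
qed

lemma jacobi_field_iff:
  assumes M: "connection_mfd M" and geo: "geodesic M \<gamma> J"
  shows "jacobi_field M \<gamma> J V \<longleftrightarrow> field_along M \<gamma> J V \<and>
     (\<forall>i\<in>idx M. \<exists>V'. connection_chart.jacobi_on (christoffel M i)
        (\<lambda>t. coord M i (\<gamma> t)) (velocity M \<gamma> i) (\<lambda>t. 0) (V i) V' (times_in M \<gamma> J i))"
proof -
  have "(\<forall>t\<in>J. \<gamma> t \<in> patch M i \<longrightarrow>
        V i differentiable (at t) \<and> covariant_derivative M \<gamma> V i differentiable (at t) \<and>
        covariant_derivative M \<gamma> (covariant_derivative M \<gamma> V) i t
        + curvature M i (coord M i (\<gamma> t)) (V i t) (velocity M \<gamma> i t) (velocity M \<gamma> i t) = 0) \<longleftrightarrow>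
    (\<exists>V'. connection_chart.jacobi_on (christoffel M i)
        (\<lambda>t. coord M i (\<gamma> t)) (velocity M \<gamma> i) (\<lambda>t. 0) (V i) V' (times_in M \<gamma> J i))" if i: "i \<in> idx M" for i
  proof -
    interpret connection_chart "chart_image M i" "christoffel M i"
      using M i by (auto simp: connection_mfd_def)
    have c: "covariant_derivative M \<gamma> V i = covd (\<lambda>t. coord M i (\<gamma> t)) (velocity M \<gamma> i) (V i)" for V
      by (simp add: fun_eq_iff covariant_derivative_def covd_def)
    have g: "geodesic_on (\<lambda>t. coord M i (\<gamma> t)) (velocity M \<gamma> i) (times_in M \<gamma> J i)"
      using geo M i by (simp add: geodesic_iff)
    have o: "open (times_in M \<gamma> J i)"
      using geo open_times_in[OF M _ _ i] unfolding geodesic_def by blast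
    show ?thesis
      unfolding jacobi_equation_iff[OF g o, symmetric] c curvature_eq by (auto simp: times_in_def)
  qed
  then show ?thesis unfolding jacobi_field_def by blast
qed

section \<open>Transition maps\<close>

lemma atlas_inj: "smooth_atlas M \<Longrightarrow> i \<in> idx M \<Longrightarrow> inj_on (coord M i) (patch M i)"
  unfolding smooth_atlas_def homeomorphism_def by (metis inj_on_inverseI)

lemma transition_coord:
  assumes "smooth_atlas M" "i \<in> idx M" "p \<in> patch M i"
  shows "transition M i j (coord M i p) = coord M j p"
  using inv_into_f_f[OF atlas_inj[OF assms(1,2)] assms(3)] by (simp add: transition_def)

lemma transition_has_derivative:
  assumes M: "smooth_atlas M" and i: "i \<in> idx M" and j: "j \<in> idx M" and p: "p \<in> patch M i \<inter> patch M j"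
  shows "(transition M i j has_derivative frechet_derivative (transition M i j) (at (coord M i p))) (at (coord M i p))"
proof -
  have "smooth_on (coord M i ` (patch M i \<inter> patch M j)) (transition M i j)"
    using M i j by (auto simp: smooth_atlas_def)
  then have "transition M i j differentiable (at (coord M i p))"
    using p smooth_on_imp_differentiable by blast
  then show ?thesis using frechet_derivative_works by blast
qed

lemma velocity_transition:
  assumes M: "smooth_atlas M" and i: "i \<in> idx M" and j: "j \<in> idx M"
    and J: "open J" "continuous_on J \<gamma>" and t: "t \<in> J" "\<gamma> t \<in> patch M i \<inter> patch M j"
    and d: "((\<lambda>t. coord M i (\<gamma> t)) has_vector_derivative v) (at t)"
  shows "velocity M \<gamma> j t = frechet_derivative (transition M i j) (at (coord M i (\<gamma> t))) v"
proof -
  have o: "open (J \<inter> \<gamma> -` patch M i)"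
    using J M i continuous_open_preimage unfolding smooth_atlas_def by blast
  have "((transition M i j \<circ> (\<lambda>t. coord M i (\<gamma> t))) has_vector_derivative
      frechet_derivative (transition M i j) (at (coord M i (\<gamma> t))) v) (at t)"
    by (rule vector_derivative_diff_chain_within[OF d has_derivative_at_withinI[OF transition_has_derivative[OF M i j t(2)]]])
  then have "((coord M j \<circ> \<gamma>) has_vector_derivative
      frechet_derivative (transition M i j) (at (coord M i (\<gamma> t))) v) (at t)"
    by (rule has_vector_derivative_transform_within_open[OF _ o])
       (use t in \<open>auto simp: transition_coord[OF M i]\<close>)
  then show ?thesis unfolding velocity_def by (rule vector_derivative_at)
qed

section \<open>The manifold structure of the fiber and of the spacetime\<close>

lemma riemannian_manifold_chart:
  assumes "riemannian_manifold M" "i \<in> idx M"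
  shows "riemannian_chart (chart_image M i) (metric M i)"
  using assms unfolding riemannian_manifold_def smooth_atlas_def
  by unfold_locales auto

lemma riemannian_connection_mfd:
  assumes "riemannian_manifold M" shows "connection_mfd M"
proof -
  have "connection_chart (chart_image M i) (christoffel M i)" if "i \<in> idx M" for i
  proof -
    interpret riemannian_chart "chart_image M i" "metric M i"
      using riemannian_manifold_chart[OF assms that] .
    show ?thesis unfolding christoffel_eq by (rule connection_chart_axioms)
  qed
  then show ?thesis using assms
    by (auto simp: connection_mfd_def riemannian_manifold_def smooth_atlas_def)
qed

locale grw_spacetime =
  fixes F :: "('i, 'p::t2_space, 'e::euclidean_space) mfd"
    and I :: "real set" and f :: "real \<Rightarrow> real"
  assumes riem: "riemannian_manifold F" and open_I: "open I" and conn_I: "connected I"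
    and f_smooth: "smooth_on I f" and f_pos: "\<tau> \<in> I \<Longrightarrow> f \<tau> > 0"
begin

abbreviation "M \<equiv> grw I f F"

lemma atlas: "smooth_atlas F" using riem by (simp add: riemannian_manifold_def)

lemma F_conn: "connection_mfd F" by (rule riemannian_connection_mfd[OF riem])

lemma chart: "i \<in> idx F \<Longrightarrow> grw_chart (chart_image F i) (metric F i) I f"
  unfolding grw_chart_def grw_chart_axioms_def
  using riemannian_manifold_chart[OF riem] open_I f_smooth f_pos by blast

lemma grw_simps [simp]: "idx M = idx F" "patch M i = I \<times> patch F i"
  "coord M i z = (fst z, coord F i (snd z))"
  by (simp_all add: grw_def split_beta)

lemma grw_image: "chart_image M i = I \<times> chart_image F i"
  by force

lemma grw_points: "points M = I \<times> points F"
  by (auto simp: points_def)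

lemma grw_metric: "i \<in> idx F \<Longrightarrow> metric M i = grw_chart.wg (metric F i) f"
  using grw_chart.wg_def[OF chart] by (force simp: grw_def fun_eq_iff)

lemma M_conn: "connection_mfd M"
proof -
  have "connection_chart (chart_image M i) (christoffel M i)" if "i \<in> idx F" for i
  proof -
    interpret grw_chart "chart_image F i" "metric F i" I f by (rule chart[OF that])
    show ?thesis unfolding christoffel_eq grw_image grw_metric[OF that] by (rule W.connection_chart_axioms)
  qed
  moreover have "open (patch F i)" if "i \<in> idx F" for i
    using F_conn that by (auto simp: connection_mfd_def)
  ultimately show ?thesis using open_I
    by (auto simp: connection_mfd_def intro: open_Times)
qed

text \<open>On the open set \<open>I \<times> chart_image F i\<close> the transition map is the
  identity in time and that of the fiber in space; hence time components of vector fields do not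
  depend on the chart.\<close>

lemma grw_transition_derivative:
  assumes i: "i \<in> idx F" and j: "j \<in> idx F" and p: "p \<in> patch F i \<inter> patch F j" and \<tau>: "\<tau> \<in> I"
  shows "frechet_derivative (transition M i j) (at (\<tau>, coord F i p)) \<nu> =
    (fst \<nu>, frechet_derivative (transition F i j) (at (coord F i p)) (snd \<nu>))"
proof -
  let ?D = "frechet_derivative (transition F i j) (at (coord F i p))"
  have snd: "((\<lambda>y. transition F i j (snd y)) has_derivative (\<lambda>\<nu>. ?D (snd \<nu>))) (at (\<tau>, coord F i p))"
    by (rule has_derivative_comp_snd) (simp add: transition_has_derivative[OF atlas i j p])
  have D: "((\<lambda>y. (fst y, transition F i j (snd y))) has_derivative (\<lambda>\<nu>. (fst \<nu>, ?D (snd \<nu>)))) (at (\<tau>, coord F i p))"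
    by (intro has_derivative_Pair snd has_derivative_fst has_derivative_ident)
  have inj: "inj_on (coord M i) (I \<times> patch F i)"
    using atlas_inj[OF atlas i] by (auto simp: inj_on_def)
  have e: "(fst y, transition F i j (snd y)) = transition M i j y" if "y \<in> I \<times> chart_image F i" for y
  proof -
    obtain \<tau>' q where y: "y = coord M i (\<tau>', q)" "\<tau>' \<in> I" "q \<in> patch F i" using \<open>y \<in> _\<close> by auto
    then have "inv_into (I \<times> patch F i) (coord M i) y = (\<tau>', q)"
      using inv_into_f_f[OF inj, of "(\<tau>', q)"] by simp
    then have "transition M i j y = (\<tau>', coord F j q)" by (simp add: transition_def)
    then show ?thesis using y transition_coord[OF atlas i] by simp
  qed
  have "open (I \<times> chart_image F i)" using open_I atlas i by (auto simp: smooth_atlas_def intro: open_Times)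
  from has_derivative_transform_within_open[OF D this _ e]
  have "(transition M i j has_derivative (\<lambda>\<nu>. (fst \<nu>, ?D (snd \<nu>)))) (at (\<tau>, coord F i p))"
    using \<tau> p by auto
  from frechet_derivative_at[OF this, symmetric] show ?thesis by simp
qed

text \<open>For a vector field \<open>V\<close>, the choice of the chart does not matter, by the transformation laws.\<close>

definition vprod :: "(real \<Rightarrow> 'p) \<Rightarrow> ('i \<Rightarrow> real \<Rightarrow> 'e) \<Rightarrow> real \<Rightarrow> real" where
  "vprod \<sigma> V r = (let i = (SOME i. i \<in> idx F \<and> \<sigma> r \<in> patch F i) in
     metric F i (coord F i (\<sigma> r)) (velocity F \<sigma> i r) (V i r))"

lemma F_geodesic_chart:
  assumes "geodesic F \<sigma> K" "i \<in> idx F"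
  shows "connection_chart.geodesic_on (chart_image F i) (koszul_christoffel (metric F i))
    (\<lambda>r. coord F i (\<sigma> r)) (velocity F \<sigma> i) (times_in F \<sigma> K i)"
  using assms F_conn by (simp add: geodesic_iff christoffel_eq)

lemma F_geodesic_chart_pointwise:
  assumes "geodesic F \<sigma> K" "i \<in> idx F" "r \<in> times_in F \<sigma> K i"
  shows "coord F i (\<sigma> r) \<in> chart_image F i"
    "((\<lambda>r. coord F i (\<sigma> r)) has_vector_derivative velocity F \<sigma> i r) (at r)"
    "(velocity F \<sigma> i has_vector_derivative - koszul_christoffel (metric F i) (coord F i (\<sigma> r)) (velocity F \<sigma> i r) (velocity F \<sigma> i r)) (at r)"
proof -
  interpret grw_chart "chart_image F i" "metric F i" I f by (rule chart[OF assms(2)])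
  show "coord F i (\<sigma> r) \<in> chart_image F i"
    "((\<lambda>r. coord F i (\<sigma> r)) has_vector_derivative velocity F \<sigma> i r) (at r)"
    "(velocity F \<sigma> i has_vector_derivative - koszul_christoffel (metric F i) (coord F i (\<sigma> r)) (velocity F \<sigma> i r) (velocity F \<sigma> i r)) (at r)"
    using F_geodesic_chart[OF assms(1,2)] assms(3) unfolding geodesic_on_def by auto
qed

lemma velocity_field:
  assumes geo: "geodesic F \<sigma> K" and i: "i \<in> idx F" and j: "j \<in> idx F"
    and r: "r \<in> K" "\<sigma> r \<in> patch F i \<inter> patch F j"
  shows "velocity F \<sigma> j r = frechet_derivative (transition F i j) (at (coord F i (\<sigma> r))) (velocity F \<sigma> i r)"
proof -
  have J: "open K" "continuous_on K \<sigma>" using geo by (auto simp: geodesic_def)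
  have "r \<in> times_in F \<sigma> K i" using r by (simp add: times_in_def)
  then show ?thesis
    by (intro velocity_transition[OF atlas i j J r(1)] r F_geodesic_chart_pointwise[OF geo i])
qed

text \<open>The transformation laws of the metric, the velocity and \<open>V\<close> replace the
  chart selected by \<open>SOME\<close> with any given one.\<close>

lemma vprod_eq:
  assumes geo: "geodesic F \<sigma> K" and i: "i \<in> idx F" and r: "r \<in> times_in F \<sigma> K i"
    and V: "\<And>i j. i \<in> idx F \<Longrightarrow> j \<in> idx F \<Longrightarrow> \<sigma> r \<in> patch F i \<inter> patch F j \<Longrightarrow>
       V j r = frechet_derivative (transition F i j) (at (coord F i (\<sigma> r))) (V i r)"
  shows "vprod \<sigma> V r = metric F i (coord F i (\<sigma> r)) (velocity F \<sigma> i r) (V i r)"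
proof -
  define j where "j = (SOME i. i \<in> idx F \<and> \<sigma> r \<in> patch F i)"
  have "j \<in> idx F \<and> \<sigma> r \<in> patch F j" unfolding j_def
    by (rule someI[where x = i]) (use i r in \<open>auto simp: times_in_def\<close>)
  then have j: "j \<in> idx F" "\<sigma> r \<in> patch F i \<inter> patch F j" using r by (auto simp: times_in_def)
  have K: "r \<in> K" using r by (auto simp: times_in_def)
  have "metric F i (coord F i (\<sigma> r)) v w = metric F j (coord F j (\<sigma> r))
      (frechet_derivative (transition F i j) (at (coord F i (\<sigma> r))) v)
      (frechet_derivative (transition F i j) (at (coord F i (\<sigma> r))) w)" for v w
    using riem i j unfolding riemannian_manifold_def Let_def by blast
  then show ?thesis
    unfolding vprod_def Let_def j_def[symmetric]
    using velocity_field[OF geo i j(1) K j(2)] V[OF i j(1) j(2)] by simp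
qed

end

section \<open>Scalar equations along a geodesic\<close>

lemma has_real_derivative_zero_constant_on:
  fixes u :: "real \<Rightarrow> real"
  assumes "connected J" "\<And>t. t \<in> J \<Longrightarrow> (u has_field_derivative 0) (at t)" "t0 \<in> J" "t \<in> J"
  shows "u t = u t0"
proof -
  have "convex J" using assms(1) is_interval_connected_1 is_interval_convex_1 by blast
  moreover have "(u has_field_derivative 0) (at t within J)" if "t \<in> J" for t
    using assms(2)[OF that] by (rule has_field_derivative_at_within)
  ultimately obtain c where "\<And>x. x \<in> J \<Longrightarrow> u x = c"
    using has_field_derivative_zero_constant[of J u] by blast
  then show ?thesis using assms by simp
qed

text \<open>\<open>u\<close> is monotone, and strictly so unless \<open>c = 0\<close>. The positive
  weight \<open>\<rho>\<close> leaves room for the factors that a change of parameter or of the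
  unknown introduces.\<close>

lemma vanishing_twice:
  fixes u :: "real \<Rightarrow> real"
  assumes J: "connected J" and t: "t0 \<in> J" "t1 \<in> J" "t0 < t1"
    and u: "\<And>t. t \<in> J \<Longrightarrow> (u has_field_derivative c * \<rho> t) (at t)"
    and \<rho>: "\<And>t. t \<in> J \<Longrightarrow> \<rho> t > 0" and z: "u t0 = 0" "u t1 = 0"
  shows "c = 0" "t \<in> J \<Longrightarrow> u t = 0"
proof -
  have "{t0..t1} \<subseteq> J" using J t connected_contains_Icc by blast
  then have "\<exists>x>t0. x < t1 \<and> u t1 - u t0 = (t1 - t0) * (c * \<rho> x)"
    by (intro MVT2 t u) auto
  then obtain x where x: "t0 < x" "x < t1" "(t1 - t0) * (c * \<rho> x) = 0" using z by auto
  have "x \<in> J" using \<open>{t0..t1} \<subseteq> J\<close> x by auto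
  then show c: "c = 0" using \<rho>[of x] x by auto
  show "u t = 0" if "t \<in> J"
    using has_real_derivative_zero_constant_on[OF J _ t(1) that, of u] u z c by simp
qed

lemma has_vector_derivative_inner:
  "(u has_vector_derivative u') (at t) \<Longrightarrow> ((\<lambda>t. u t \<bullet> b) has_field_derivative u' \<bullet> b) (at t)"
  unfolding has_real_derivative_iff_has_vector_derivative
  using bounded_linear.has_vector_derivative[OF bounded_linear_inner_left] by blast

text \<open>Since \<open>u' / \<rho>\<close> is constant, each component of \<open>u\<close> has a
  constant multiple of \<open>\<rho>\<close> as derivative.\<close>

lemma vanishing_twice_vector:
  fixes u :: "real \<Rightarrow> 'v::euclidean_space"
  assumes T: "connected T" and t: "t0 \<in> T" "t1 \<in> T" "t0 < t1"
    and u: "\<And>t. t \<in> T \<Longrightarrow> (u has_vector_derivative u' t) (at t)"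
    and \<rho>: "\<And>t. t \<in> T \<Longrightarrow> \<rho> t > 0"
    and c: "\<And>t. t \<in> T \<Longrightarrow> ((\<lambda>t. u' t /\<^sub>R \<rho> t) has_vector_derivative 0) (at t)"
    and z: "u t0 = 0" "u t1 = 0" and tT: "t \<in> T"
  shows "u t = 0"
proof (rule euclidean_eqI)
  fix b :: 'v
  have const: "(u' t /\<^sub>R \<rho> t) \<bullet> b = (u' t0 /\<^sub>R \<rho> t0) \<bullet> b" if "t \<in> T" for t
    by (rule has_real_derivative_zero_constant_on[OF T _ t(1) that])
       (use has_vector_derivative_inner[OF c, of _ b] in simp)
  have "((\<lambda>t. u t \<bullet> b) has_field_derivative ((u' t0 /\<^sub>R \<rho> t0) \<bullet> b) * \<rho> t) (at t)" if "t \<in> T" for t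
    using has_vector_derivative_inner[OF u[OF that], of b] const[OF that] \<rho>[OF that]
    by (simp add: field_simps)
  from vanishing_twice(2)[OF T t this \<rho> _ _ tT] z show "u t \<bullet> b = 0 \<bullet> b" by simp
qed

text \<open>Here \<open>f0\<close>, \<open>f1\<close>, \<open>f2\<close> stand for \<open>f\<close>
  and its derivatives along the geodesic, \<open>v\<close> for the product of fiber component and
  fiber velocity, and \<open>p\<close> for its derivative in the fiber parameter. Detached from the
  charts, the problem is plain calculus: two first integrals eliminate \<open>p\<close> and
  \<open>\<alpha>\<close>, and what remains is a monotone function with two zeros.\<close>

lemma grw_jacobi_scalar:
  fixes f0 f1 f2 \<tau>1 h1 \<alpha> \<alpha>1 v p m m1 :: "real \<Rightarrow> real"
  assumes J: "connected J" and t: "t0 \<in> J" "t1 \<in> J" "t0 < t1"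
    and f0: "\<And>t. t \<in> J \<Longrightarrow> f0 t > 0"
    and d0: "\<And>t. t \<in> J \<Longrightarrow> (f0 has_field_derivative f1 t * \<tau>1 t) (at t)"
    and d1: "\<And>t. t \<in> J \<Longrightarrow> (f1 has_field_derivative f2 t * \<tau>1 t) (at t)"
    and \<tau>1: "\<And>t. t \<in> J \<Longrightarrow> \<tau>1 t \<noteq> 0"
    and d\<tau>1: "\<And>t. t \<in> J \<Longrightarrow> (\<tau>1 has_field_derivative - (f0 t * f1 t * ((h1 t)\<^sup>2 * s))) (at t)"
    and h1: "\<And>t. t \<in> J \<Longrightarrow> h1 t = l / (f0 t)\<^sup>2" and l: "l > 0"
    and d\<alpha>: "\<And>t. t \<in> J \<Longrightarrow> (\<alpha> has_field_derivative \<alpha>1 t) (at t)"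
    and d\<alpha>1: "\<And>t. t \<in> J \<Longrightarrow> (\<alpha>1 has_field_derivative
       - 2 * (f0 t * f1 t) * ((h1 t)\<^sup>2 * p t) - ((f1 t)\<^sup>2 + f0 t * f2 t) * \<alpha> t * ((h1 t)\<^sup>2 * s)) (at t)"
    and dv: "\<And>t. t \<in> J \<Longrightarrow> (v has_field_derivative h1 t * p t) (at t)"
    and dp: "\<And>t. t \<in> J \<Longrightarrow> (p has_field_derivative - 2 * s * m1 t) (at t)"
    and m: "\<And>t. m t = f1 t / f0 t * \<alpha> t"
    and m1: "\<And>t. m1 t = (f2 t / f0 t - (f1 t)\<^sup>2 / (f0 t)\<^sup>2) * \<tau>1 t * \<alpha> t + f1 t / f0 t * \<alpha>1 t"
    and z: "\<alpha> t0 = 0" "\<alpha> t1 = 0" "v t0 = 0" "v t1 = 0"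
    and tJ: "t \<in> J"
  shows "\<alpha> t = 0"
proof -
  have dm: "(m has_field_derivative m1 t) (at t)" if "t \<in> J" for t
    unfolding m1 m using f0[OF that]
    by (auto intro!: derivative_eq_intros d0 d1 d\<alpha> that simp: field_simps power2_eq_square)
  \<comment> \<open>A first integral, since the derivative of \<open>p\<close> is
    \<open>- 2 * s\<close> times that of \<open>m\<close>. Its constancy will fix the sign of the
    derivative of \<open>v / (\<tau>1)\<^sup>2\<close>.\<close>
  define c where "c = p t0 + 2 * s * m t0"
  have c: "p t = c - 2 * s * m t" if "t \<in> J" for t
  proof -
    have "p t + 2 * s * m t = p t0 + 2 * s * m t0"
      by (rule has_real_derivative_zero_constant_on[OF J _ t(1) that])
         (auto intro!: derivative_eq_intros dp dm)
    then show ?thesis by (simp add: c_def)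
  qed
  \<comment> \<open>The Lorentzian product of the Jacobi field with the velocity, where
    \<open>f\<^sup>2 * h1\<close> has been replaced by \<open>l\<close>; \<open>q1\<close> is its
    derivative.\<close>
  define q where "q t = l * v t - \<tau>1 t * \<alpha> t" for t
  define q1 where "q1 t = s * l\<^sup>2 * f1 t / (f0 t)^3 * \<alpha> t - \<tau>1 t * \<alpha>1 t + l\<^sup>2 * p t / (f0 t)\<^sup>2" for t
  have dq: "(q has_field_derivative q1 t) (at t)" if "t \<in> J" for t
    unfolding q_def[abs_def] q1_def using f0[OF that]
    by (auto intro!: derivative_eq_intros dv d\<tau>1 d\<alpha> that simp: h1[OF that] field_simps power2_eq_square power3_eq_cube)
  have dq1: "(q1 has_field_derivative 0) (at t)" if "t \<in> J" for t
    unfolding q1_def[abs_def] using f0[OF that]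
    by (auto intro!: derivative_eq_intros dp d0 d1 d\<tau>1 d\<alpha> d\<alpha>1 that simp: h1[OF that] m1)
       (simp add: field_simps eval_nat_numeral)
  have "q t = 0" if "t \<in> J" for t
  proof (rule vanishing_twice(2)[OF J t, of q "q1 t0" "\<lambda>_. 1"])
    show "(q has_field_derivative q1 t0 * 1) (at t)" if "t \<in> J" for t
      using dq[OF that] has_real_derivative_zero_constant_on[OF J dq1 t(1) that] by simp
  qed (use z that in \<open>auto simp: q_def\<close>)
  then have \<alpha>: "\<alpha> t = l * v t / \<tau>1 t" if "t \<in> J" for t
    using that \<tau>1[OF that] by (simp add: q_def field_simps)
  \<comment> \<open>With \<open>\<alpha> = l * v / \<tau>1\<close> inserted in \<open>p\<close>, the
    terms of the derivative that contain \<open>v\<close> cancel, which leaves \<open>c\<close>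
    times a positive weight.\<close>
  have "v t / (\<tau>1 t)\<^sup>2 = 0"
  proof (rule vanishing_twice(2)[OF J t, of "\<lambda>t. v t / (\<tau>1 t)\<^sup>2" c "\<lambda>t. h1 t / (\<tau>1 t)\<^sup>2"])
    fix t assume tJ: "t \<in> J"
    have "((\<lambda>t. v t / (\<tau>1 t)\<^sup>2) has_field_derivative
      (h1 t * p t * (\<tau>1 t)\<^sup>2 - v t * (2 * (- (f0 t * f1 t * ((h1 t)\<^sup>2 * s))) * \<tau>1 t)) / ((\<tau>1 t)\<^sup>2 * (\<tau>1 t)\<^sup>2)) (at t)"
      using \<tau>1[OF tJ] by (auto intro!: derivative_eq_intros dv d\<tau>1 tJ)
    moreover have "(h1 t * p t * (\<tau>1 t)\<^sup>2 - v t * (2 * (- (f0 t * f1 t * ((h1 t)\<^sup>2 * s))) * \<tau>1 t)) / ((\<tau>1 t)\<^sup>2 * (\<tau>1 t)\<^sup>2)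
        = c * (h1 t / (\<tau>1 t)\<^sup>2)"
      using f0[OF tJ] \<tau>1[OF tJ] unfolding c[OF tJ] m \<alpha>[OF tJ] h1[OF tJ]
      by (simp add: field_simps power2_eq_square)
    ultimately show "((\<lambda>t. v t / (\<tau>1 t)\<^sup>2) has_field_derivative c * (h1 t / (\<tau>1 t)\<^sup>2)) (at t)" by simp
    show "0 < h1 t / (\<tau>1 t)\<^sup>2" using \<tau>1[OF tJ] f0[OF tJ] l by (simp add: h1[OF tJ])
  qed (use z tJ in auto)
  then show ?thesis using \<alpha>[OF tJ] \<tau>1[OF tJ] by simp
qed

lemma (in connection_chart) geodesic_on_cong:
  assumes "open T" "\<And>t. t \<in> T \<Longrightarrow> x t = x' t" "\<And>t. t \<in> T \<Longrightarrow> v t = v' t" "geodesic_on x v T"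
  shows "geodesic_on x' v' T"
  unfolding geodesic_on_def
proof (intro ballI conjI)
  fix t assume t: "t \<in> T"
  then have *: "x t \<in> S" "(x has_vector_derivative v t) (at t)" "(v has_vector_derivative - \<Gamma> (x t) (v t) (v t)) (at t)"
    using assms(4) by (auto simp: geodesic_on_def)
  show "x' t \<in> S" using * assms(2)[OF t] by simp
  show "(x' has_vector_derivative v' t) (at t)"
    using has_vector_derivative_transform_within_open[OF *(2) assms(1) t] assms(2) assms(3)[OF t] by simp
  show "(v' has_vector_derivative - \<Gamma> (x' t) (v' t) (v' t)) (at t)"
    using has_vector_derivative_transform_within_open[OF *(3) assms(1) t assms(3)] assms(2)[OF t] assms(3)[OF t] by simp
qed

lemma (in connection_chart) jacobi_on_cong:
  assumes "\<And>t. t \<in> T \<Longrightarrow> x t = x' t" "\<And>t. t \<in> T \<Longrightarrow> v t = v' t" "\<And>t. t \<in> T \<Longrightarrow> \<phi> t = \<phi>' t"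
  shows "jacobi_on x v \<phi> V V' T \<longleftrightarrow> jacobi_on x' v' \<phi>' V V' T"
  using assms by (simp add: jacobi_on_def)

lemma (in connection_chart) dB_scale:
  assumes "x \<in> S"
  shows "dB x u (c *\<^sub>R v) (c *\<^sub>R w) = (c * c) *\<^sub>R dB x u v w"
proof -
  note b = bilinear_derivative[OF assms, of u]
  show ?thesis using bilinear_lmul[OF b, of c v "c *\<^sub>R w"] bilinear_rmul[OF b, of v c w] by simp
qed

section \<open>Chart-independent functions along geodesics\<close>

context grw_spacetime
begin

abbreviation transforms :: "(real \<Rightarrow> 'p) \<Rightarrow> real set \<Rightarrow> ('i \<Rightarrow> real \<Rightarrow> 'e) \<Rightarrow> bool" where
  "transforms \<sigma> K V \<equiv> (\<forall>i\<in>idx F. \<forall>j\<in>idx F. \<forall>t\<in>K. \<sigma> t \<in> patch F i \<inter> patch F j \<longrightarrow>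
        V j t = frechet_derivative (transition F i j) (at (coord F i (\<sigma> t))) (V i t))"

lemma geodesic_ex_chart: "geodesic F \<sigma> K \<Longrightarrow> r \<in> K \<Longrightarrow> \<exists>i\<in>idx F. r \<in> times_in F \<sigma> K i"
proof -
  assume "geodesic F \<sigma> K" and r: "r \<in> K"
  then have "\<sigma> r \<in> points F" unfolding geodesic_def by auto
  then obtain i where "i \<in> idx F" "\<sigma> r \<in> patch F i" unfolding points_def by blast
  then show ?thesis using r unfolding times_in_def by blast
qed

lemma M_geodesic_chart:
  assumes "geodesic M \<gamma> J" and i: "i \<in> idx F"
  shows "connection_chart.geodesic_on (I \<times> chart_image F i) (koszul_christoffel (grw_chart.wg (metric F i) f))
    (\<lambda>t. coord M i (\<gamma> t)) (velocity M \<gamma> i) (times_in M \<gamma> J i)"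
proof -
  have "\<forall>i\<in>idx M. connection_chart.geodesic_on (chart_image M i) (christoffel M i)
        (\<lambda>t. coord M i (\<gamma> t)) (velocity M \<gamma> i) (times_in M \<gamma> J i)"
    using assms(1) unfolding geodesic_iff[OF M_conn] by (elim conjE)
  then have "connection_chart.geodesic_on (chart_image M i) (christoffel M i)
        (\<lambda>t. coord M i (\<gamma> t)) (velocity M \<gamma> i) (times_in M \<gamma> J i)"
    by (rule bspec) (simp add: i)
  then show ?thesis unfolding grw_image christoffel_eq grw_metric[OF i] .
qed

lemma vprod_chart:
  assumes "geodesic F \<sigma> K" "i \<in> idx F" "r \<in> times_in F \<sigma> K i" "transforms \<sigma> K V"
  shows "vprod \<sigma> V r = metric F i (coord F i (\<sigma> r)) (velocity F \<sigma> i r) (V i r)"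
proof (rule vprod_eq[OF assms(1-3)])
  fix i j assume "i \<in> idx F" "j \<in> idx F" "\<sigma> r \<in> patch F i \<inter> patch F j"
  moreover have "r \<in> K" using assms(3) by (simp add: times_in_def)
  ultimately show "V j r = frechet_derivative (transition F i j) (at (coord F i (\<sigma> r))) (V i r)"
    using assms(4) by blast
qed

lemma F_times_open: "geodesic F \<sigma> K \<Longrightarrow> i \<in> idx F \<Longrightarrow> open (times_in F \<sigma> K i)"
  using open_times_in[OF F_conn] by (auto simp: geodesic_def)

lemma velocity_transforms: "geodesic F \<sigma> K \<Longrightarrow> transforms \<sigma> K (velocity F \<sigma>)"
  using velocity_field by blast

text \<open>In each chart the squared speed has derivative \<open>0\<close>; \<open>vprod\<close>
  glues the charts over the connected domain.\<close>

lemma speed_const: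
  assumes geo: "geodesic F \<sigma> K"
  obtains s where "s \<ge> 0"
    "\<And>i r. i \<in> idx F \<Longrightarrow> r \<in> times_in F \<sigma> K i \<Longrightarrow>
       metric F i (coord F i (\<sigma> r)) (velocity F \<sigma> i r) (velocity F \<sigma> i r) = s"
proof -
  obtain r0 where r0: "r0 \<in> K" using geo by (auto simp: geodesic_def)
  have d: "(vprod \<sigma> (velocity F \<sigma>) has_field_derivative 0) (at r)" if rK: "r \<in> K" for r
  proof -
    obtain i where i: "i \<in> idx F" "r \<in> times_in F \<sigma> K i" using geodesic_ex_chart[OF geo rK] by blast
    interpret grw_chart "chart_image F i" "metric F i" I f by (rule chart[OF i(1)])
    show ?thesis
      unfolding has_real_derivative_iff_has_vector_derivative
      by (rule has_vector_derivative_transform_within_open[OF speed_constant[OF F_geodesic_chart[OF geo i(1)] i(2)]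
            F_times_open[OF geo i(1)] i(2)])
         (simp add: vprod_chart[OF geo i(1) _ velocity_transforms[OF geo]])
  qed
  have eq: "metric F i (coord F i (\<sigma> r)) (velocity F \<sigma> i r) (velocity F \<sigma> i r) = vprod \<sigma> (velocity F \<sigma>) r0"
    if "i \<in> idx F" "r \<in> times_in F \<sigma> K i" for i r
    using has_real_derivative_zero_constant_on[OF _ d r0, of r] geo that
      vprod_chart[OF geo that velocity_transforms[OF geo]] by (auto simp: geodesic_def times_in_def)
  obtain i where i: "i \<in> idx F" "r0 \<in> times_in F \<sigma> K i" using geodesic_ex_chart[OF geo r0] by blast
  interpret grw_chart "chart_image F i" "metric F i" I f by (rule chart[OF i(1)])
  have "coord F i (\<sigma> r0) \<in> chart_image F i" using i by (auto simp: times_in_def)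
  then have "metric F i (coord F i (\<sigma> r0)) (velocity F \<sigma> i r0) (velocity F \<sigma> i r0) \<ge> 0"
    using g_pos[of "coord F i (\<sigma> r0)" "velocity F \<sigma> i r0"] by (cases "velocity F \<sigma> i r0 = 0") (auto simp: G.zero_left)
  then show ?thesis using that[of "vprod \<sigma> (velocity F \<sigma>) r0"] eq eq[OF i] by simp
qed

text \<open>Since \<open>vprod\<close> does not refer to a particular chart, neither does its
  derivative; thus the product of the velocity with the covariant derivative of \<open>V\<close>
  becomes a global function without a separate transformation law.\<close>

lemma vprod_jacobi:
  assumes geo: "geodesic F \<sigma> K" and V: "transforms \<sigma> K V" and i: "i \<in> idx F" and r: "r \<in> times_in F \<sigma> K i"
    and jac: "connection_chart.jacobi_on (christoffel F i) (\<lambda>r. coord F i (\<sigma> r)) (velocity F \<sigma> i) \<phi> (V i) V' (times_in F \<sigma> K i)"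
  shows "(vprod \<sigma> V has_field_derivative deriv (vprod \<sigma> V) r) (at r)"
    "deriv (vprod \<sigma> V) r = metric F i (coord F i (\<sigma> r)) (velocity F \<sigma> i r)
        (V' r + christoffel F i (coord F i (\<sigma> r)) (velocity F \<sigma> i r) (V i r))"
    "(deriv (vprod \<sigma> V) has_field_derivative metric F i (coord F i (\<sigma> r)) (velocity F \<sigma> i r) (\<phi> r)) (at r)"
proof -
  interpret grw_chart "chart_image F i" "metric F i" I f by (rule chart[OF i])
  note ij = inner_jacobi[OF F_geodesic_chart[OF geo i] jac[unfolded christoffel_eq]]
  let ?p = "\<lambda>r. metric F i (coord F i (\<sigma> r)) (velocity F \<sigma> i r)
        (V' r + christoffel F i (coord F i (\<sigma> r)) (velocity F \<sigma> i r) (V i r))"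
  have 1: "(vprod \<sigma> V has_field_derivative ?p r) (at r)" if "r \<in> times_in F \<sigma> K i" for r
    unfolding has_real_derivative_iff_has_vector_derivative christoffel_eq
    by (rule has_vector_derivative_transform_within_open[OF ij(1)[OF that] F_times_open[OF geo i] that])
       (simp add: vprod_chart[OF geo i _ V])
  have e: "deriv (vprod \<sigma> V) r = ?p r" if "r \<in> times_in F \<sigma> K i" for r
    using 1[OF that] by (rule DERIV_imp_deriv)
  show "(vprod \<sigma> V has_field_derivative deriv (vprod \<sigma> V) r) (at r)" using 1[OF r] e[OF r] by simp
  show "deriv (vprod \<sigma> V) r = ?p r" by (rule e[OF r])
  show "(deriv (vprod \<sigma> V) has_field_derivative metric F i (coord F i (\<sigma> r)) (velocity F \<sigma> i r) (\<phi> r)) (at r)"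
    unfolding has_real_derivative_iff_has_vector_derivative
    by (rule has_vector_derivative_transform_within_open[OF ij(2)[OF r] F_times_open[OF geo i] r])
       (simp add: e christoffel_eq)
qed

end

section \<open>Time and fiber components of a spacetime geodesic\<close>

locale grw_geodesic = grw_spacetime F I f
  for F :: "('i, 'p::t2_space, 'e::euclidean_space) mfd" and I f +
  fixes \<gamma> :: "real \<Rightarrow> real \<times> 'p" and J :: "real set" and \<sigma> :: "real \<Rightarrow> 'p" and K :: "real set" and h :: "real \<Rightarrow> real"
  assumes geo: "geodesic M \<gamma> J" and fgeo: "geodesic F \<sigma> K" and h_smooth: "smooth_on J h"
    and h_pos: "t \<in> J \<Longrightarrow> deriv h t > 0" and h_K: "t \<in> J \<Longrightarrow> h t \<in> K"
    and proj: "t \<in> J \<Longrightarrow> \<sigma> (h t) = snd (\<gamma> t)"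
begin

abbreviation "\<tau> \<equiv> \<lambda>t. fst (\<gamma> t)"
definition "\<tau>1 = deriv \<tau>"
abbreviation "h1 \<equiv> deriv h"
abbreviation "h2 \<equiv> deriv (deriv h)"
abbreviation "x i \<equiv> \<lambda>r. coord F i (\<sigma> r)"
abbreviation "w i \<equiv> velocity F \<sigma> i"
abbreviation "TM i \<equiv> times_in M \<gamma> J i"
abbreviation "TF i \<equiv> times_in F \<sigma> K i"

lemma J: "open J" "connected J" "J \<noteq> {}" and K: "open K" "connected K"
  using geo fgeo by (auto simp: geodesic_def)

lemma \<tau>_I: "t \<in> J \<Longrightarrow> \<tau> t \<in> I"
  using geo grw_points by (force simp: geodesic_def)

lemma TM_iff: "t \<in> TM i \<longleftrightarrow> t \<in> J \<and> h t \<in> TF i"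
  using \<tau>_I proj h_K by (auto simp: times_in_def mem_Times_iff)

lemma ex_chart: "t \<in> J \<Longrightarrow> \<exists>i\<in>idx F. t \<in> TM i"
  using geodesic_ex_chart[OF fgeo h_K] by (auto simp: TM_iff)

lemma TM_open: "i \<in> idx F \<Longrightarrow> open (TM i)"
  using open_times_in[OF M_conn] geo by (auto simp: geodesic_def)

lemma h_deriv: "t \<in> J \<Longrightarrow> (h has_field_derivative h1 t) (at t)" "t \<in> J \<Longrightarrow> (h1 has_field_derivative h2 t) (at t)"
  using smooth_on_real_has_field_derivative h_smooth smooth_on_deriv[OF h_smooth J(1)] by blast+

lemma h_comp:
  assumes "t \<in> J" "(u has_vector_derivative u') (at (h t))"
  shows "((\<lambda>t. u (h t)) has_vector_derivative h1 t *\<^sub>R u') (at t)"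
  using vector_diff_chain_at[OF h_deriv(1)[OF assms(1), unfolded has_real_derivative_iff_has_vector_derivative] assms(2)]
  by (simp add: comp_def)

lemma velocity_M:
  assumes i: "i \<in> idx F" and t: "t \<in> TM i"
  shows "velocity M \<gamma> i t = (\<tau>1 t, h1 t *\<^sub>R w i (h t))" "(\<tau> has_field_derivative \<tau>1 t) (at t)"
proof -
  interpret grw_chart "chart_image F i" "metric F i" I f by (rule chart[OF i])
  have tJ: "t \<in> J" "h t \<in> TF i" using t by (auto simp: TM_iff)
  have "((\<lambda>t. coord M i (\<gamma> t)) has_vector_derivative velocity M \<gamma> i t) (at t)"
    using M_geodesic_chart[OF geo i] t unfolding W.geodesic_on_def by blast
  then have "((\<lambda>t. (\<tau> t, coord F i (snd (\<gamma> t)))) has_vector_derivative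
      (fst (velocity M \<gamma> i t), snd (velocity M \<gamma> i t))) (at t)" by simp
  then have 1: "(\<tau> has_vector_derivative fst (velocity M \<gamma> i t)) (at t)"
    and 2: "((\<lambda>t. coord F i (snd (\<gamma> t))) has_vector_derivative snd (velocity M \<gamma> i t)) (at t)"
    unfolding has_vector_derivative_Pair_iff by auto
  have \<tau>: "(\<tau> has_field_derivative fst (velocity M \<gamma> i t)) (at t)"
    using 1 by (simp add: has_real_derivative_iff_has_vector_derivative)
  then have f: "fst (velocity M \<gamma> i t) = \<tau>1 t" unfolding \<tau>1_def by (rule DERIV_imp_deriv[symmetric])
  have "((\<lambda>t. x i (h t)) has_vector_derivative h1 t *\<^sub>R w i (h t)) (at t)"
    by (rule h_comp[OF tJ(1) F_geodesic_chart_pointwise(2)[OF fgeo i tJ(2)]])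
  then have "((\<lambda>t. coord F i (snd (\<gamma> t))) has_vector_derivative h1 t *\<^sub>R w i (h t)) (at t)"
    by (rule has_vector_derivative_transform_within_open[OF _ J(1) tJ(1)]) (simp add: proj)
  with 2 have "snd (velocity M \<gamma> i t) = h1 t *\<^sub>R w i (h t)" by (rule vector_derivative_unique_at)
  with f show "velocity M \<gamma> i t = (\<tau>1 t, h1 t *\<^sub>R w i (h t))" by (simp add: prod_eq_iff)
  show "(\<tau> has_field_derivative \<tau>1 t) (at t)" using \<tau> f by simp
qed

lemma \<tau>_deriv: "t \<in> J \<Longrightarrow> (\<tau> has_field_derivative \<tau>1 t) (at t)"
  using ex_chart velocity_M(2) by blast

lemma M_geodesic_equations:
  assumes i: "i \<in> idx F" and t: "t \<in> TM i"
  shows "(\<tau>1 has_vector_derivative - (warp_\<psi> f (\<tau> t) * metric F i (x i (h t)) (h1 t *\<^sub>R w i (h t)) (h1 t *\<^sub>R w i (h t)))) (at t)"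
    "((\<lambda>t. h1 t *\<^sub>R w i (h t)) has_vector_derivative
       - koszul_christoffel (metric F i) (x i (h t)) (h1 t *\<^sub>R w i (h t)) (h1 t *\<^sub>R w i (h t))
       - (2 * warp_\<eta> f (\<tau> t) * \<tau>1 t) *\<^sub>R (h1 t *\<^sub>R w i (h t))) (at t)"
proof -
  interpret grw_chart "chart_image F i" "metric F i" I f by (rule chart[OF i])
  note M_geodesic_chart[OF geo i]
  then have "W.geodesic_on (\<lambda>t. (\<tau> t, x i (h t))) (\<lambda>t. (\<tau>1 t, h1 t *\<^sub>R w i (h t))) (TM i)"
    by (rule W.geodesic_on_cong[OF TM_open[OF i], rotated 2])
       (auto simp: velocity_M(1)[OF i] TM_iff proj)
  then show "(\<tau>1 has_vector_derivative - (warp_\<psi> f (\<tau> t) * metric F i (x i (h t)) (h1 t *\<^sub>R w i (h t)) (h1 t *\<^sub>R w i (h t)))) (at t)"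
    "((\<lambda>t. h1 t *\<^sub>R w i (h t)) has_vector_derivative
       - koszul_christoffel (metric F i) (x i (h t)) (h1 t *\<^sub>R w i (h t)) (h1 t *\<^sub>R w i (h t))
       - (2 * warp_\<eta> f (\<tau> t) * \<tau>1 t) *\<^sub>R (h1 t *\<^sub>R w i (h t))) (at t)"
    unfolding W_geodesic_on_iff using t by auto
qed

text \<open>The squared speed of \<open>\<sigma>\<close>, which by \<open>speed_const\<close>
  depends neither on the chart nor on the parameter.\<close>

definition "s = (SOME s. s \<ge> 0 \<and> (\<forall>i r. i \<in> idx F \<longrightarrow> r \<in> TF i \<longrightarrow> metric F i (x i r) (w i r) (w i r) = s))"

lemma s_nonneg: "s \<ge> 0" and s_speed: "i \<in> idx F \<Longrightarrow> r \<in> TF i \<Longrightarrow> metric F i (x i r) (w i r) (w i r) = s"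
proof -
  have "s \<ge> 0 \<and> (\<forall>i r. i \<in> idx F \<longrightarrow> r \<in> TF i \<longrightarrow> metric F i (x i r) (w i r) (w i r) = s)"
    unfolding s_def by (rule someI_ex) (metis speed_const[OF fgeo])
  then show "s \<ge> 0" "i \<in> idx F \<Longrightarrow> r \<in> TF i \<Longrightarrow> metric F i (x i r) (w i r) (w i r) = s" by auto
qed

lemma speed_M:
  assumes i: "i \<in> idx F" and t: "t \<in> TM i"
  shows "metric F i (x i (h t)) (h1 t *\<^sub>R w i (h t)) (h1 t *\<^sub>R w i (h t)) = (h1 t)\<^sup>2 * s"
proof -
  interpret grw_chart "chart_image F i" "metric F i" I f by (rule chart[OF i])
  have r: "h t \<in> TF i" "x i (h t) \<in> chart_image F i"
    using t unfolding TM_iff by (auto simp: times_in_def)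
  show ?thesis using s_speed[OF i r(1)] by (simp add: G.scale_left G.scale_right r(2) power2_eq_square)
qed

lemma \<tau>1_deriv: assumes "t \<in> J"
  shows "(\<tau>1 has_field_derivative - (warp_\<psi> f (\<tau> t) * ((h1 t)\<^sup>2 * s))) (at t)"
proof -
  obtain i where i: "i \<in> idx F" "t \<in> TM i" using ex_chart[OF assms] by blast
  show ?thesis using M_geodesic_equations(1)[OF i] speed_M[OF i]
    by (simp add: has_real_derivative_iff_has_vector_derivative)
qed

lemma w_eq_0_iff: assumes "i \<in> idx F" "r \<in> TF i" shows "w i r = 0 \<longleftrightarrow> s = 0"
proof -
  interpret grw_chart "chart_image F i" "metric F i" I f by (rule chart[OF assms(1)])
  have "x i r \<in> chart_image F i" using assms by (auto simp: times_in_def)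
  then show ?thesis using s_speed[OF assms] g_pos[of "x i r" "w i r"] G.zero_left less_irrefl by metis
qed

text \<open>The chain rule and the geodesic equation yield two derivatives of the fiber velocity,
  which differ by a multiple of \<open>w\<close>. As \<open>s > 0\<close> means
  \<open>w \<noteq> 0\<close>, the coefficient vanishes.\<close>

lemma h2_eq:
  assumes "s > 0" and t: "t \<in> J"
  shows "h2 t = - 2 * warp_\<eta> f (\<tau> t) * \<tau>1 t * h1 t"
proof -
  obtain i where i: "i \<in> idx F" "t \<in> TM i" using ex_chart[OF t] by blast
  interpret grw_chart "chart_image F i" "metric F i" I f by (rule chart[OF i(1)])
  have r: "h t \<in> TF i" using i by (auto simp: TM_iff)
  note F = F_geodesic_chart_pointwise[OF fgeo i(1) r]
  have "((\<lambda>t. h1 t *\<^sub>R w i (h t)) has_vector_derivative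
      h1 t *\<^sub>R (h1 t *\<^sub>R - \<Gamma> (x i (h t)) (w i (h t)) (w i (h t))) + h2 t *\<^sub>R w i (h t)) (at t)"
    by (rule has_vector_derivative_scaleR[OF h_deriv(2)[OF t] h_comp[OF t F(3)]])
  from vector_derivative_unique_at[OF this M_geodesic_equations(2)[OF i]]
  have "(h2 t + 2 * warp_\<eta> f (\<tau> t) * \<tau>1 t * h1 t) *\<^sub>R w i (h t) = 0"
    by (simp add: C.scale_left C.scale_right F(1) algebra_simps)
  moreover have "w i (h t) \<noteq> 0" using w_eq_0_iff[OF i(1) r] \<open>s > 0\<close> by simp
  ultimately show ?thesis by simp
qed

lemma f_along:
  assumes "t \<in> J"
  shows "((\<lambda>t. f (\<tau> t)) has_field_derivative deriv f (\<tau> t) * \<tau>1 t) (at t)"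
    "((\<lambda>t. deriv f (\<tau> t)) has_field_derivative deriv (deriv f) (\<tau> t) * \<tau>1 t) (at t)"
    "f (\<tau> t) > 0"
proof -
  have d: "(f has_field_derivative deriv f (\<tau> t)) (at (\<tau> t))"
    "(deriv f has_field_derivative deriv (deriv f) (\<tau> t)) (at (\<tau> t))"
    using smooth_on_real_has_field_derivative[OF f_smooth] smooth_on_real_has_field_derivative[OF smooth_on_deriv[OF f_smooth open_I]]
      \<tau>_I[OF assms] by blast+
  show "((\<lambda>t. f (\<tau> t)) has_field_derivative deriv f (\<tau> t) * \<tau>1 t) (at t)"
    "((\<lambda>t. deriv f (\<tau> t)) has_field_derivative deriv (deriv f) (\<tau> t) * \<tau>1 t) (at t)"
    by (rule DERIV_chain2[OF d(1) \<tau>_deriv[OF assms]], rule DERIV_chain2[OF d(2) \<tau>_deriv[OF assms]])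
  show "f (\<tau> t) > 0" using f_pos \<tau>_I assms by blast
qed

text \<open>The analogue of Clairaut's relation: by \<open>h2_eq\<close>, the logarithmic
  derivatives of \<open>h1\<close> and \<open>f\<^sup>2\<close> are opposite.\<close>

lemma h1_eq:
  assumes "s > 0"
  obtains l where "l > 0" "\<And>t. t \<in> J \<Longrightarrow> h1 t = l / (f (\<tau> t))\<^sup>2"
proof -
  obtain t0 where t0: "t0 \<in> J" using J by blast
  have d: "((\<lambda>t. (f (\<tau> t))\<^sup>2 * h1 t) has_field_derivative 0) (at t)" if "t \<in> J" for t
    using f_along(3)[OF that]
    by (auto intro!: derivative_eq_intros f_along h_deriv that simp: h2_eq[OF assms that] warp_defs field_simps power2_eq_square)
  define l where "l = (f (\<tau> t0))\<^sup>2 * h1 t0"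
  have "(f (\<tau> t))\<^sup>2 * h1 t = l" if "t \<in> J" for t
    unfolding l_def by (rule has_real_derivative_zero_constant_on[OF J(2) d t0 that])
  then have "h1 t = l / (f (\<tau> t))\<^sup>2" if "t \<in> J" for t
    using that f_along(3)[OF that] by (simp add: field_simps)
  moreover have "l > 0" using h_pos[OF t0] f_along(3)[OF t0] by (simp add: l_def)
  ultimately show ?thesis using that by blast
qed

end

section \<open>Lifting and projecting Jacobi fields\<close>

lemma real_inverse_derivative:
  fixes h k :: "real \<Rightarrow> real"
  assumes "open J" and d: "\<And>t. t \<in> J \<Longrightarrow> (h has_field_derivative h1 t) (at t)"
    and k: "\<And>t. t \<in> J \<Longrightarrow> k (h t) = t" and t: "t \<in> J" "h1 t \<noteq> 0"
  shows "(k has_field_derivative 1 / h1 t) (at (h t))"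
proof -
  have "continuous_on J h"
    by (rule DERIV_continuous_on) (rule has_field_derivative_at_within[OF d])
  then have "(k has_derivative (\<lambda>y. 1 / h1 t * y)) (at (h t))"
    by (rule has_derivative_inverse_strong[OF \<open>open J\<close> t(1) _ k d[OF t(1), unfolded has_field_derivative_def]])
       (use t(2) in \<open>auto simp: fun_eq_iff\<close>)
  then show ?thesis unfolding has_field_derivative_def .
qed

lemma has_vector_derivative_comp_real:
  assumes "(k has_field_derivative k') (at r)" "(u has_vector_derivative u') (at (k r))"
  shows "((\<lambda>r. u (k r)) has_vector_derivative k' *\<^sub>R u') (at r)"
  using vector_diff_chain_at[OF assms(1)[unfolded has_real_derivative_iff_has_vector_derivative] assms(2)]
  by (simp add: comp_def)

context grw_geodesic
begin

text \<open>The time component is \<open>0\<close>, as the Jacobi fields to be compared turn out to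
  be tangent to the fibers; outside \<open>J\<close> the value \<open>0\<close> complies with the
  convention of \<open>field_along\<close>.\<close>

definition lift :: "('i \<Rightarrow> real \<Rightarrow> 'e) \<Rightarrow> 'i \<Rightarrow> real \<Rightarrow> real \<times> 'e" where
  "lift U i t = (if t \<in> J then (0, U i (h t)) else (0, 0))"

lemma h_mono:
  assumes "t \<in> J" "t' \<in> J" "t < t'" shows "h t < h t'"
proof -
  have "{t..t'} \<subseteq> J" using J assms connected_contains_Icc by blast
  then show ?thesis using h_deriv(1) h_pos
    by (intro DERIV_pos_imp_increasing[OF \<open>t < t'\<close>]) force
qed

lemma h_inj: "inj_on h J"
  by (rule inj_onI) (metis h_mono linorder_neqE_linordered_idom less_irrefl)

definition "k = inv_into J h"

lemma k_h: "t \<in> J \<Longrightarrow> k (h t) = t"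
  by (simp add: k_def h_inj)

lemma M_jacobi_chart:
  assumes i: "i \<in> idx F"
  shows "connection_chart.jacobi_on (christoffel M i) (\<lambda>t. coord M i (\<gamma> t)) (velocity M \<gamma> i) (\<lambda>t. 0)
      (\<lambda>t. (\<alpha> t, W t)) (\<lambda>t. (\<alpha>' t, W' t)) (TM i) \<longleftrightarrow>
    (\<forall>t\<in>TM i. (\<alpha> has_vector_derivative \<alpha>' t) (at t) \<and> (W has_vector_derivative W' t) (at t) \<and>
     (\<alpha>' has_vector_derivative - 2 * warp_\<psi> f (\<tau> t) * metric F i (x i (h t)) (h1 t *\<^sub>R w i (h t))
         (W' t + christoffel F i (x i (h t)) (h1 t *\<^sub>R w i (h t)) (W t))
        - warp_\<psi>' f (\<tau> t) * \<alpha> t * ((h1 t)\<^sup>2 * s)) (at t) \<and>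
     (W' has_vector_derivative - 2 *\<^sub>R christoffel F i (x i (h t)) (h1 t *\<^sub>R w i (h t)) (W' t)
       - frechet_derivative (\<lambda>y. christoffel F i y (h1 t *\<^sub>R w i (h t)) (h1 t *\<^sub>R w i (h t))) (at (x i (h t))) (W t)
       - (2 * warp_\<eta> f (\<tau> t) * \<tau>1 t) *\<^sub>R W' t
       - (2 * (warp_\<eta> f (\<tau> t) * \<alpha>' t + warp_\<eta>' f (\<tau> t) * \<tau>1 t * \<alpha> t)) *\<^sub>R (h1 t *\<^sub>R w i (h t))) (at t))"
proof -
  interpret grw_chart "chart_image F i" "metric F i" I f by (rule chart[OF i])
  have "W.jacobi_on (\<lambda>t. coord M i (\<gamma> t)) (velocity M \<gamma> i) (\<lambda>t. 0) (\<lambda>t. (\<alpha> t, W t)) (\<lambda>t. (\<alpha>' t, W' t)) (TM i) \<longleftrightarrow>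
    W.jacobi_on (\<lambda>t. (\<tau> t, x i (h t))) (\<lambda>t. (\<tau>1 t, h1 t *\<^sub>R w i (h t))) (\<lambda>t. 0) (\<lambda>t. (\<alpha> t, W t)) (\<lambda>t. (\<alpha>' t, W' t)) (TM i)"
    by (rule W.jacobi_on_cong) (auto simp: velocity_M(1)[OF i] TM_iff proj)
  moreover
  have S: "\<tau> t \<in> I \<and> x i (h t) \<in> chart_image F i" if "t \<in> TM i" for t
    using that \<tau>_I unfolding TM_iff by (auto simp: times_in_def)
  note * = W_jacobi_on_iff[where T = "TM i" and \<tau> = \<tau> and x = "\<lambda>t. x i (h t)", OF S]
  ultimately show ?thesis
    unfolding christoffel_eq grw_metric[OF i] *
    by (simp only: speed_M[OF i] cong: ball_cong)
qed

lemma M_patch_iff: "t \<in> J \<Longrightarrow> \<gamma> t \<in> patch M i \<longleftrightarrow> \<sigma> (h t) \<in> patch F i"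
  using \<tau>_I proj by (auto simp: mem_Times_iff)

lemma M_field_transition:
  assumes "field_along M \<gamma> J V" "i \<in> idx F" "j \<in> idx F" "t \<in> J" "\<sigma> (h t) \<in> patch F i \<inter> patch F j"
  shows "V j t = (fst (V i t), frechet_derivative (transition F i j) (at (coord F i (\<sigma> (h t)))) (snd (V i t)))"
proof -
  have "\<gamma> t \<in> patch M i \<inter> patch M j" using assms M_patch_iff by blast
  then have "V j t = frechet_derivative (transition M i j) (at (coord M i (\<gamma> t))) (V i t)"
    using assms(1-4) unfolding field_along_def grw_simps(1) by blast
  moreover have "coord M i (\<gamma> t) = (\<tau> t, coord F i (\<sigma> (h t)))" using proj assms by simp
  ultimately show ?thesis
    using grw_transition_derivative[OF assms(2,3,5) \<tau>_I[OF assms(4)]] by simp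
qed

text \<open>A vanishing time component is a solution as soon as \<open>vprod \<sigma> U\<close> has
  derivative \<open>0\<close>, since this derivative enters the time equation as a source. It is
  constant along \<open>\<sigma>\<close>, and the two zeros of the field force it to be
  \<open>0\<close>. The fiber equation is that along \<open>\<sigma>\<close> in the parameter
  \<open>t\<close>, where \<open>h2_eq\<close> produces the terms with
  \<open>warp_\<eta>\<close>.\<close>

lemma lift_jacobi:
  assumes s: "s > 0" and t: "t0 \<in> J" "t1 \<in> J" "t0 < t1"
    and U: "U \<in> jacobi_fields_vanishing_at F \<sigma> K (h t0) (h t1)"
  shows "lift U \<in> jacobi_fields_vanishing_at M \<gamma> J t0 t1"
proof -
  have jac: "jacobi_field F \<sigma> K U" and z: "\<And>i. U i (h t0) = 0" "\<And>i. U i (h t1) = 0"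
    using U by (auto simp: jacobi_fields_vanishing_at_def)
  have fa: "field_along F \<sigma> K U" using jac by (simp add: jacobi_field_def)
  then have tr: "transforms \<sigma> K U"
    and fz: "\<And>i r. \<not> (i \<in> idx F \<and> r \<in> K \<and> \<sigma> r \<in> patch F i) \<Longrightarrow> U i r = 0"
    unfolding field_along_def by blast+
  have jc: "\<exists>U'. connection_chart.jacobi_on (christoffel F i) (x i) (w i) (\<lambda>t. 0) (U i) U' (TF i)"
    if "i \<in> idx F" for i
    using jac that unfolding jacobi_field_iff[OF F_conn fgeo] by blast
  have vd: "(vprod \<sigma> U has_field_derivative deriv (vprod \<sigma> U) r) (at r)"
    "(deriv (vprod \<sigma> U) has_field_derivative 0) (at r)" if rK: "r \<in> K" for r
  proof -
    obtain i where i: "i \<in> idx F" "r \<in> TF i" using geodesic_ex_chart[OF fgeo rK] by blast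
    interpret grw_chart "chart_image F i" "metric F i" I f by (rule chart[OF i(1)])
    have S: "x i r \<in> chart_image F i" using i by (auto simp: times_in_def)
    obtain U' where U': "connection_chart.jacobi_on (christoffel F i) (x i) (w i) (\<lambda>t. 0) (U i) U' (TF i)"
      using jc[OF i(1)] by blast
    show "(vprod \<sigma> U has_field_derivative deriv (vprod \<sigma> U) r) (at r)"
     "(deriv (vprod \<sigma> U) has_field_derivative 0) (at r)"
      using vprod_jacobi(1,3)[OF fgeo tr i U'] by (simp_all add: G.zero_right S)
  qed
  define c where "c = deriv (vprod \<sigma> U) (h t0)"
  have c: "deriv (vprod \<sigma> U) r = c" if "r \<in> K" for r
    unfolding c_def by (rule has_real_derivative_zero_constant_on[OF K(2) vd(2) h_K[OF t(1)] that])
  have vz: "vprod \<sigma> U (h t) = 0" if "t = t0 \<or> t = t1" for t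
  proof -
    have tJ: "t \<in> J" using that t by auto
    obtain i where i: "i \<in> idx F" "h t \<in> TF i" using geodesic_ex_chart[OF fgeo h_K[OF tJ]] by blast
    interpret grw_chart "chart_image F i" "metric F i" I f by (rule chart[OF i(1)])
    have S: "x i (h t) \<in> chart_image F i" using i by (auto simp: times_in_def)
    show ?thesis using vprod_chart[OF fgeo i tr] that z G.zero_right[OF S, of "w i (h t)"] by auto
  qed
  have "c = 0"
    by (rule vanishing_twice(1)[OF K(2) h_K[OF t(1)] h_K[OF t(2)] h_mono[OF t], of "vprod \<sigma> U" c "\<lambda>_. 1"])
       (use vd(1) c vz in auto)
  have "field_along M \<gamma> J (lift U)" unfolding field_along_def
  proof (intro conjI allI impI ballI)
    fix i t assume "\<not> (i \<in> idx M \<and> t \<in> J \<and> \<gamma> t \<in> patch M i)"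
    then have "t \<notin> J \<or> U i (h t) = 0"
      using fz[of i "h t"] M_patch_iff[of t i] unfolding grw_simps(1) by blast
    then show "lift U i t = 0" by (auto simp: lift_def zero_prod_def)
  next
    fix i j t assume ij: "i \<in> idx M" "j \<in> idx M" and t: "t \<in> J" "\<gamma> t \<in> patch M i \<inter> patch M j"
    then have p: "\<sigma> (h t) \<in> patch F i \<inter> patch F j" using M_patch_iff by blast
    have "U j (h t) = frechet_derivative (transition F i j) (at (coord F i (\<sigma> (h t)))) (U i (h t))"
      using tr ij p h_K[OF t(1)] unfolding grw_simps(1) by blast
    moreover have "coord M i (\<gamma> t) = (\<tau> t, coord F i (\<sigma> (h t)))" using proj t by simp
    ultimately show "lift U j t = frechet_derivative (transition M i j) (at (coord M i (\<gamma> t))) (lift U i t)"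
      using grw_transition_derivative[OF _ _ p \<tau>_I[OF t(1)]] ij t by (simp add: lift_def)
  qed
  moreover have "\<exists>V'. connection_chart.jacobi_on (christoffel M i) (\<lambda>t. coord M i (\<gamma> t)) (velocity M \<gamma> i) (\<lambda>t. 0)
      (lift U i) V' (TM i)" if i: "i \<in> idx F" for i
  proof -
    interpret grw_chart "chart_image F i" "metric F i" I f by (rule chart[OF i])
    obtain U' where U': "jacobi_on (x i) (w i) (\<lambda>t. 0) (U i) U' (TF i)"
      using jc[OF i] unfolding christoffel_eq by blast
    have L: "lift U i = (\<lambda>t. (0, if t \<in> J then U i (h t) else 0))"
      by (auto simp: lift_def)
    have "connection_chart.jacobi_on (christoffel M i) (\<lambda>t. coord M i (\<gamma> t)) (velocity M \<gamma> i) (\<lambda>t. 0)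
      (lift U i) (\<lambda>t. (0, h1 t *\<^sub>R U' (h t))) (TM i)"
      unfolding L M_jacobi_chart[OF i]
    proof (intro ballI conjI)
      fix t assume "t \<in> TM i"
      then have t: "t \<in> J" "h t \<in> TF i" by (auto simp: TM_iff)
      then have S: "x i (h t) \<in> chart_image F i" by (auto simp: times_in_def)
      have U1: "(U i has_vector_derivative U' (h t)) (at (h t))"
        and U2: "(U' has_vector_derivative - 2 *\<^sub>R \<Gamma> (x i (h t)) (w i (h t)) (U' (h t)) - C.dB (x i (h t)) (U i (h t)) (w i (h t)) (w i (h t))) (at (h t))"
        using U' t unfolding jacobi_on_def by auto
      show "((\<lambda>t. 0::real) has_vector_derivative 0) (at t)" by simp
      show "((\<lambda>t. if t \<in> J then U i (h t) else 0) has_vector_derivative h1 t *\<^sub>R U' (h t)) (at t)"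
        by (rule has_vector_derivative_transform_within_open[OF h_comp[OF t(1) U1] J(1) t(1)]) simp
      have p: "metric F i (x i (h t)) (w i (h t)) (U' (h t) + \<Gamma> (x i (h t)) (w i (h t)) (U i (h t))) = 0"
        using vprod_jacobi(2)[OF fgeo tr i t(2), of "\<lambda>t. 0" U'] U' c[OF h_K[OF t(1)]] \<open>c = 0\<close>
        by (simp add: christoffel_eq)
      have "metric F i (x i (h t)) (h1 t *\<^sub>R w i (h t))
         (h1 t *\<^sub>R U' (h t) + christoffel F i (x i (h t)) (h1 t *\<^sub>R w i (h t)) (U i (h t))) = 0"
        using p unfolding christoffel_eq C.scale_left[OF S] scaleR_add_right[symmetric]
          G.scale_left[OF S] G.scale_right[OF S] by simp
      then show "((\<lambda>t. 0::real) has_vector_derivative - 2 * warp_\<psi> f (\<tau> t) * metric F i (x i (h t)) (h1 t *\<^sub>R w i (h t))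
         (h1 t *\<^sub>R U' (h t) + christoffel F i (x i (h t)) (h1 t *\<^sub>R w i (h t)) (if t \<in> J then U i (h t) else 0))
        - warp_\<psi>' f (\<tau> t) * 0 * ((h1 t)\<^sup>2 * s)) (at t)" using t by simp
      have "((\<lambda>t. h1 t *\<^sub>R U' (h t)) has_vector_derivative
          h1 t *\<^sub>R (h1 t *\<^sub>R (- 2 *\<^sub>R \<Gamma> (x i (h t)) (w i (h t)) (U' (h t)) - C.dB (x i (h t)) (U i (h t)) (w i (h t)) (w i (h t))))
          + h2 t *\<^sub>R U' (h t)) (at t)"
        by (rule has_vector_derivative_scaleR[OF h_deriv(2)[OF t(1)] h_comp[OF t(1) U2]])
      then show "((\<lambda>t. h1 t *\<^sub>R U' (h t)) has_vector_derivative
        - 2 *\<^sub>R christoffel F i (x i (h t)) (h1 t *\<^sub>R w i (h t)) (h1 t *\<^sub>R U' (h t))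
       - frechet_derivative (\<lambda>y. christoffel F i y (h1 t *\<^sub>R w i (h t)) (h1 t *\<^sub>R w i (h t))) (at (x i (h t))) (if t \<in> J then U i (h t) else 0)
       - (2 * warp_\<eta> f (\<tau> t) * \<tau>1 t) *\<^sub>R (h1 t *\<^sub>R U' (h t))
       - (2 * (warp_\<eta> f (\<tau> t) * 0 + warp_\<eta>' f (\<tau> t) * \<tau>1 t * 0)) *\<^sub>R (h1 t *\<^sub>R w i (h t))) (at t)"
        using t unfolding christoffel_eq dB_scale[OF S] C.scale_left[OF S] C.scale_right[OF S] h2_eq[OF s t(1)]
        by (elim has_vector_derivative_eq_rhs) (simp add: algebra_simps)
    qed
    then show ?thesis by blast
  qed
  ultimately have "jacobi_field M \<gamma> J (lift U)" unfolding jacobi_field_iff[OF M_conn geo] by simp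
  then show ?thesis using z by (auto simp: jacobi_fields_vanishing_at_def lift_def zero_prod_def)
qed

text \<open>In the parameter \<open>r = h t\<close>, the derivative of \<open>1 / h1\<close> cancels
  the friction term \<open>2 * warp_\<eta> f * \<tau>1\<close>, again by \<open>h2_eq\<close>. The
  terms with \<open>\<alpha>\<close> survive as a source, but this source is a multiple of the
  velocity \<open>w\<close>.\<close>

lemma projected_jacobi_chart:
  assumes s: "s > 0" and i: "i \<in> idx F" and hJ: "h ` J = K"
    and jac: "connection_chart.jacobi_on (christoffel M i) (\<lambda>t. coord M i (\<gamma> t)) (velocity M \<gamma> i) (\<lambda>t. 0)
      (\<lambda>t. (\<alpha> t, W t)) (\<lambda>t. (\<alpha>' t, W' t)) (TM i)"
  shows "connection_chart.jacobi_on (christoffel F i) (x i) (w i)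
     (\<lambda>r. (- 2 * (warp_\<eta> f (\<tau> (k r)) * \<alpha>' (k r) + warp_\<eta>' f (\<tau> (k r)) * \<tau>1 (k r) * \<alpha> (k r)) / h1 (k r)) *\<^sub>R w i r)
     (\<lambda>r. if r \<in> K then W (k r) else 0) (\<lambda>r. (1 / h1 (k r)) *\<^sub>R W' (k r)) (TF i)"
proof -
  interpret grw_chart "chart_image F i" "metric F i" I f by (rule chart[OF i])
  show ?thesis unfolding christoffel_eq jacobi_on_def
  proof (intro ballI conjI)
    fix r assume r: "r \<in> TF i"
    then have rK: "r \<in> K" and S: "x i r \<in> chart_image F i" by (auto simp: times_in_def)
    then obtain t where t: "t \<in> J" "r = h t" using hJ by blast
    have kr: "k r = t" using k_h t by simp
    have tT: "t \<in> TM i" using t r by (simp add: TM_iff)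
    have hp: "h1 t > 0" using h_pos t by simp
    have dk: "(k has_field_derivative 1 / h1 t) (at r)"
      unfolding t(2) by (rule real_inverse_derivative[OF J(1) h_deriv(1) k_h t(1)]) (use hp in auto)
    have W1: "(W has_vector_derivative W' t) (at t)"
      and W2: "(W' has_vector_derivative - 2 *\<^sub>R \<Gamma> (x i r) (h1 t *\<^sub>R w i r) (W' t)
       - C.dB (x i r) (W t) (h1 t *\<^sub>R w i r) (h1 t *\<^sub>R w i r)
       - (2 * warp_\<eta> f (\<tau> t) * \<tau>1 t) *\<^sub>R W' t
       - (2 * (warp_\<eta> f (\<tau> t) * \<alpha>' t + warp_\<eta>' f (\<tau> t) * \<tau>1 t * \<alpha> t)) *\<^sub>R (h1 t *\<^sub>R w i r)) (at t)"
      using jac[unfolded M_jacobi_chart[OF i], unfolded christoffel_eq] tT t(2) by auto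
    have "((\<lambda>r. W (k r)) has_vector_derivative (1 / h1 t) *\<^sub>R W' t) (at r)"
      by (rule has_vector_derivative_comp_real[OF dk]) (simp add: kr W1)
    then show "((\<lambda>r. if r \<in> K then W (k r) else 0) has_vector_derivative (1 / h1 (k r)) *\<^sub>R W' (k r)) (at r)"
      unfolding kr by (rule has_vector_derivative_transform_within_open[OF _ K(1) rK]) simp
    have dW: "((\<lambda>r. W' (k r)) has_vector_derivative (1 / h1 t) *\<^sub>R (- 2 *\<^sub>R \<Gamma> (x i r) (h1 t *\<^sub>R w i r) (W' t)
       - C.dB (x i r) (W t) (h1 t *\<^sub>R w i r) (h1 t *\<^sub>R w i r)
       - (2 * warp_\<eta> f (\<tau> t) * \<tau>1 t) *\<^sub>R W' t
       - (2 * (warp_\<eta> f (\<tau> t) * \<alpha>' t + warp_\<eta>' f (\<tau> t) * \<tau>1 t * \<alpha> t)) *\<^sub>R (h1 t *\<^sub>R w i r))) (at r)"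
      by (rule has_vector_derivative_comp_real[OF dk]) (unfold kr, rule W2)
    have dh: "((\<lambda>r. 1 / h1 (k r)) has_field_derivative - (h2 t * (1 / h1 t)) / (h1 t * h1 t)) (at r)"
    proof -
      have "((\<lambda>r. h1 (k r)) has_field_derivative h2 t * (1 / h1 t)) (at r)"
        by (rule DERIV_chain2[OF _ dk]) (unfold kr, rule h_deriv(2)[OF t(1)])
      then show ?thesis using hp by (auto intro!: derivative_eq_intros simp: kr)
    qed
    have e: "(1 / h1 (k r)) *\<^sub>R ((1 / h1 t) *\<^sub>R (- 2 *\<^sub>R \<Gamma> (x i r) (h1 t *\<^sub>R w i r) (W' t)
       - C.dB (x i r) (W t) (h1 t *\<^sub>R w i r) (h1 t *\<^sub>R w i r)
       - (2 * warp_\<eta> f (\<tau> t) * \<tau>1 t) *\<^sub>R W' t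
       - (2 * (warp_\<eta> f (\<tau> t) * \<alpha>' t + warp_\<eta>' f (\<tau> t) * \<tau>1 t * \<alpha> t)) *\<^sub>R (h1 t *\<^sub>R w i r)))
       + (- (h2 t * (1 / h1 t)) / (h1 t * h1 t)) *\<^sub>R W' (k r) =
      (- 2 * (warp_\<eta> f (\<tau> (k r)) * \<alpha>' (k r) + warp_\<eta>' f (\<tau> (k r)) * \<tau>1 (k r) * \<alpha> (k r)) / h1 (k r)) *\<^sub>R w i r
       - 2 *\<^sub>R \<Gamma> (x i r) (w i r) ((1 / h1 (k r)) *\<^sub>R W' (k r))
       - C.dB (x i r) (if r \<in> K then W (k r) else 0) (w i r) (w i r)"
      unfolding kr dB_scale[OF S] C.scale_left[OF S] C.scale_right[OF S] h2_eq[OF s t(1)]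
      using hp rK by (simp add: algebra_simps add_divide_distrib diff_divide_distrib)
    show "((\<lambda>r. (1 / h1 (k r)) *\<^sub>R W' (k r)) has_vector_derivative
       (- 2 * (warp_\<eta> f (\<tau> (k r)) * \<alpha>' (k r) + warp_\<eta>' f (\<tau> (k r)) * \<tau>1 (k r) * \<alpha> (k r)) / h1 (k r)) *\<^sub>R w i r
       - 2 *\<^sub>R \<Gamma> (x i r) (w i r) ((1 / h1 (k r)) *\<^sub>R W' (k r))
       - C.dB (x i r) (if r \<in> K then W (k r) else 0) (w i r) (w i r)) (at r)"
      using has_vector_derivative_scaleR[OF dh dW] unfolding e .
  qed
qed

text \<open>Once \<open>grw_jacobi_scalar\<close> has shown that the time component vanishes, the
  source in \<open>projected_jacobi_chart\<close> disappears and the fiber component is a Jacobi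
  field of the fiber.\<close>

lemma project_jacobi:
  assumes s: "s > 0" and \<tau>1: "\<And>t. t \<in> J \<Longrightarrow> \<tau>1 t \<noteq> 0" and hJ: "h ` J = K"
    and t: "t0 \<in> J" "t1 \<in> J" "t0 < t1"
    and V: "V \<in> jacobi_fields_vanishing_at M \<gamma> J t0 t1"
  shows "\<exists>U\<in>jacobi_fields_vanishing_at F \<sigma> K (h t0) (h t1). V = lift U"
proof -
  have jac: "jacobi_field M \<gamma> J V" and z: "\<And>i. V i t0 = 0" "\<And>i. V i t1 = 0"
    using V by (auto simp: jacobi_fields_vanishing_at_def)
  have fa: "field_along M \<gamma> J V" using jac by (simp add: jacobi_field_def)
  then have fz: "\<And>i t. \<not> (i \<in> idx F \<and> t \<in> J \<and> \<gamma> t \<in> patch M i) \<Longrightarrow> V i t = 0"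
    unfolding field_along_def grw_simps(1) by blast
  have "\<exists>V'. \<forall>i\<in>idx F. connection_chart.jacobi_on (christoffel M i) (\<lambda>t. coord M i (\<gamma> t)) (velocity M \<gamma> i) (\<lambda>t. 0) (V i) (V' i) (TM i)"
    using jac unfolding jacobi_field_iff[OF M_conn geo] grw_simps(1) by metis
  then obtain V' where V': "\<And>i. i \<in> idx F \<Longrightarrow> connection_chart.jacobi_on (christoffel M i) (\<lambda>t. coord M i (\<gamma> t)) (velocity M \<gamma> i) (\<lambda>t. 0)
     (\<lambda>t. (fst (V i t), snd (V i t))) (\<lambda>t. (fst (V' i t), snd (V' i t))) (TM i)" by auto
  \<comment> \<open>All charts give the same time component, so that any of them may be chosen to
    obtain a single function on \<open>J\<close>.\<close>
  define \<alpha> where "\<alpha> t = fst (V (SOME i. i \<in> idx F \<and> t \<in> TM i) t)" for t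
  have \<alpha>_eq: "\<alpha> t = fst (V i t)" if i: "i \<in> idx F" "t \<in> TM i" for i t
  proof -
    have j: "(SOME i. i \<in> idx F \<and> t \<in> TM i) \<in> idx F \<and> t \<in> TM (SOME i. i \<in> idx F \<and> t \<in> TM i)"
      by (rule someI[where x = i]) (use i in auto)
    then have "\<sigma> (h t) \<in> patch F i \<inter> patch F (SOME i. i \<in> idx F \<and> t \<in> TM i)" "t \<in> J"
      using i(2) unfolding TM_iff by (auto simp: times_in_def)
    then show ?thesis unfolding \<alpha>_def
      using M_field_transition[OF fa i(1), of "SOME i. i \<in> idx F \<and> t \<in> TM i" t] j by simp
  qed
  define \<alpha>1 where "\<alpha>1 = deriv \<alpha>"
  have \<alpha>_d: "(\<alpha> has_vector_derivative fst (V' i t)) (at t)" if i: "i \<in> idx F" "t \<in> TM i" for i t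
  proof -
    have "((\<lambda>t. fst (V i t)) has_vector_derivative fst (V' i t)) (at t)"
      using V'[OF i(1), unfolded M_jacobi_chart[OF i(1)]] i(2) by blast
    then show ?thesis
      by (rule has_vector_derivative_transform_within_open[OF _ TM_open[OF i(1)] i(2)]) (simp add: \<alpha>_eq[OF i(1)])
  qed
  have \<alpha>1_eq: "\<alpha>1 t = fst (V' i t)" if "i \<in> idx F" "t \<in> TM i" for i t
    unfolding \<alpha>1_def using \<alpha>_d[OF that]
    by (intro DERIV_imp_deriv) (simp add: has_real_derivative_iff_has_vector_derivative)
  define m1 where "m1 t = warp_\<eta>' f (\<tau> t) * \<tau>1 t * \<alpha> t + warp_\<eta> f (\<tau> t) * \<alpha>1 t" for t
  \<comment> \<open>By \<open>hJ\<close>, the inverse \<open>k\<close> of \<open>h\<close> is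
    available on all of \<open>K\<close>; outside, \<open>0\<close> complies with
    \<open>field_along\<close>.\<close>
  define U where "U i r = (if r \<in> K then snd (V i (k r)) else 0)" for i r
  define U' where "U' i r = (1 / h1 (k r)) *\<^sub>R snd (V' i (k r))" for i r
  have kJ: "k r \<in> J" "h (k r) = r" if "r \<in> K" for r
    using that hJ k_h by auto
  have Ujac: "connection_chart.jacobi_on (christoffel F i) (x i) (w i)
     (\<lambda>r. (- 2 * m1 (k r) / h1 (k r)) *\<^sub>R w i r) (U i) (U' i) (TF i)" if i: "i \<in> idx F" for i
  proof -
    interpret grw_chart "chart_image F i" "metric F i" I f by (rule chart[OF i])
    have "\<alpha> (k r) = fst (V i (k r))" "\<alpha>1 (k r) = fst (V' i (k r))" if "r \<in> TF i" for r
    proof -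
      have "r \<in> K" using that by (simp add: times_in_def)
      then have "k r \<in> TM i" using that kJ by (simp add: TM_iff)
      then show "\<alpha> (k r) = fst (V i (k r))" "\<alpha>1 (k r) = fst (V' i (k r))" using \<alpha>_eq \<alpha>1_eq i by auto
    qed
    then have "jacobi_on (x i) (w i) (\<lambda>r. (- 2 * m1 (k r) / h1 (k r)) *\<^sub>R w i r)
        (\<lambda>r. if r \<in> K then snd (V i (k r)) else 0) (\<lambda>r. (1 / h1 (k r)) *\<^sub>R snd (V' i (k r))) (TF i)"
      using projected_jacobi_chart[OF s i hJ V'[OF i]] unfolding christoffel_eq
      by (subst jacobi_on_cong) (auto simp: m1_def add.commute)
    then show ?thesis unfolding christoffel_eq U_def[abs_def] U'_def[abs_def] .
  qed
  have Utr: "transforms \<sigma> K U"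
  proof (intro ballI impI)
    fix i j r assume ij: "i \<in> idx F" "j \<in> idx F" and r: "r \<in> K" and p: "\<sigma> r \<in> patch F i \<inter> patch F j"
    show "U j r = frechet_derivative (transition F i j) (at (coord F i (\<sigma> r))) (U i r)"
      using M_field_transition[OF fa ij kJ(1)[OF r]] p r kJ by (simp add: U_def)
  qed
  have Uz: "U i (h t0) = 0" "U i (h t1) = 0" for i
    using z k_h t by (simp_all add: U_def)
  \<comment> \<open>The unknowns of \<open>grw_jacobi_scalar\<close>: functions of the fiber
    parameter, read at \<open>h t\<close>.\<close>
  define v where "v t = vprod \<sigma> U (h t)" for t
  define p where "p t = deriv (vprod \<sigma> U) (h t)" for t
  obtain l where l: "l > 0" "\<And>t. t \<in> J \<Longrightarrow> h1 t = l / (f (\<tau> t))\<^sup>2" using h1_eq[OF s] by blast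
  have \<alpha>0: "\<alpha> t = 0" if "t \<in> J" for t
  proof (rule grw_jacobi_scalar[OF J(2) t, of "\<lambda>t. f (\<tau> t)" "\<lambda>t. deriv f (\<tau> t)" \<tau>1 "\<lambda>t. deriv (deriv f) (\<tau> t)"
        h1 s l \<alpha> \<alpha>1 p v m1 "\<lambda>t. warp_\<eta> f (\<tau> t) * \<alpha> t"])
    show "0 < l" by (rule l(1))
  next
    fix t assume tJ: "t \<in> J"
    obtain i where i: "i \<in> idx F" "t \<in> TM i" using ex_chart[OF tJ] by blast
    interpret grw_chart "chart_image F i" "metric F i" I f by (rule chart[OF i(1)])
    have r: "h t \<in> TF i" using i by (simp add: TM_iff)
    then have S: "x i (h t) \<in> chart_image F i" by (auto simp: times_in_def)
    note vj = vprod_jacobi[OF fgeo Utr i(1) r Ujac[OF i(1)]]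
    show "0 < f (\<tau> t)" "((\<lambda>t. f (\<tau> t)) has_field_derivative deriv f (\<tau> t) * \<tau>1 t) (at t)"
      "((\<lambda>t. deriv f (\<tau> t)) has_field_derivative deriv (deriv f) (\<tau> t) * \<tau>1 t) (at t)"
      using f_along[OF tJ] by auto
    show "\<tau>1 t \<noteq> 0" by (rule \<tau>1[OF tJ])
    show "h1 t = l / (f (\<tau> t))\<^sup>2" by (rule l(2)[OF tJ])
    show "(\<tau>1 has_field_derivative - (f (\<tau> t) * deriv f (\<tau> t) * ((h1 t)\<^sup>2 * s))) (at t)"
      using \<tau>1_deriv[OF tJ] by (simp add: warp_defs)
    show "(\<alpha> has_field_derivative \<alpha>1 t) (at t)"
      using \<alpha>_d[OF i] \<alpha>1_eq[OF i] by (simp add: has_real_derivative_iff_has_vector_derivative)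
    have "(\<alpha>1 has_vector_derivative - 2 * warp_\<psi> f (\<tau> t) * metric F i (x i (h t)) (h1 t *\<^sub>R w i (h t))
         (snd (V' i t) + christoffel F i (x i (h t)) (h1 t *\<^sub>R w i (h t)) (snd (V i t)))
        - warp_\<psi>' f (\<tau> t) * fst (V i t) * ((h1 t)\<^sup>2 * s)) (at t)"
      by (rule has_vector_derivative_transform_within_open[OF _ TM_open[OF i(1)] i(2), of "\<lambda>t. fst (V' i t)"])
         (use V'[OF i(1), unfolded M_jacobi_chart[OF i(1)]] i \<alpha>1_eq in auto)
    moreover have "metric F i (x i (h t)) (h1 t *\<^sub>R w i (h t))
         (snd (V' i t) + christoffel F i (x i (h t)) (h1 t *\<^sub>R w i (h t)) (snd (V i t))) = (h1 t)\<^sup>2 * p t"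
    proof -
      have "snd (V' i t) = h1 t *\<^sub>R U' i (h t)" "snd (V i t) = U i (h t)"
        using h_pos[OF tJ] k_h[OF tJ] h_K[OF tJ] by (simp_all add: U'_def U_def)
      then show ?thesis
        unfolding p_def vj(2) christoffel_eq
        by (simp add: C.scale_left[OF S] scaleR_add_right[symmetric] G.scale_left[OF S] G.scale_right[OF S] power2_eq_square
           del: scaleR_add_right)
    qed
    ultimately show "(\<alpha>1 has_field_derivative - 2 * (f (\<tau> t) * deriv f (\<tau> t)) * ((h1 t)\<^sup>2 * p t)
        - ((deriv f (\<tau> t))\<^sup>2 + f (\<tau> t) * deriv (deriv f) (\<tau> t)) * \<alpha> t * ((h1 t)\<^sup>2 * s)) (at t)"
      using \<alpha>_eq[OF i] by (simp add: has_real_derivative_iff_has_vector_derivative warp_defs)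
    show "(v has_field_derivative h1 t * p t) (at t)"
      unfolding v_def[abs_def] p_def using DERIV_chain2[OF vj(1) h_deriv(1)[OF tJ]] by (simp add: mult.commute)
    have "metric F i (x i (h t)) (w i (h t)) ((- 2 * m1 (k (h t)) / h1 (k (h t))) *\<^sub>R w i (h t)) = - 2 * m1 t / h1 t * s"
      using s_speed[OF i(1) r] k_h[OF tJ] by (simp add: G.scale_right[OF S] G.neg_right[OF S])
    from DERIV_chain2[OF vj(3)[unfolded this] h_deriv(1)[OF tJ]]
    show "(p has_field_derivative - 2 * s * m1 t) (at t)"
      unfolding p_def[abs_def] using h_pos[OF tJ] by (simp add: mult.commute mult.left_commute)
  next
    have vz: "v t = 0 \<and> \<alpha> t = 0" if "t = t0 \<or> t = t1" for t
    proof -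
      have tJ: "t \<in> J" using that t by auto
      obtain i where i: "i \<in> idx F" "t \<in> TM i" using ex_chart[OF tJ] by blast
      interpret grw_chart "chart_image F i" "metric F i" I f by (rule chart[OF i(1)])
      have r: "h t \<in> TF i" using i by (simp add: TM_iff)
      then have S: "x i (h t) \<in> chart_image F i" by (auto simp: times_in_def)
      show ?thesis unfolding v_def
        using vprod_chart[OF fgeo i(1) r Utr] that z Uz G.zero_right[OF S, of "w i (h t)"] \<alpha>_eq[OF i] by auto
    qed
    show "\<alpha> t0 = 0" "\<alpha> t1 = 0" "v t0 = 0" "v t1 = 0" using vz by auto
  qed (use that in \<open>auto simp: warp_defs m1_def\<close>)
  have \<alpha>10: "\<alpha>1 t = 0" if "t \<in> J" for t
  proof -
    have "(\<alpha> has_field_derivative 0) (at t)"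
      by (rule has_field_derivative_transform_within_open[OF DERIV_const J(1) that]) (simp add: \<alpha>0)
    then show ?thesis unfolding \<alpha>1_def by (rule DERIV_imp_deriv)
  qed
  have "field_along F \<sigma> K U" unfolding field_along_def
  proof (rule conjI[OF _ Utr], intro allI impI)
    fix i r assume n: "\<not> (i \<in> idx F \<and> r \<in> K \<and> \<sigma> r \<in> patch F i)"
    show "U i r = 0"
    proof (cases "r \<in> K")
      case True
      then have "\<not> (i \<in> idx F \<and> k r \<in> J \<and> \<gamma> (k r) \<in> patch M i)"
        using n M_patch_iff[OF kJ(1)[OF True], of i] kJ(2)[OF True] by simp
      then show ?thesis using fz by (simp add: U_def)
    qed (simp add: U_def)
  qed
  moreover have "\<exists>U'. connection_chart.jacobi_on (christoffel F i) (x i) (w i) (\<lambda>t. 0) (U i) U' (TF i)" if i: "i \<in> idx F" for i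
  proof -
    interpret grw_chart "chart_image F i" "metric F i" I f by (rule chart[OF i])
    have "(- 2 * m1 (k r) / h1 (k r)) *\<^sub>R w i r = 0" if "r \<in> TF i" for r
    proof -
      have "k r \<in> J" using that kJ by (simp add: times_in_def)
      then show ?thesis using \<alpha>0 \<alpha>10 by (simp add: m1_def)
    qed
    then have "jacobi_on (x i) (w i) (\<lambda>t. 0) (U i) (U' i) (TF i)"
      using Ujac[OF i] unfolding christoffel_eq by (subst jacobi_on_cong) auto
    then show ?thesis unfolding christoffel_eq by blast
  qed
  ultimately have "jacobi_field F \<sigma> K U" unfolding jacobi_field_iff[OF F_conn fgeo] by simp
  then have "U \<in> jacobi_fields_vanishing_at F \<sigma> K (h t0) (h t1)"
    using Uz by (auto simp: jacobi_fields_vanishing_at_def)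
  moreover have "V = lift U"
  proof (intro ext)
    fix i t
    show "V i t = lift U i t"
    proof (cases "i \<in> idx F \<and> t \<in> J \<and> \<gamma> t \<in> patch M i")
      case True
      then have "t \<in> TM i" by (simp add: times_in_def)
      then show ?thesis using \<alpha>_eq[of i t] \<alpha>0[of t] True k_h h_K by (simp add: lift_def U_def prod_eq_iff)
    next
      case False
      then have "V i t = 0" using fz by simp
      then show ?thesis using k_h h_K by (simp add: lift_def U_def zero_prod_def)
    qed
  qed
  ultimately show ?thesis by blast
qed

section \<open>Conjugate parameters and their multiplicities\<close>

lemma jacobi_fields_eq:
  assumes "s > 0" "\<And>t. t \<in> J \<Longrightarrow> \<tau>1 t \<noteq> 0" "h ` J = K" "t0 \<in> J" "t1 \<in> J" "t0 < t1"
  shows "jacobi_fields_vanishing_at M \<gamma> J t0 t1 = lift ` jacobi_fields_vanishing_at F \<sigma> K (h t0) (h t1)"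
  using lift_jacobi[OF assms(1,4,5,6)] project_jacobi[OF assms] by blast

lemma jacobi_field_outside:
  assumes "U \<in> jacobi_fields_vanishing_at F \<sigma> K r0 r1" "r \<notin> K"
  shows "U i r = 0"
  using assms unfolding jacobi_fields_vanishing_at_def jacobi_field_def field_along_def by blast

text \<open>\<open>lift\<close> reads \<open>U\<close> on the image of \<open>h\<close> only. Since
  this image is \<open>K\<close>, a field that vanishes off \<open>K\<close> is determined by its
  lift.\<close>

lemma lift_eq_0_iff:
  assumes hJ: "h ` J = K" and U: "\<And>i r. r \<notin> K \<Longrightarrow> U i r = 0"
  shows "lift U = 0 \<longleftrightarrow> U = 0"
proof
  assume L: "lift U = 0"
  have "U i r = 0" for i r
  proof (cases "r \<in> K")
    case True
    then obtain t where "t \<in> J" "r = h t" using hJ by blast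
    then show ?thesis using fun_cong[OF fun_cong[OF L], of i t] by (simp add: lift_def zero_prod_def)
  qed (rule U)
  then show "U = 0" by (simp add: fun_eq_iff)
qed (simp add: lift_def fun_eq_iff zero_prod_def)

lemma conjugate_params_iff:
  assumes "s > 0" "\<And>t. t \<in> J \<Longrightarrow> \<tau>1 t \<noteq> 0" and hJ: "h ` J = K" and t: "t0 \<in> J" "t1 \<in> J" "t0 < t1"
  shows "t1 \<in> conjugate_params M \<gamma> J t0 \<longleftrightarrow> h t1 \<in> conjugate_params F \<sigma> K (h t0)"
proof -
  have "lift U = 0 \<longleftrightarrow> U = 0" if "U \<in> jacobi_fields_vanishing_at F \<sigma> K (h t0) (h t1)" for U
    by (rule lift_eq_0_iff[OF hJ jacobi_field_outside[OF that]])
  then show ?thesis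
    using t h_K[OF t(2)] h_mono[OF t] by (simp add: conjugate_params_def jacobi_fields_eq[OF assms])
qed

text \<open>The dimension refers to the space of all families of functions, on which
  \<open>lift\<close> ignores what happens outside \<open>K\<close>. Injectivity is therefore shown
  on the subspace of the families that vanish there; it contains the span, so that a basis is
  carried to a basis.\<close>

lemma conjugate_multiplicity_eq:
  assumes "s > 0" "\<And>t. t \<in> J \<Longrightarrow> \<tau>1 t \<noteq> 0" and hJ: "h ` J = K" and t: "t0 \<in> J" "t1 \<in> J" "t0 < t1"
  shows "conjugate_multiplicity F \<sigma> K (h t0) (h t1) = conjugate_multiplicity M \<gamma> J t0 t1"
proof -
  interpret A: vector_space "scale_field :: real \<Rightarrow> ('i \<Rightarrow> real \<Rightarrow> 'e) \<Rightarrow> _" by (rule vector_space_scale_field)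
  interpret B: vector_space "scale_field :: real \<Rightarrow> ('i \<Rightarrow> real \<Rightarrow> real \<times> 'e) \<Rightarrow> _" by (rule vector_space_scale_field)
  interpret AB: vector_space_pair "scale_field :: real \<Rightarrow> ('i \<Rightarrow> real \<Rightarrow> 'e) \<Rightarrow> _"
    "scale_field :: real \<Rightarrow> ('i \<Rightarrow> real \<Rightarrow> real \<times> 'e) \<Rightarrow> _" by unfold_locales
  let ?U = "jacobi_fields_vanishing_at F \<sigma> K (h t0) (h t1)"
  have lin: "Vector_Spaces.linear scale_field scale_field lift"
    by unfold_locales (auto simp: lift_def scale_field_def fun_eq_iff)
  have sub: "A.subspace {U. \<forall>i r. r \<notin> K \<longrightarrow> U i r = 0}"
    by (rule A.subspaceI) (auto simp: scale_field_def)
  have "A.span ?U \<subseteq> {U. \<forall>i r. r \<notin> K \<longrightarrow> U i r = 0}"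
    by (rule A.span_minimal[OF _ sub]) (use jacobi_field_outside in blast)
  moreover have "inj_on lift {U. \<forall>i r. r \<notin> K \<longrightarrow> U i r = 0}"
    unfolding AB.linear_inj_on_iff_eq_0[OF lin sub]
    using lift_eq_0_iff[OF hJ] by blast
  ultimately have inj: "inj_on lift (A.span ?U)" by (rule inj_on_subset[rotated])
  obtain b where b: "b \<subseteq> ?U" "A.independent b" "?U \<subseteq> A.span b" "card b = A.dim ?U"
    using A.basis_exists by blast
  have ind: "B.independent (lift ` b)"
    by (rule AB.linear_independent_injective_image[OF lin b(2) inj_on_subset[OF inj A.span_mono[OF b(1)]]])
  have sp: "lift ` ?U \<subseteq> B.span (lift ` b)"
    using b(3) AB.linear_span_image[OF lin, of b] by blast
  show ?thesis
    unfolding conjugate_multiplicity_def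
    using card_image[OF inj_on_subset[OF inj order_trans[OF b(1) A.span_superset]]] b(4)
      B.basis_card_eq_dim[OF image_mono[OF b(1)] sp ind] by (simp add: jacobi_fields_eq[OF assms])
qed

section \<open>The case of a constant fiber component\<close>

lemma \<sigma>_constant:
  assumes "s = 0" "r0 \<in> K" "r \<in> K" shows "\<sigma> r = \<sigma> r0"
proof -
  \<comment> \<open>In a chart the coordinates have derivative \<open>0\<close>, and the chart is
    injective; so the level sets are open, and the domain is connected.\<close>
  have "open {r \<in> K. \<sigma> r = \<sigma> r0}"
  proof (subst open_subopen, intro ballI)
    fix r assume r: "r \<in> {r \<in> K. \<sigma> r = \<sigma> r0}"
    then obtain i where i: "i \<in> idx F" "r \<in> TF i" using geodesic_ex_chart[OF fgeo] by blast
    obtain e where e: "e > 0" "ball r e \<subseteq> TF i" using F_times_open[OF fgeo i(1)] i(2) open_contains_ball by blast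
    have "\<sigma> r' = \<sigma> r" if r': "r' \<in> ball r e" for r'
    proof -
      have "(x i has_vector_derivative 0) (at r' within ball r e)" if "r' \<in> ball r e" for r'
      proof -
        have rT: "r' \<in> TF i" using that e by blast
        have "w i r' = 0" using w_eq_0_iff[OF i(1) rT] \<open>s = 0\<close> by simp
        then show ?thesis
          using has_vector_derivative_at_within[OF F_geodesic_chart_pointwise(2)[OF fgeo i(1) rT]] by simp
      qed
      then obtain c where "\<And>r'. r' \<in> ball r e \<Longrightarrow> x i r' = c"
        using has_vector_derivative_zero_constant[OF convex_ball[of r e], of "x i"] by blast
      then have "x i r' = x i r" using r' \<open>e > 0\<close> by simp
      moreover have "\<sigma> r' \<in> patch F i" "\<sigma> r \<in> patch F i" using e r' i by (auto simp: times_in_def)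
      ultimately show ?thesis using atlas_inj[OF atlas i(1)] by (meson inj_onD)
    qed
    note eq = this
    have sub: "ball r e \<subseteq> K" using e(2) unfolding times_in_def by blast
    have "ball r e \<subseteq> {r \<in> K. \<sigma> r = \<sigma> r0}"
    proof
      fix r' assume r': "r' \<in> ball r e"
      have "\<sigma> r = \<sigma> r0" using r by blast
      with eq[OF r'] have "\<sigma> r' = \<sigma> r0" by (rule trans)
      then show "r' \<in> {r \<in> K. \<sigma> r = \<sigma> r0}" using sub r' by blast
    qed
    then show "\<exists>T. open T \<and> r \<in> T \<and> T \<subseteq> {r \<in> K. \<sigma> r = \<sigma> r0}"
      using e by (intro exI[of _ "ball r e"]) auto
  qed
  moreover have "continuous_on K \<sigma>" using fgeo by (simp add: geodesic_def)
  ultimately show ?thesis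
    using continuous_levelset_open[OF K(2), of \<sigma> "\<sigma> r0"] assms by blast
qed

text \<open>A constant curve never leaves a chart around its point, and there the Jacobi equation
  reads \<open>V'' = 0\<close>, because the velocity vanishes.\<close>

lemma no_conjugate_params_fiber:
  assumes "s = 0" and r0: "r0 \<in> K" shows "conjugate_params F \<sigma> K r0 = {}"
proof -
  have "V = 0" if r1: "r1 \<in> K" "r0 < r1" and V: "V \<in> jacobi_fields_vanishing_at F \<sigma> K r0 r1" for r1 V
  proof (intro ext)
    fix i r
    have jac: "jacobi_field F \<sigma> K V" and z: "V i r0 = 0" "V i r1 = 0"
      using V by (auto simp: jacobi_fields_vanishing_at_def)
    show "V i r = 0 i r"
    proof (cases "i \<in> idx F \<and> r \<in> K \<and> \<sigma> r \<in> patch F i")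
      case True
      then have i: "i \<in> idx F" and rK: "r \<in> K" by auto
      have "\<sigma> r' \<in> patch F i" if "r' \<in> K" for r'
        using \<sigma>_constant[OF assms(1) rK that] True by simp
      then have TF: "TF i = K" unfolding times_in_def by blast
      interpret grw_chart "chart_image F i" "metric F i" I f by (rule chart[OF i])
      obtain V' where V': "jacobi_on (x i) (w i) (\<lambda>t. 0) (V i) V' (TF i)"
        using jac i unfolding jacobi_field_iff[OF F_conn fgeo] christoffel_eq by blast
      have d: "(V i has_vector_derivative V' r) (at r)" "(V' has_vector_derivative 0) (at r)" if "r \<in> K" for r
      proof -
        have S: "x i r \<in> chart_image F i" using that TF by (auto simp: times_in_def)
        have w: "w i r = 0" using w_eq_0_iff[OF i] that TF assms by simp
        have dB0: "C.dB (x i r) u 0 0 = 0" for u using dB_scale[OF S, where c = 0 and v = 0 and w = 0] by simp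
        show "(V i has_vector_derivative V' r) (at r)" "(V' has_vector_derivative 0) (at r)"
          using V' that TF unfolding jacobi_on_def by (auto simp: w dB0 C.zero_left[OF S])
      qed
      have "V i r = 0"
        by (rule vanishing_twice_vector[OF K(2) r0 r1 d(1) _ _ z rK, of "\<lambda>_. 1"]) (use d(2) in auto)
      then show ?thesis by simp
    next
      case False
      then show ?thesis using jac unfolding jacobi_field_def field_along_def by simp
    qed
  qed
  then show ?thesis unfolding conjugate_params_def by blast
qed

end

lemma open_interval_antiderivative:
  fixes q :: "real \<Rightarrow> real"
  assumes I: "open I" "connected I" and q: "continuous_on I q"
  shows "\<exists>Q. \<forall>y\<in>I. (Q has_field_derivative q y) (at y)"
proof (cases "I = {}")
  case False
  then obtain y0 where y0: "y0 \<in> I" by blast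
  have nb: "\<exists>c d. c < y \<and> y < d \<and> c \<in> I \<and> d \<in> I" if y: "y \<in> I" for y
  proof -
    obtain e where e: "e > 0" "cball y e \<subseteq> I" using I(1) y open_contains_cball by blast
    then have "y - e \<in> I" "y + e \<in> I" by (auto simp: dist_real_def subset_iff)
    then show ?thesis using e by (intro exI[of _ "y - e"] exI[of _ "y + e"]) auto
  qed
  have "((\<lambda>u. LBINT y=y0..u. q y) has_field_derivative q y) (at y)" if y: "y \<in> I" for y
  proof -
    obtain c1 d1 c2 d2 where cd: "c1 < y" "y < d1" "c1 \<in> I" "d1 \<in> I" "c2 < y0" "y0 < d2" "c2 \<in> I" "d2 \<in> I"
      using nb[OF y] nb[OF y0] by blast
    \<comment> \<open>The fundamental theorem is applied on a compact subinterval of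
      \<open>I\<close> which has both \<open>y\<close> and the base point \<open>y0\<close> in its
      interior.\<close>
    define c where "c = min c1 c2"
    define d where "d = max d1 d2"
    have "c \<in> I" "d \<in> I" and lt: "c < y" "y < d" "c < y0" "y0 < d" using cd unfolding c_def d_def min_def max_def by (simp_all split: if_split)
    have "{c..d} \<subseteq> I" by (rule connected_contains_Icc[OF I(2) \<open>c \<in> I\<close> \<open>d \<in> I\<close>])
    then have "continuous_on {c..d} q" using q continuous_on_subset by blast
    then have "((\<lambda>u. LBINT y=y0..u. q y) has_vector_derivative q y) (at y within {c..d})"
      using lt by (intro interval_integral_FTC2) auto
    moreover have "y \<in> interior {c..d}" using lt by simp
    ultimately show ?thesis
      unfolding has_real_derivative_iff_has_vector_derivative by (simp only: at_within_interior)
  qed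
  then show ?thesis by (intro exI[of _ "\<lambda>u::real. LBINT y=y0..u. q y"] ballI)
qed simp

context grw_geodesic
begin

text \<open>With fiber velocity \<open>0\<close>, the time component is affine, while the fiber
  component satisfies \<open>W'' = - 2 (f' / f) \<tau>' W'\<close>. Hence
  \<open>f\<^sup>2 W'\<close> is constant, and \<open>vanishing_twice_vector\<close> applies with
  the weight \<open>1 / f\<^sup>2\<close>.\<close>

lemma no_conjugate_params_spacetime:
  assumes "s = 0" and t0: "t0 \<in> J" shows "conjugate_params M \<gamma> J t0 = {}"
proof -
  have "V = 0" if t1: "t1 \<in> J" "t0 < t1" and V: "V \<in> jacobi_fields_vanishing_at M \<gamma> J t0 t1" for t1 V
  proof (intro ext)
    fix i t
    have jac: "jacobi_field M \<gamma> J V" and z: "V i t0 = 0" "V i t1 = 0"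
      using V by (auto simp: jacobi_fields_vanishing_at_def)
    show "V i t = 0 i t"
    proof (cases "i \<in> idx M \<and> t \<in> J \<and> \<gamma> t \<in> patch M i")
      case True
      then have i: "i \<in> idx F" and tJ: "t \<in> J" by auto
      have p: "\<sigma> (h t) \<in> patch F i" using M_patch_iff[OF tJ] True by blast
      have "\<gamma> t' \<in> patch M i" if "t' \<in> J" for t'
      proof -
        have "\<sigma> (h t') = \<sigma> (h t)" by (rule \<sigma>_constant[OF assms(1) h_K[OF tJ] h_K[OF that]])
        then have "\<sigma> (h t') \<in> patch F i" using p by (rule ssubst)
        then show ?thesis using M_patch_iff[OF that] by blast
      qed
      then have TM: "TM i = J" unfolding times_in_def by blast
      interpret grw_chart "chart_image F i" "metric F i" I f by (rule chart[OF i])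
      obtain V' where V': "connection_chart.jacobi_on (christoffel M i) (\<lambda>t. coord M i (\<gamma> t)) (velocity M \<gamma> i) (\<lambda>t. 0)
           (\<lambda>t. (fst (V i t), snd (V i t))) (\<lambda>t. (fst (V' t), snd (V' t))) (TM i)"
        using jac i unfolding jacobi_field_iff[OF M_conn geo] grw_simps(1) by auto
      have d: "((\<lambda>t. fst (V i t)) has_vector_derivative fst (V' t)) (at t)"
        "((\<lambda>t. snd (V i t)) has_vector_derivative snd (V' t)) (at t)"
        "((\<lambda>t. fst (V' t)) has_vector_derivative 0) (at t)"
        "((\<lambda>t. snd (V' t)) has_vector_derivative - (2 * \<eta> (\<tau> t) * \<tau>1 t) *\<^sub>R snd (V' t)) (at t)" if tJ: "t \<in> J" for t
      proof -
        have T: "h t \<in> TF i" using tJ TM TM_iff by blast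
        have S: "x i (h t) \<in> chart_image F i" using T by (auto simp: times_in_def)
        have w: "w i (h t) = 0" using w_eq_0_iff[OF i T] assms by simp
        have dB0: "C.dB (x i (h t)) u 0 0 = 0" for u using dB_scale[OF S, where c = 0 and v = 0 and w = 0] by simp
        note * = V'[unfolded M_jacobi_chart[OF i], unfolded TM christoffel_eq, THEN bspec, OF tJ,
            unfolded w scaleR_zero_right C.zero_left[OF S] G.zero_left[OF S] assms dB0]
        show "((\<lambda>t. fst (V i t)) has_vector_derivative fst (V' t)) (at t)"
          "((\<lambda>t. snd (V i t)) has_vector_derivative snd (V' t)) (at t)"
          "((\<lambda>t. fst (V' t)) has_vector_derivative 0) (at t)"
          "((\<lambda>t. snd (V' t)) has_vector_derivative - (2 * \<eta> (\<tau> t) * \<tau>1 t) *\<^sub>R snd (V' t)) (at t)"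
          using * by auto
      qed
      have "fst (V i t) = 0"
        by (rule vanishing_twice_vector[OF J(2) t0 t1 d(1) _ _ _ _ tJ, of "\<lambda>_. 1"]) (use d(3) z in auto)
      moreover have "snd (V i t) = 0"
      proof (rule vanishing_twice_vector[OF J(2) t0 t1 d(2) _ _ _ _ tJ, of "\<lambda>t. 1 / (f (\<tau> t))\<^sup>2"])
        fix t assume tJ: "t \<in> J"
        show "0 < 1 / (f (\<tau> t))\<^sup>2" using f_along(3)[OF tJ] by simp
        have "((\<lambda>t. (f (\<tau> t))\<^sup>2) has_field_derivative 2 * f (\<tau> t) * (deriv f (\<tau> t) * \<tau>1 t)) (at t)"
          by (auto intro!: derivative_eq_intros f_along tJ)
        from has_vector_derivative_scaleR[OF this d(4)[OF tJ]]
        show "((\<lambda>t. snd (V' t) /\<^sub>R (1 / (f (\<tau> t))\<^sup>2)) has_vector_derivative 0) (at t)"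
          using f_along(3)[OF tJ] by (simp add: warp_defs power2_eq_square field_simps)
      qed (use z in auto)
      ultimately show ?thesis by (simp add: prod_eq_iff)
    next
      case False
      then show ?thesis using jac unfolding jacobi_field_def field_along_def by simp
    qed
  qed
  then show ?thesis unfolding conjugate_params_def by blast
qed

text \<open>Causality as a comparison of the two speeds; for \<open>s > 0\<close> it excludes zeros
  of \<open>\<tau>1\<close>.\<close>

lemma causal_velocity:
  assumes "causal_curve M \<gamma> J" and t: "t \<in> J"
  shows "(f (\<tau> t) * h1 t)\<^sup>2 * s \<le> (\<tau>1 t)\<^sup>2"
proof -
  obtain i where i: "i \<in> idx F" "t \<in> TM i" using ex_chart[OF t] by blast
  interpret grw_chart "chart_image F i" "metric F i" I f by (rule chart[OF i(1)])
  have "metric M i (coord M i (\<gamma> t)) (velocity M \<gamma> i t) (velocity M \<gamma> i t) \<le> 0"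
    using assms i unfolding causal_curve_def grw_simps(1) times_in_def by blast
  then show ?thesis
    unfolding velocity_M(1)[OF i] grw_metric[OF i(1)]
    using speed_M[OF i] proj[OF t] by (simp add: wg_def power2_eq_square algebra_simps)
qed

end

section \<open>Spacetime geodesics built from fiber geodesics\<close>

context grw_spacetime
begin

text \<open>The converse of the splitting: a fiber geodesic run with
  \<open>\<rho>' = l / f\<^sup>2\<close>, together with a solution of the time equation. It serves
  both to continue a given geodesic and to join two points; \<open>l = 0\<close> yields geodesics
  over a single fiber point.\<close>

lemma grw_geodesicI:
  assumes J: "open J" "connected J" "J \<noteq> {}" and \<tau>I: "\<And>t. t \<in> J \<Longrightarrow> \<tau> t \<in> I"
    and d\<tau>: "\<And>t. t \<in> J \<Longrightarrow> (\<tau> has_field_derivative \<tau>1 t) (at t)"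
    and d\<tau>1: "\<And>t. t \<in> J \<Longrightarrow> (\<tau>1 has_field_derivative - (s * l\<^sup>2 * deriv f (\<tau> t) / (f (\<tau> t))^3)) (at t)"
    and fgeo: "geodesic F \<sigma> K"
    and s: "\<And>i r. i \<in> idx F \<Longrightarrow> r \<in> times_in F \<sigma> K i \<Longrightarrow>
       metric F i (coord F i (\<sigma> r)) (velocity F \<sigma> i r) (velocity F \<sigma> i r) = s"
    and \<rho>K: "\<And>t. t \<in> J \<Longrightarrow> \<rho> t \<in> K"
    and d\<rho>: "\<And>t. t \<in> J \<Longrightarrow> (\<rho> has_field_derivative l / (f (\<tau> t))\<^sup>2) (at t)"
  shows "geodesic M (\<lambda>t. (\<tau> t, \<sigma> (\<rho> t))) J"
proof (rule geodesicI(1)[OF M_conn J, where v = "\<lambda>i t. (\<tau>1 t, (l / (f (\<tau> t))\<^sup>2) *\<^sub>R velocity F \<sigma> i (\<rho> t))"])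
  have c\<tau>: "continuous_on J \<tau>" by (rule DERIV_continuous_on) (rule has_field_derivative_at_within[OF d\<tau>])
  have c\<rho>: "continuous_on J \<rho>" by (rule DERIV_continuous_on) (rule has_field_derivative_at_within[OF d\<rho>])
  have c\<sigma>: "continuous_on K \<sigma>" "\<sigma> ` K \<subseteq> points F" using fgeo by (auto simp: geodesic_def)
  show "continuous_on J (\<lambda>t. (\<tau> t, \<sigma> (\<rho> t)))"
    by (intro continuous_on_Pair c\<tau> continuous_on_compose2[OF c\<sigma>(1) c\<rho>]) (use \<rho>K in auto)
  show "(\<lambda>t. (\<tau> t, \<sigma> (\<rho> t))) ` J \<subseteq> points M"
    unfolding grw_points using \<tau>I \<rho>K c\<sigma>(2) by auto
  fix i assume "i \<in> idx M"
  then have i: "i \<in> idx F" by simp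
  interpret grw_chart "chart_image F i" "metric F i" I f by (rule chart[OF i])
  have "W.geodesic_on (\<lambda>t. (\<tau> t, coord F i (\<sigma> (\<rho> t)))) (\<lambda>t. (\<tau>1 t, (l / (f (\<tau> t))\<^sup>2) *\<^sub>R velocity F \<sigma> i (\<rho> t)))
     (times_in M (\<lambda>t. (\<tau> t, \<sigma> (\<rho> t))) J i)"
    unfolding W_geodesic_on_iff
  proof (intro ballI conjI)
    fix t assume "t \<in> times_in M (\<lambda>t. (\<tau> t, \<sigma> (\<rho> t))) J i"
    then have t: "t \<in> J" "\<rho> t \<in> times_in F \<sigma> K i" using \<rho>K by (auto simp: times_in_def)
    note F = F_geodesic_chart_pointwise[OF fgeo i t(2)]
    have f0: "f (\<tau> t) > 0" using f_pos \<tau>I t by blast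
    show "\<tau> t \<in> I" "coord F i (\<sigma> (\<rho> t)) \<in> chart_image F i" using \<tau>I t F by auto
    show "(\<tau> has_vector_derivative \<tau>1 t) (at t)"
      using d\<tau>[OF t(1)] by (simp add: has_real_derivative_iff_has_vector_derivative)
    show "((\<lambda>t. coord F i (\<sigma> (\<rho> t))) has_vector_derivative (l / (f (\<tau> t))\<^sup>2) *\<^sub>R velocity F \<sigma> i (\<rho> t)) (at t)"
      by (rule has_vector_derivative_comp_real[OF d\<rho>[OF t(1)] F(2)])
    have "\<psi> (\<tau> t) * metric F i (coord F i (\<sigma> (\<rho> t))) ((l / (f (\<tau> t))\<^sup>2) *\<^sub>R velocity F \<sigma> i (\<rho> t)) ((l / (f (\<tau> t))\<^sup>2) *\<^sub>R velocity F \<sigma> i (\<rho> t))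
       = s * l\<^sup>2 * deriv f (\<tau> t) / (f (\<tau> t))^3"
      using f0 s[OF i t(2)]
      by (simp add: G.scale_left[OF F(1)] G.scale_right[OF F(1)] warp_defs field_simps eval_nat_numeral)
    then show "(\<tau>1 has_vector_derivative - (\<psi> (\<tau> t) * metric F i (coord F i (\<sigma> (\<rho> t))) ((l / (f (\<tau> t))\<^sup>2) *\<^sub>R velocity F \<sigma> i (\<rho> t)) ((l / (f (\<tau> t))\<^sup>2) *\<^sub>R velocity F \<sigma> i (\<rho> t)))) (at t)"
      using d\<tau>1[OF t(1)] by (simp add: has_real_derivative_iff_has_vector_derivative)
    have "((\<lambda>t. f (\<tau> t)) has_field_derivative deriv f (\<tau> t) * \<tau>1 t) (at t)"
      by (rule DERIV_chain2[OF f_deriv(1)[OF \<tau>I[OF t(1)]] d\<tau>[OF t(1)]])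
    then have "((\<lambda>t. l / (f (\<tau> t))\<^sup>2) has_field_derivative - (2 * l * deriv f (\<tau> t) * \<tau>1 t / (f (\<tau> t))^3)) (at t)"
      using f0 by (auto intro!: derivative_eq_intros simp: field_simps eval_nat_numeral)
    from has_vector_derivative_scaleR[OF this has_vector_derivative_comp_real[OF d\<rho>[OF t(1)] F(3)]]
    show "((\<lambda>t. (l / (f (\<tau> t))\<^sup>2) *\<^sub>R velocity F \<sigma> i (\<rho> t)) has_vector_derivative
       - \<Gamma> (coord F i (\<sigma> (\<rho> t))) ((l / (f (\<tau> t))\<^sup>2) *\<^sub>R velocity F \<sigma> i (\<rho> t)) ((l / (f (\<tau> t))\<^sup>2) *\<^sub>R velocity F \<sigma> i (\<rho> t))
       - (2 * \<eta> (\<tau> t) * \<tau>1 t) *\<^sub>R ((l / (f (\<tau> t))\<^sup>2) *\<^sub>R velocity F \<sigma> i (\<rho> t))) (at t)"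
      using f0 by (elim has_vector_derivative_eq_rhs)
        (simp add: C.scale_left[OF F(1)] C.scale_right[OF F(1)] warp_defs eval_nat_numeral mult_ac)
  qed
  then show "connection_chart.geodesic_on (chart_image M i) (christoffel M i) (\<lambda>t. coord M i (\<tau> t, \<sigma> (\<rho> t)))
      (\<lambda>t. (\<tau>1 t, (l / (f (\<tau> t))\<^sup>2) *\<^sub>R velocity F \<sigma> i (\<rho> t))) (times_in M (\<lambda>t. (\<tau> t, \<sigma> (\<rho> t))) J i)"
    unfolding grw_image christoffel_eq grw_metric[OF i] unfolding grw_simps fst_conv snd_conv .
qed

end

text \<open>The form in which the non-escape equalities are used: quadratures which grow at least as fast as the
  divergent integrals take all values.\<close>

definition non_escaping :: "real set \<Rightarrow> (real \<Rightarrow> real) \<Rightarrow> bool" where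
  "non_escaping I f \<longleftrightarrow> (\<forall>H H' \<kappa>. 0 < \<kappa> \<longrightarrow>
     (\<forall>y\<in>I. (H has_field_derivative H' y) (at y) \<and> H' y \<ge> \<kappa> * (1 / (f y)\<^sup>2 * (1 / (f y)\<^sup>2 + 1) powr (- 1 / 2))) \<longrightarrow>
     H ` I = UNIV)"

section \<open>Surjectivity of the change of parameter\<close>

context grw_geodesic
begin

text \<open>A continuous function without zeros on an interval has constant sign; through
  \<open>e\<close>, increasing and decreasing time components are treated alike.\<close>

lemma \<tau>1_sign:
  assumes "\<And>t. t \<in> J \<Longrightarrow> \<tau>1 t \<noteq> 0"
  obtains e :: real where "e * e = 1" "\<And>t. t \<in> J \<Longrightarrow> e * \<tau>1 t > 0"
proof -
  obtain t0 where t0: "t0 \<in> J" using J by blast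
  have "continuous_on J \<tau>1" by (rule DERIV_continuous_on) (rule has_field_derivative_at_within[OF \<tau>1_deriv])
  then have c: "connected (\<tau>1 ` J)" using J by (simp add: connected_continuous_image)
  have "sgn (\<tau>1 t0) * \<tau>1 t > 0" if t: "t \<in> J" for t
  proof (rule ccontr)
    assume n: "\<not> ?thesis"
    have "0 \<in> \<tau>1 ` J"
    proof (cases "\<tau>1 t0 > 0")
      case True
      then have "\<tau>1 t \<le> 0" using n by simp
      then have "{\<tau>1 t..\<tau>1 t0} \<subseteq> \<tau>1 ` J" using c t t0 by (intro connected_contains_Icc) auto
      then show ?thesis using True \<open>\<tau>1 t \<le> 0\<close> by auto
    next
      case False
      then have l: "\<tau>1 t0 < 0" using assms[OF t0] by simp
      then have "\<tau>1 t \<ge> 0" using n by simp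
      then have "{\<tau>1 t0..\<tau>1 t} \<subseteq> \<tau>1 ` J" using c t t0 by (intro connected_contains_Icc) auto
      then show ?thesis using l \<open>\<tau>1 t \<ge> 0\<close> by auto
    qed
    then show False using assms by auto
  qed
  moreover have "sgn (\<tau>1 t0) * sgn (\<tau>1 t0) = 1" using assms[OF t0] by (simp add: sgn_real_def)
  ultimately show ?thesis by (rule that[rotated])
qed

text \<open>The time component is the inverse of an antiderivative \<open>T\<close> on \<open>I\<close>, and the parameter of the
  fiber component is an antiderivative \<open>H\<close>, as a function of time. These quadratures are defined on
  all of \<open>I\<close>, so that the maximality of the geodesic implies that all of \<open>K\<close> is reached.\<close>

lemma reparametrization_surj:
  assumes max: "inextendible_geodesic M \<gamma> J" and s: "s > 0" and causal: "causal_curve M \<gamma> J"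
    and ne: "non_escaping I f"
  shows "h ` J = K"
proof -
  obtain l where l: "l > 0" "\<And>t. t \<in> J \<Longrightarrow> h1 t = l / (f (\<tau> t))\<^sup>2" using h1_eq[OF s] by blast
  have lower: "s * l\<^sup>2 / (f (\<tau> t))\<^sup>2 \<le> (\<tau>1 t)\<^sup>2" if "t \<in> J" for t
    using causal_velocity[OF causal that] f_along(3)[OF that]
    by (simp add: l(2)[OF that] field_simps power2_eq_square)
  have \<tau>1: "\<tau>1 t \<noteq> 0" if "t \<in> J" for t
    using lower[OF that] s l(1) f_along(3)[OF that]
    by (smt (verit) divide_pos_pos mult_pos_pos zero_less_power power_zero_numeral)
  obtain e where e: "e * e = 1" "\<And>t. t \<in> J \<Longrightarrow> e * \<tau>1 t > 0" using \<tau>1_sign[OF \<tau>1] by blast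
  then have e0: "e \<noteq> 0" and e1: "e = 1 \<or> e = - 1" using square_eq_1_iff[of e] by auto
  obtain t0 where t0: "t0 \<in> J" using J by blast
  \<comment> \<open>The constant of energy conservation. Causality makes it nonnegative, which keeps
    the radicand \<open>G\<close> positive on all of \<open>I\<close>, not just on the times
    attained by the geodesic.\<close>
  define D where "D = (\<tau>1 t0)\<^sup>2 - s * l\<^sup>2 / (f (\<tau> t0))\<^sup>2"
  have D0: "D \<ge> 0" using lower[OF t0] by (simp add: D_def)
  have energy: "(\<tau>1 t)\<^sup>2 = s * l\<^sup>2 / (f (\<tau> t))\<^sup>2 + D" if "t \<in> J" for t
  proof -
    have "((\<lambda>t. (\<tau>1 t)\<^sup>2 - s * l\<^sup>2 / (f (\<tau> t))\<^sup>2) has_field_derivative 0) (at t)" if "t \<in> J" for t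
      using f_along(3)[OF that]
      by (auto intro!: derivative_eq_intros \<tau>1_deriv f_along that)
         (simp add: l(2)[OF that] warp_defs field_simps eval_nat_numeral)
    from has_real_derivative_zero_constant_on[OF J(2) this t0 that] show ?thesis by (simp add: D_def)
  qed
  define G where "G y = s * l\<^sup>2 / (f y)\<^sup>2 + D" for y
  have G0: "G y > 0" if "y \<in> I" for y
    using s l(1) f_pos[OF that] D0 by (simp add: G_def add_pos_nonneg)
  \<comment> \<open>The velocity of \<open>\<tau>\<close> as a function of \<open>\<tau>\<close>
    itself, which turns the second-order equation into quadratures.\<close>
  define q where "q y = e * sqrt (G y)" for y
  have q0: "q y \<noteq> 0" if "y \<in> I" for y using G0[OF that] e0 by (simp add: q_def)
  have q\<tau>: "q (\<tau> t) = \<tau>1 t" if "t \<in> J" for t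
  proof -
    have "sqrt (G (\<tau> t)) = \<bar>\<tau>1 t\<bar>" using energy[OF that] by (simp add: G_def flip: real_sqrt_abs)
    then show ?thesis using e1 e(2)[OF that] by (auto simp: q_def)
  qed
  have fd: "(f has_field_derivative deriv f y) (at y)" if "y \<in> I" for y
    using smooth_on_real_has_field_derivative f_smooth that by blast
  have dq: "(q has_field_derivative - (s * l\<^sup>2 * deriv f y / (f y)^3) / q y) (at y)" if "y \<in> I" for y
  proof -
    have "(G has_field_derivative - (2 * s * l\<^sup>2 * deriv f y / (f y)^3)) (at y)"
      unfolding G_def[abs_def] using f_pos[OF that]
      by (auto intro!: derivative_eq_intros fd that simp: field_simps eval_nat_numeral)
    then have "(q has_field_derivative e * (- (2 * s * l\<^sup>2 * deriv f y / (f y)^3) * (inverse (sqrt (G y)) / 2))) (at y)"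
      unfolding q_def[abs_def] using G0[OF that]
      by (auto intro!: derivative_eq_intros)
    moreover have "e * (- (2 * s * l\<^sup>2 * deriv f y / (f y)^3) * (inverse (sqrt (G y)) / 2)) = - (s * l\<^sup>2 * deriv f y / (f y)^3) / q y"
    proof -
      show ?thesis using e1 by (auto simp: q_def field_simps)
    qed
    ultimately show ?thesis by simp
  qed
  have cq: "continuous_on I q"
    by (rule DERIV_continuous_on) (rule has_field_derivative_at_within[OF dq])
  have cf: "continuous_on I f" by (rule DERIV_continuous_on) (rule has_field_derivative_at_within[OF fd])
  have c1: "continuous_on I (\<lambda>y. 1 / q y)" and c2: "continuous_on I (\<lambda>y. l / (f y)\<^sup>2 / q y)"
    using q0 less_imp_neq[OF f_pos, symmetric] by (auto intro!: continuous_intros cq cf)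
  from open_interval_antiderivative[OF open_I conn_I c1] obtain T0
    where T0: "\<forall>y\<in>I. (T0 has_field_derivative 1 / q y) (at y)" ..
  from open_interval_antiderivative[OF open_I conn_I c2] obtain H0
    where H0: "\<forall>y\<in>I. (H0 has_field_derivative l / (f y)\<^sup>2 / q y) (at y)" ..
  \<comment> \<open>The constants are chosen such that \<open>T\<close> inverts
    \<open>\<tau>\<close> and the composition of \<open>H\<close> with \<open>\<tau>\<close> is
    \<open>h\<close>.\<close>
  define T where "T y = T0 y - T0 (\<tau> t0) + t0" for y
  define H where "H y = H0 y - H0 (\<tau> t0) + h t0" for y
  have dT: "(T has_field_derivative 1 / q y) (at y)" and dH: "(H has_field_derivative l / (f y)\<^sup>2 / q y) (at y)"
    if "y \<in> I" for y
    unfolding T_def[abs_def] H_def[abs_def] by (auto intro!: derivative_eq_intros T0[rule_format] H0[rule_format] that)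
  have T\<tau>: "T (\<tau> t) = t" if "t \<in> J" for t
  proof -
    have "((\<lambda>t. T (\<tau> t) - t) has_field_derivative 0) (at t)" if "t \<in> J" for t
      using DERIV_diff[OF DERIV_chain2[OF dT[OF \<tau>_I[OF that]] \<tau>_deriv[OF that]] DERIV_ident]
      by (simp add: q\<tau>[OF that] \<tau>1[OF that])
    from has_real_derivative_zero_constant_on[OF J(2) this t0 that] show ?thesis by (simp add: T_def)
  qed
  have H\<tau>: "H (\<tau> t) = h t" if "t \<in> J" for t
  proof -
    have "((\<lambda>t. H (\<tau> t) - h t) has_field_derivative 0) (at t)" if "t \<in> J" for t
      using DERIV_diff[OF DERIV_chain2[OF dH[OF \<tau>_I[OF that]] \<tau>_deriv[OF that]] h_deriv(1)[OF that]]
      by (simp add: q\<tau>[OF that] \<tau>1[OF that] l(2)[OF that])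
    from has_real_derivative_zero_constant_on[OF J(2) this t0 that] show ?thesis by (simp add: H_def)
  qed
  have mono: "e * u y < e * u y'"
    if y: "y \<in> I" "y' \<in> I" "y < y'" and u: "\<And>y. y \<in> I \<Longrightarrow> (u has_field_derivative c y / q y) (at y)"
      "\<And>y. y \<in> I \<Longrightarrow> c y > 0" for u c y y'
  proof (rule DERIV_pos_imp_increasing[OF y(3)])
    fix z assume "y \<le> z" "z \<le> y'"
    then have z: "z \<in> I" using connected_contains_Icc[OF conn_I y(1,2)] by auto
    have "e / q z = 1 / sqrt (G z)" using e0 by (simp add: q_def)
    then have "e * (c z / q z) = c z / sqrt (G z)" by (metis times_divide_eq_right mult.commute mult.right_neutral times_divide_eq_left)
    then have "e * (c z / q z) > 0" using u(2)[OF z] G0[OF z] by simp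
    then show "\<exists>D. ((\<lambda>y. e * u y) has_real_derivative D) (at z) \<and> 0 < D"
      using DERIV_cmult[OF u(1)[OF z], of e] by blast
  qed
  have monoT: "e * T y < e * T y'" and monoH: "e * H y < e * H y'" if "y \<in> I" "y' \<in> I" "y < y'" for y y'
    using mono[OF that dT] mono[OF that dH] l(1) f_pos by (force, force)
  have injT: "inj_on T I"
    by (rule inj_onI) (metis monoT linorder_neqE_linordered_idom less_irrefl)
  \<comment> \<open>All times at which the fiber parameter given by the quadrature lies in the
    domain of \<open>\<sigma>\<close>. The geodesic over them extends \<open>\<gamma>\<close>, so
    that by maximality its domain \<open>J'\<close> is \<open>J\<close>.\<close>
  define Y where "Y = I \<inter> H -` K"
  have cT: "continuous_on I T" and cH: "continuous_on I H"
    by ((rule DERIV_continuous_on, rule has_field_derivative_at_within, rule dT, assumption),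
        (rule DERIV_continuous_on, rule has_field_derivative_at_within, rule dH, assumption))
  have oY: "open Y" unfolding Y_def by (rule continuous_open_preimage[OF cH open_I K(1)])
  have "is_interval Y" unfolding is_interval_1
  proof (intro ballI allI impI)
    fix y1 y2 y assume y: "y1 \<in> Y" "y2 \<in> Y" "y1 \<le> y \<and> y \<le> y2"
    then have yI: "y \<in> I" using connected_contains_Icc[OF conn_I, of y1 y2] by (auto simp: Y_def)
    have "e * H y1 \<le> e * H y" "e * H y \<le> e * H y2"
      using monoH[of y1 y] monoH[of y y2] y yI by (auto simp: Y_def order_le_less)
    then have "H y \<in> {H y1..H y2} \<or> H y \<in> {H y2..H y1}" using e1 by auto
    moreover have "{H y1..H y2} \<subseteq> K" "{H y2..H y1} \<subseteq> K"
      using connected_contains_Icc[OF K(2)] y by (auto simp only: Y_def)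
    ultimately have "H y \<in> K" by blast
    then show "y \<in> Y" using yI by (simp add: Y_def)
  qed
  then have connY: "connected Y" by (simp add: is_interval_connected_1)
  define J' where "J' = T ` Y"
  define \<theta> where "\<theta> = inv_into I T"
  have YI: "Y \<subseteq> I" by (simp add: Y_def)
  have \<theta>T: "\<theta> (T y) = y" if "y \<in> I" for y using injT that by (simp add: \<theta>_def)
  have JJ': "J \<subseteq> J'"
  proof
    fix t assume t: "t \<in> J"
    then have "\<tau> t \<in> Y" using \<tau>_I H\<tau> h_K by (simp add: Y_def)
    then show "t \<in> J'" using T\<tau>[OF t] unfolding J'_def by force
  qed
  have \<theta>Y: "\<theta> t \<in> Y" "T (\<theta> t) = t" if "t \<in> J'" for t
    using that YI \<theta>T by (auto simp: J'_def)
  have \<theta>I: "\<theta> t \<in> I" if "t \<in> J'" for t using \<theta>Y YI that by blast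
  have d\<theta>: "(\<theta> has_field_derivative q (\<theta> t)) (at t)" if "t \<in> J'" for t
    using real_inverse_derivative[OF open_I dT \<theta>T \<theta>I[OF that]] q0[OF \<theta>I[OF that]] \<theta>Y[OF that] by simp
  have geo': "geodesic M (\<lambda>t. (\<theta> t, \<sigma> (H (\<theta> t)))) J'"
  proof (rule grw_geodesicI[where ?\<tau>1.0 = "\<lambda>t. q (\<theta> t)" and s = s and l = l and K = K])
    show "open J'" unfolding J'_def
      by (rule invariance_of_domain[OF continuous_on_subset[OF cT YI] oY inj_on_subset[OF injT YI]])
    show "connected J'" unfolding J'_def
      by (rule connected_continuous_image[OF continuous_on_subset[OF cT YI] connY])
    show "J' \<noteq> {}" using JJ' J by blast
    show "geodesic F \<sigma> K" by (rule fgeo)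
  next
    fix t assume t: "t \<in> J'"
    show "\<theta> t \<in> I" "H (\<theta> t) \<in> K" using \<theta>Y[OF t] by (auto simp: Y_def)
    show "(\<theta> has_field_derivative q (\<theta> t)) (at t)" by (rule d\<theta>[OF t])
    show "((\<lambda>t. q (\<theta> t)) has_field_derivative - (s * l\<^sup>2 * deriv f (\<theta> t) / (f (\<theta> t))^3)) (at t)"
      using DERIV_chain2[OF dq[OF \<theta>I[OF t]] d\<theta>[OF t]] q0[OF \<theta>I[OF t]] by simp
    show "((\<lambda>t. H (\<theta> t)) has_field_derivative l / (f (\<theta> t))\<^sup>2) (at t)"
      using DERIV_chain2[OF dH[OF \<theta>I[OF t]] d\<theta>[OF t]] q0[OF \<theta>I[OF t]] by simp
  qed (rule s_speed)
  have "(\<theta> t, \<sigma> (H (\<theta> t))) = \<gamma> t" if t: "t \<in> J" for t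
  proof -
    have "\<theta> t = \<tau> t" using \<theta>T[OF \<tau>_I[OF t]] T\<tau>[OF t] by simp
    then show ?thesis using H\<tau>[OF t] proj[OF t] by (simp add: prod_eq_iff)
  qed
  then have "J' = J" using max geo' JJ' unfolding inextendible_geodesic_def by blast
  \<comment> \<open>The factor \<open>e\<close> makes the quadrature increasing, as a lower bound by
    the positive weight in \<open>non_escaping\<close> requires.\<close>
  have "(\<lambda>y. e * H y) ` I = UNIV"
  proof -
    \<comment> \<open>Chosen so that \<open>G y \<le> m * (1 / (f y)\<^sup>2 + 1)\<close>; thus the
      integrand \<open>l / f\<^sup>2 / sqrt G\<close> dominates a multiple of the non-escape
      weight.\<close>
    define m where "m = max (s * l\<^sup>2) D"
    have m0: "m > 0" using s l(1) by (simp add: m_def less_max_iff_disj)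
    have "\<forall>y\<in>I. ((\<lambda>y. e * H y) has_field_derivative l / (f y)\<^sup>2 / sqrt (G y)) (at y) \<and>
        l / (f y)\<^sup>2 / sqrt (G y) \<ge> (l / sqrt m) * (1 / (f y)\<^sup>2 * (1 / (f y)\<^sup>2 + 1) powr (- 1 / 2))"
    proof (intro ballI conjI)
      fix y assume y: "y \<in> I"
      have eq: "e * (l / (f y)\<^sup>2 / q y) = l / (f y)\<^sup>2 / sqrt (G y)" using e0 by (simp add: q_def)
      show "((\<lambda>y. e * H y) has_field_derivative l / (f y)\<^sup>2 / sqrt (G y)) (at y)"
        using DERIV_cmult[OF dH[OF y], of e] unfolding eq .
      have p: "1 / (f y)\<^sup>2 + 1 > 0" using f_pos[OF y] by (simp add: add_pos_pos)
      have "G y \<le> m * (1 / (f y)\<^sup>2 + 1)"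
      proof -
        have "s * l\<^sup>2 * (1 / (f y)\<^sup>2) \<le> m * (1 / (f y)\<^sup>2)" by (rule mult_right_mono) (simp_all add: m_def)
        moreover have "D \<le> m" by (simp add: m_def)
        ultimately show ?thesis by (simp add: G_def distrib_left)
      qed
      then have "sqrt (G y) \<le> sqrt m * sqrt (1 / (f y)\<^sup>2 + 1)"
        by (metis real_sqrt_le_mono real_sqrt_mult)
      moreover have "(1 / (f y)\<^sup>2 + 1) powr (- 1 / 2) = 1 / sqrt (1 / (f y)\<^sup>2 + 1)"
        using p by (simp add: powr_minus_divide powr_half_sqrt)
      moreover have "l / (f y)\<^sup>2 / (sqrt m * sqrt (1 / (f y)\<^sup>2 + 1)) \<le> l / (f y)\<^sup>2 / sqrt (G y)"
        using calculation(1) G0[OF y] l(1) by (intro divide_left_mono) (simp_all add: mult_pos_pos m0 p)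
      ultimately show "l / (f y)\<^sup>2 / sqrt (G y) \<ge> (l / sqrt m) * (1 / (f y)\<^sup>2 * (1 / (f y)\<^sup>2 + 1) powr (- 1 / 2))"
        by (simp add: mult_ac)
    qed
    moreover have "l / sqrt m > 0" using l(1) m0 by simp
    ultimately show ?thesis
      using ne[unfolded non_escaping_def, THEN spec, THEN spec, THEN spec, THEN mp, THEN mp,
          of "l / sqrt m" "\<lambda>y. e * H y" "\<lambda>y. l / (f y)\<^sup>2 / sqrt (G y)"] by blast
  qed
  note eH = this
  have surjH: "\<exists>y\<in>I. H y = r" for r
  proof -
    have "e * r \<in> (\<lambda>y. e * H y) ` I" unfolding eH by simp
    then obtain y where "y \<in> I" "e * r = e * H y" by blast
    then show ?thesis using e0 by auto
  qed
  show ?thesis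
  proof
    show "K \<subseteq> h ` J"
    proof
      fix r assume "r \<in> K"
      obtain y where y: "y \<in> I" "H y = r" using surjH by blast
      then have "T y \<in> J" using \<open>r \<in> K\<close> \<open>J' = J\<close> by (auto simp: J'_def Y_def)
      moreover have "\<tau> (T y) = y" using injT T\<tau>[OF \<open>T y \<in> J\<close>] y \<tau>_I[OF \<open>T y \<in> J\<close>] by (auto dest: inj_onD)
      ultimately show "r \<in> h ` J" using H\<tau>[of "T y"] y by force
    qed
  qed (use h_K in auto)
qed

end

section \<open>Ordinary differential equations with a parameter\<close>

text \<open>The expression is the integral of \<open>y\<close> from \<open>0\<close> to
  \<open>r\<close>, rescaled to a fixed interval: this handles both signs of \<open>r\<close> at
  once and lets \<open>integral_continuous_on_param\<close> supply the joint continuity in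
  \<open>r\<close> and the parameter.\<close>

lemma has_vector_derivative_scaled_integral:
  fixes y :: "real \<Rightarrow> 'a::euclidean_space"
  assumes "continuous_on UNIV y"
  shows "((\<lambda>r. r *\<^sub>R integral {0..1} (\<lambda>s. y (r * s))) has_vector_derivative y r) (at r)"
proof -
  define B where "B = \<bar>r\<bar> + 1"
  obtain g where g: "\<And>x. x \<in> {-B..B} \<Longrightarrow> (g has_vector_derivative y x) (at x within {-B..B})"
    using antiderivative_continuous[of "-B" B y] continuous_on_subset[OF assms] by blast
  have int: "r' *\<^sub>R integral {0..1} (\<lambda>s. y (r' * s)) = g r' - g 0" if r': "r' \<in> {-B<..<B}" for r'
  proof -
    have "((\<lambda>s. r' *\<^sub>R y (r' * s)) has_integral g (r' * 1) - g (r' * 0)) {0..1}"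
    proof (rule fundamental_theorem_of_calculus)
      fix s :: real assume s: "s \<in> {0..1}"
      have img: "r' * s \<in> {-B..B}" if "s \<in> {0..1}" for s
      proof -
        have "\<bar>r' * s\<bar> \<le> \<bar>r'\<bar> * 1" using that unfolding abs_mult by (intro mult_left_mono) auto
        then show ?thesis using r' by auto
      qed
      have "((\<lambda>s. r' * s) has_vector_derivative r') (at s within {0..1})"
        by (auto intro!: derivative_eq_intros)
      moreover have "(g has_vector_derivative y (r' * s)) (at (r' * s) within (\<lambda>s. r' * s) ` {0..1})"
        by (rule has_vector_derivative_within_subset[OF g[OF img[OF s]]]) (use img in auto)
      ultimately show "((\<lambda>s. g (r' * s)) has_vector_derivative r' *\<^sub>R y (r' * s)) (at s within {0..1})"
        using vector_diff_chain_within[of "\<lambda>s. r' * s" r' s "{0..1}" g] by (simp add: comp_def)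
    qed simp
    from integral_unique[OF this] show ?thesis by simp
  qed
  have r: "r \<in> {-B<..<B}" by (auto simp: B_def)
  then have "(g has_vector_derivative y r) (at r)"
    using g[of r] at_within_interior[of r "{-B..B}"] by simp
  then have "((\<lambda>r. g r - g 0) has_vector_derivative y r) (at r)" by (auto intro!: derivative_eq_intros)
  then show ?thesis
    by (rule has_vector_derivative_transform_within_open[OF _ _ r]) (use int in auto)
qed

text \<open>Integration reproduces the exponential weight up to the factor
  \<open>1 / \<kappa>\<close>, which is the source of the contraction.\<close>

lemma integral_exp_abs:
  fixes \<kappa> r :: real assumes "\<kappa> > 0"
  shows "((\<lambda>s. \<bar>r\<bar> * exp (\<kappa> * \<bar>r * s\<bar>)) has_integral (exp (\<kappa> * \<bar>r\<bar>) - 1) / \<kappa>) {0..1}"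
proof -
  have "((\<lambda>s. \<bar>r\<bar> * exp (\<kappa> * \<bar>r\<bar> * s)) has_integral exp (\<kappa> * \<bar>r\<bar> * 1) / \<kappa> - exp (\<kappa> * \<bar>r\<bar> * 0) / \<kappa>) {0..1}"
    by (rule fundamental_theorem_of_calculus)
       (use assms in \<open>auto intro!: derivative_eq_intros simp flip: has_real_derivative_iff_has_vector_derivative\<close>)
  then have "((\<lambda>s. \<bar>r\<bar> * exp (\<kappa> * \<bar>r\<bar> * s)) has_integral (exp (\<kappa> * \<bar>r\<bar>) - 1) / \<kappa>) {0..1}"
    by (simp add: diff_divide_distrib)
  then show ?thesis by (rule has_integral_eq[rotated]) (auto simp: abs_mult)
qed

text \<open>Picard iteration is a contraction for the norm weighted with \<open>exp (- 2 * L * \<bar>r\<bar>)\<close>; taking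
  bounded continuous functions of the parameter and of the time simultaneously yields the continuous
  dependence on the parameter.\<close>

theorem ode_with_parameter:
  fixes X :: "real \<Rightarrow> 'a::euclidean_space \<Rightarrow> 'a" and x0 :: "real \<Rightarrow> 'a"
  assumes cX: "continuous_on UNIV (\<lambda>p. X (fst p) (snd p))"
    and lip: "\<And>w x y. norm (X w x - X w y) \<le> L * norm (x - y)" and L: "L > 0"
    and bX: "\<And>w. norm (X w 0) \<le> C" and cx: "continuous_on UNIV x0" and bx: "\<And>w. norm (x0 w) \<le> C"
  obtains u where "continuous_on UNIV (\<lambda>p. u (fst p) (snd p))" "\<And>w. u w 0 = x0 w"
    "\<And>w r. (u w has_vector_derivative X w (u w r)) (at r)"
proof -
  \<comment> \<open>Makes the contraction factor \<open>L / \<kappa>\<close> equal to 1/2.\<close>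
  define \<kappa> where "\<kappa> = 2 * L"
  have \<kappa>: "\<kappa> > 0" using L by (simp add: \<kappa>_def)
  have C: "C \<ge> 0" using bx[of 0] norm_ge_zero order_trans by blast
  \<comment> \<open>The bounded function \<open>v\<close> stands for the solution divided by its
    exponential weight; \<open>Y\<close> is the right-hand side along that solution and
    \<open>P\<close> its integral from \<open>0\<close>.\<close>
  define Y where "Y v w \<rho> = X w (exp (\<kappa> * \<bar>\<rho>\<bar>) *\<^sub>R apply_bcontfun v (w, \<rho>))" for v w \<rho>
  define P where "P v w r = r *\<^sub>R integral {0..1} (\<lambda>s. Y v w (r * s))" for v w r
  have cY: "continuous_on A (\<lambda>p. Y v (a p) (b p))" if "continuous_on A a" "continuous_on A b"
    for v A and a b :: "'z::topological_space \<Rightarrow> real"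
  proof -
    have c: "continuous_on A (\<lambda>p. (a p, exp (\<kappa> * \<bar>b p\<bar>) *\<^sub>R apply_bcontfun v (a p, b p)))"
      by (intro continuous_intros that continuous_on_compose2[OF continuous_on_apply_bcontfun[of UNIV v]]) auto
    show ?thesis using continuous_on_compose2[OF cX c] by (simp add: Y_def)
  qed
  have iY: "(\<lambda>s. Y v w (r * s)) integrable_on {0..1}" for v w r
    by (intro integrable_continuous_real cY continuous_intros)
  have cP: "continuous_on UNIV (\<lambda>p. P v (fst p) (snd p))" for v
  proof -
    have "continuous_on (UNIV \<times> cbox 0 1) (\<lambda>(p, s). Y v (fst p) (snd p * s))" for v
      unfolding split_beta by (intro cY continuous_intros)
    from integral_continuous_on_param[OF this]
    show ?thesis unfolding P_def by (intro continuous_intros) (simp add: cbox_interval)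
  qed
  have P_le: "norm (P v w r) \<le> C * \<bar>r\<bar> + L * norm v * ((exp (\<kappa> * \<bar>r\<bar>) - 1) / \<kappa>)" for v w r
  proof -
    have "norm (integral {0..1} (\<lambda>s. r *\<^sub>R Y v w (r * s)))
       \<le> integral {0..1} (\<lambda>s. C * \<bar>r\<bar> + L * norm v * (\<bar>r\<bar> * exp (\<kappa> * \<bar>r * s\<bar>)))"
    proof (rule integral_norm_bound_integral)
      show "(\<lambda>s. r *\<^sub>R Y v w (r * s)) integrable_on {0..1}" by (intro integrable_cmul iY)
      show "(\<lambda>s. C * \<bar>r\<bar> + L * norm v * (\<bar>r\<bar> * exp (\<kappa> * \<bar>r * s\<bar>))) integrable_on {0..1}"
        by (intro integrable_continuous_real continuous_intros)
      fix s :: real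
      have "norm (Y v w (r * s)) \<le> norm (X w 0) + norm (Y v w (r * s) - X w 0)"
        by (metis add.commute diff_add_cancel norm_triangle_ineq)
      also have "norm (Y v w (r * s) - X w 0) \<le> L * norm (exp (\<kappa> * \<bar>r * s\<bar>) *\<^sub>R apply_bcontfun v (w, r * s))"
        using lip[of w "exp (\<kappa> * \<bar>r * s\<bar>) *\<^sub>R apply_bcontfun v (w, r * s)" 0] by (simp add: Y_def)
      also have "\<dots> \<le> L * (exp (\<kappa> * \<bar>r * s\<bar>) * norm v)"
        using L norm_bounded[of v "(w, r * s)"] by simp
      finally have "norm (Y v w (r * s)) \<le> C + L * (exp (\<kappa> * \<bar>r * s\<bar>) * norm v)" using bX[of w] by simp
      then have "\<bar>r\<bar> * norm (Y v w (r * s)) \<le> \<bar>r\<bar> * (C + L * (exp (\<kappa> * \<bar>r * s\<bar>) * norm v))"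
        by (rule mult_left_mono) simp
      then show "norm (r *\<^sub>R Y v w (r * s)) \<le> C * \<bar>r\<bar> + L * norm v * (\<bar>r\<bar> * exp (\<kappa> * \<bar>r * s\<bar>))"
        by (simp add: algebra_simps)
    qed
    also have "\<dots> = C * \<bar>r\<bar> + L * norm v * ((exp (\<kappa> * \<bar>r\<bar>) - 1) / \<kappa>)"
    proof -
      have "((\<lambda>s. C * \<bar>r\<bar> + L * norm v * (\<bar>r\<bar> * exp (\<kappa> * \<bar>r * s\<bar>))) has_integral
          (1 - 0) *\<^sub>R (C * \<bar>r\<bar>) + L * norm v * ((exp (\<kappa> * \<bar>r\<bar>) - 1) / \<kappa>)) {0..1}"
        by (intro has_integral_add has_integral_mult_right integral_exp_abs \<kappa> has_integral_const_real[where a = "0::real" and b = 1, simplified content_real]) simp?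
      then show ?thesis by (simp add: integral_unique)
    qed
    finally show ?thesis by (simp add: P_def)
  qed
  have P_diff: "norm (P v w r - P v' w r) \<le> L * dist v v' * ((exp (\<kappa> * \<bar>r\<bar>) - 1) / \<kappa>)" for v v' w r
  proof -
    have "norm (integral {0..1} (\<lambda>s. r *\<^sub>R (Y v w (r * s) - Y v' w (r * s))))
       \<le> integral {0..1} (\<lambda>s. L * dist v v' * (\<bar>r\<bar> * exp (\<kappa> * \<bar>r * s\<bar>)))"
    proof (rule integral_norm_bound_integral)
      show "(\<lambda>s. r *\<^sub>R (Y v w (r * s) - Y v' w (r * s))) integrable_on {0..1}"
        by (intro integrable_cmul integrable_diff iY)
      show "(\<lambda>s. L * dist v v' * (\<bar>r\<bar> * exp (\<kappa> * \<bar>r * s\<bar>))) integrable_on {0..1}"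
        by (intro integrable_continuous_real continuous_intros)
      fix s :: real
      have "norm (Y v w (r * s) - Y v' w (r * s)) \<le> L * norm (exp (\<kappa> * \<bar>r * s\<bar>) *\<^sub>R apply_bcontfun v (w, r * s) - exp (\<kappa> * \<bar>r * s\<bar>) *\<^sub>R apply_bcontfun v' (w, r * s))"
        unfolding Y_def by (rule lip)
      also have "\<dots> = L * (exp (\<kappa> * \<bar>r * s\<bar>) * dist (apply_bcontfun v (w, r * s)) (apply_bcontfun v' (w, r * s)))"
        by (simp add: dist_norm flip: scaleR_diff_right)
      also have "\<dots> \<le> L * (exp (\<kappa> * \<bar>r * s\<bar>) * dist v v')"
        using L dist_bounded[of v "(w, r * s)" v'] by simp
      finally have "\<bar>r\<bar> * norm (Y v w (r * s) - Y v' w (r * s)) \<le> \<bar>r\<bar> * (L * (exp (\<kappa> * \<bar>r * s\<bar>) * dist v v'))"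
        by (rule mult_left_mono) simp
      then show "norm (r *\<^sub>R (Y v w (r * s) - Y v' w (r * s))) \<le> L * dist v v' * (\<bar>r\<bar> * exp (\<kappa> * \<bar>r * s\<bar>))"
        by (simp add: mult_ac)
    qed
    also have "\<dots> = L * dist v v' * ((exp (\<kappa> * \<bar>r\<bar>) - 1) / \<kappa>)"
      by (intro integral_unique has_integral_mult_right integral_exp_abs \<kappa>)
    finally show ?thesis
      using integral_diff[OF iY[of v w r] iY[of v' w r]] by (simp add: P_def scaleR_diff_right[symmetric])
  qed
  \<comment> \<open>Picard's operator for the weighted function. Its values are bounded, as both
    \<open>\<bar>r\<bar>\<close> and \<open>exp (\<kappa> * \<bar>r\<bar>)\<close> are at most
    multiples of the weight that is divided out.\<close>
  define Q where "Q v p = exp (- (\<kappa> * \<bar>snd p\<bar>)) *\<^sub>R (x0 (fst p) + P v (fst p) (snd p))" for v p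
  have Q_bcont: "Q v \<in> bcontfun" for v
  proof (rule bcontfun_normI)
    show "continuous_on UNIV (Q v)" unfolding Q_def[abs_def]
      by (intro continuous_intros cP continuous_on_compose2[OF cx]) auto
    fix p :: "real \<times> real"
    define e where "e = exp (\<kappa> * \<bar>snd p\<bar>)"
    have e: "e \<ge> 1" using \<kappa> by (simp add: e_def)
    have e2: "\<kappa> * \<bar>snd p\<bar> \<le> e"
      using exp_ge_add_one_self[of "\<kappa> * \<bar>snd p\<bar>"] unfolding e_def by linarith
    have "norm (x0 (fst p) + P v (fst p) (snd p)) \<le> C + (C * \<bar>snd p\<bar> + L * norm v * ((e - 1) / \<kappa>))"
      using norm_triangle_ineq[of "x0 (fst p)" "P v (fst p) (snd p)"] bx[of "fst p"] P_le[of v "fst p" "snd p"]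
      by (simp add: e_def)
    also have "\<dots> \<le> C * e + (C / \<kappa> * e + L * norm v / \<kappa> * e)"
    proof (intro add_mono)
      show "C \<le> C * e" using mult_left_mono[OF e C] by simp
      show "C * \<bar>snd p\<bar> \<le> C / \<kappa> * e" using mult_left_mono[OF e2 C] \<kappa> by (simp add: field_simps)
      show "L * norm v * ((e - 1) / \<kappa>) \<le> L * norm v / \<kappa> * e"
        using \<kappa> L by (simp add: field_simps)
    qed
    also have "\<dots> = (C + C / \<kappa> + L * norm v / \<kappa>) * e" by (simp add: algebra_simps)
    finally have "norm (x0 (fst p) + P v (fst p) (snd p)) / e \<le> C + C / \<kappa> + L * norm v / \<kappa>"
      using e by (simp add: pos_divide_le_eq)
    moreover have "norm (Q v p) = norm (x0 (fst p) + P v (fst p) (snd p)) / e"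
      unfolding Q_def norm_scaleR e_def by (simp add: exp_minus divide_inverse mult.commute)
    ultimately show "norm (Q v p) \<le> C + C / \<kappa> + L * norm v / \<kappa>" by simp
  qed
  have Q_app: "apply_bcontfun (Bcontfun (Q v)) = Q v" for v by (rule Bcontfun_inverse[OF Q_bcont])
  have "\<exists>!v. Bcontfun (Q v) = v"
  proof (rule banach_fix_type[of "1/2"], simp, simp, intro allI)
    fix v v' :: "(real \<times> real) \<Rightarrow>\<^sub>C 'a"
    show "dist (Bcontfun (Q v)) (Bcontfun (Q v')) \<le> 1 / 2 * dist v v'"
    proof (rule dist_bound)
      fix p :: "real \<times> real"
      define e where "e = exp (\<kappa> * \<bar>snd p\<bar>)"
      have e: "e > 0" by (simp add: e_def)
      have "Q v p - Q v' p = (1 / e) *\<^sub>R (P v (fst p) (snd p) - P v' (fst p) (snd p))"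
        by (simp add: Q_def e_def exp_minus inverse_eq_divide algebra_simps)
      then have "dist (Q v p) (Q v' p) = (1 / e) * norm (P v (fst p) (snd p) - P v' (fst p) (snd p))"
        using e by (simp add: dist_norm)
      also have "\<dots> \<le> (1 / e) * (L * dist v v' * ((e - 1) / \<kappa>))"
        using P_diff[of v "fst p" "snd p" v'] e unfolding e_def by (intro mult_left_mono) auto
      also have "\<dots> \<le> 1 / 2 * dist v v'"
        using e L by (simp add: \<kappa>_def field_simps)
      finally show "dist (apply_bcontfun (Bcontfun (Q v)) p) (apply_bcontfun (Bcontfun (Q v')) p) \<le> 1 / 2 * dist v v'"
        by (simp add: Q_app)
    qed
  qed
  then obtain v where "Bcontfun (Q v) = v" by blast
  then have v: "apply_bcontfun v p = Q v p" for p using Q_app by metis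
  define u where "u w r = x0 w + P v w r" for w r
  have uv: "u w r = exp (\<kappa> * \<bar>r\<bar>) *\<^sub>R apply_bcontfun v (w, r)" for w r
    by (simp add: v Q_def u_def flip: exp_add)
  have Yu: "Y v w r = X w (u w r)" for w r by (simp add: Y_def uv)
  show ?thesis
  proof (rule that[of u])
    show "continuous_on UNIV (\<lambda>p. u (fst p) (snd p))"
      unfolding u_def by (intro continuous_intros cP continuous_on_compose2[OF cx]) auto
    show "u w 0 = x0 w" for w by (simp add: u_def P_def)
    fix w r
    have "continuous_on UNIV (Y v w)" by (intro cY continuous_intros)
    then have "((\<lambda>r. x0 w + P v w r) has_vector_derivative 0 + Y v w r) (at r)"
      unfolding P_def
      by (intro has_vector_derivative_add has_vector_derivative_const has_vector_derivative_scaled_integral)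
    then show "(u w has_vector_derivative X w (u w r)) (at r)"
      unfolding Yu by (simp add: u_def[abs_def])
  qed
qed

section \<open>A boundary value problem\<close>

lemma strict_mono_of_pos_derivative:
  fixes \<Phi> :: "real \<Rightarrow> real"
  assumes "\<And>x. (\<Phi> has_field_derivative \<Phi>' x) (at x)" "\<And>x. \<Phi>' x > 0"
  shows "strict_mono \<Phi>"
  by (rule strict_monoI, rule DERIV_pos_imp_increasing) (use assms in blast)+

text \<open>In the application, \<open>F\<close> is \<open>f\<^sup>2\<close> as a function of
  \<open>\<theta>\<close>, and \<open>\<Phi>\<close> is an antiderivative of the non-escape weight
  in this variable; \<open>surj\<Phi>\<close> is then what the divergence of both integrals
  gives.\<close>

locale newton_equation =
  fixes F F1 F2 \<Phi> :: "real \<Rightarrow> real" and s L \<theta>1 :: real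
  assumes F_pos: "F x > 0" and dF: "(F has_field_derivative F1 x) (at x)"
    and dF1: "(F1 has_field_derivative F2 x) (at x)" and cF2: "continuous_on UNIV F2"
    and d\<Phi>: "(\<Phi> has_field_derivative 1 / sqrt (1 + F x)) (at x)" and surj\<Phi>: "\<Phi> ` UNIV = UNIV"
    and s: "s \<ge> 0" and L: "L > 0"
begin

text \<open>Forced by the energy relation \<open>w\<^sup>2 = s + D w * F \<theta>1\<close> at the
  initial time; either sign occurs.\<close>

definition D :: "real \<Rightarrow> real" where "D w = (w\<^sup>2 - s) / F \<theta>1"

lemma mono\<Phi>: "strict_mono \<Phi>"
  by (rule strict_mono_of_pos_derivative[OF d\<Phi>]) (simp add: F_pos add_pos_pos)

text \<open>The equation is \<open>\<theta>'' = D w * F1 \<theta> / 2\<close> with \<open>\<theta> 0 = \<theta>1\<close>, \<open>\<theta>' 0 = w\<close>. Since the energy is conserved,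
  \<open>\<Phi> \<circ> \<theta>\<close> is Lipschitz, so that \<open>\<theta>\<close> stays within bounds \<open>lo\<close>, \<open>hi\<close> which only depend on a bound
  of \<open>w\<close>. Hence \<open>F1\<close> may be replaced by a globally Lipschitz function.\<close>

lemma a_priori_bound:
  assumes lohi: "lo < \<theta>1" "\<theta>1 < hi" and R: "R \<ge> 0"
    and \<Phi>lo: "\<Phi> lo \<le> \<Phi> \<theta>1 - R * c - 1" and \<Phi>hi: "\<Phi> hi \<ge> \<Phi> \<theta>1 + R * c + 1"
    and G: "\<And>x. lo \<le> x \<Longrightarrow> x \<le> hi \<Longrightarrow> G x = F1 x"
    and d\<theta>: "\<And>r. (\<theta> has_field_derivative \<omega> r) (at r)"
    and d\<omega>: "\<And>r. (\<omega> has_field_derivative D w * G (\<theta> r) / 2) (at r)"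
    and init: "\<theta> 0 = \<theta>1" "\<omega> 0 = w"
    and c: "c \<ge> 0" "s \<le> c\<^sup>2" "D w \<le> c\<^sup>2" and r: "\<bar>r\<bar> \<le> R"
  shows "lo < \<theta> r \<and> \<theta> r < hi"
proof (rule ccontr)
  assume n: "\<not> ?thesis"
  have c\<theta>: "continuous_on A \<theta>" for A using d\<theta> by (meson DERIV_isCont continuous_at_imp_continuous_on)
  \<comment> \<open>Exit times as fractions of \<open>r\<close>, so that both signs of
    \<open>r\<close> are covered. Being closed, \<open>S\<close> has a least element
    \<open>q\<close>; before it, \<open>G\<close> agrees with \<open>F1\<close> and the energy is
    conserved.\<close>
  define S where "S = {p\<in>{0..1}. \<theta> (p * r) \<le> lo \<or> hi \<le> \<theta> (p * r)}"
  have "closed S"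
  proof -
    have "S = {0..1} \<inter> ((\<lambda>p. \<theta> (p * r)) -` ({..lo} \<union> {hi..}))" by (auto simp: S_def)
    moreover have "continuous_on {0..1} (\<lambda>p. \<theta> (p * r))"
      by (intro continuous_on_compose2[OF c\<theta>[of UNIV]] continuous_intros) auto
    from continuous_closed_preimage[OF this, of "{..lo} \<union> {hi..}"]
    have "closed ({0..1} \<inter> ((\<lambda>p. \<theta> (p * r)) -` ({..lo} \<union> {hi..})))" by (simp only: closed_atLeastAtMost closed_Un closed_atMost closed_atLeast)
    ultimately show ?thesis by simp
  qed
  moreover have "bounded S" by (rule bounded_subset[of "{0..1}"]) (auto simp: S_def)
  ultimately have "compact S" by (simp add: compact_eq_bounded_closed)
  moreover have "S \<noteq> {}" using n by (auto simp: S_def not_less intro!: exI[of _ 1])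
  ultimately obtain q where q: "q \<in> S" "\<And>p. p \<in> S \<Longrightarrow> q \<le> p" using compact_attains_inf by metis
  have inside: "lo < \<theta> (p * r) \<and> \<theta> (p * r) < hi" if "0 \<le> p" "p < q" for p
  proof (rule ccontr)
    assume "\<not> ?thesis"
    then have "p \<in> S" using that q(1) by (auto simp: S_def not_less)
    then show False using q(2)[of p] that by simp
  qed
  have q0: "q > 0" using q(1) init lohi by (cases "q = 0") (auto simp: S_def)
  define E where "E p = (\<omega> (p * r))\<^sup>2 - D w * F (\<theta> (p * r))" for p
  have dr: "((\<lambda>p. p * r) has_field_derivative r) (at p)" for p by (auto intro!: derivative_eq_intros)
  have E: "E p = s" if p: "0 \<le> p" "p < q" for p
  proof -
    have "E p = E 0"
    proof (rule has_real_derivative_zero_constant_on[of "{0..<q}" E])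
      fix p assume p: "p \<in> {0..<q}"
      have "(E has_field_derivative 2 * \<omega> (p * r) * (D w * G (\<theta> (p * r)) / 2 * r) - D w * (F1 (\<theta> (p * r)) * (\<omega> (p * r) * r))) (at p)"
        unfolding E_def[abs_def]
        by (auto intro!: derivative_eq_intros DERIV_chain2[OF d\<omega> dr] DERIV_chain2[OF dF DERIV_chain2[OF d\<theta> dr]])
      then show "(E has_field_derivative 0) (at p)" using G inside[of p] p by simp
    qed (use p q0 in auto)
    also have "\<dots> = s" using init F_pos[of \<theta>1] by (simp add: E_def D_def)
    finally show ?thesis .
  qed
  \<comment> \<open>Up to the first exit, \<open>\<Phi> \<circ> \<theta>\<close> changes by at most
    \<open>R * c\<close>, whereas \<open>lo\<close> and \<open>hi\<close> lie at least
    \<open>R * c + 1\<close> away in terms of \<open>\<Phi>\<close>; the excess 1 contradicts the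
    exit.\<close>
  have "\<exists>z>0. z < q \<and> \<Phi> (\<theta> (q * r)) - \<Phi> (\<theta> (0 * r)) = (q - 0) * (1 / sqrt (1 + F (\<theta> (z * r))) * (\<omega> (z * r) * r))"
    by (rule MVT2[OF q0]) (rule DERIV_chain2[OF d\<Phi> DERIV_chain2[OF d\<theta> dr]])
  then obtain z where z: "0 < z" "z < q"
    and eq: "\<Phi> (\<theta> (q * r)) - \<Phi> \<theta>1 = q * (1 / sqrt (1 + F (\<theta> (z * r))) * (\<omega> (z * r) * r))"
    using init by auto
  have Fz: "1 + F (\<theta> (z * r)) > 0" using F_pos by (simp add: add_pos_pos)
  have "(\<omega> (z * r))\<^sup>2 = s + D w * F (\<theta> (z * r))" using E[of z] z by (simp add: E_def)
  also have "\<dots> \<le> c\<^sup>2 * 1 + c\<^sup>2 * F (\<theta> (z * r))"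
    using c F_pos[of "\<theta> (z * r)"] by (intro add_mono mult_right_mono) auto
  also have "\<dots> = (c * sqrt (1 + F (\<theta> (z * r))))\<^sup>2" using Fz by (simp add: power_mult_distrib algebra_simps)
  finally have "\<bar>\<omega> (z * r)\<bar> \<le> c * sqrt (1 + F (\<theta> (z * r)))"
    using c(1) Fz by - (rule power2_le_imp_le, simp_all)
  then have w: "\<bar>\<omega> (z * r)\<bar> / sqrt (1 + F (\<theta> (z * r))) \<le> c" using Fz by (simp add: pos_divide_le_eq)
  have "\<bar>\<Phi> (\<theta> (q * r)) - \<Phi> \<theta>1\<bar> = q * \<bar>r\<bar> * (\<bar>\<omega> (z * r)\<bar> / sqrt (1 + F (\<theta> (z * r))))"
    unfolding eq using q0 Fz by (simp add: abs_mult)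
  also have "\<dots> \<le> (1 * R) * c"
  proof (rule mult_mono[OF _ w])
    have "q \<le> 1" using q(1) by (simp add: S_def)
    then show "q * \<bar>r\<bar> \<le> 1 * R" using r q0 by (intro mult_mono) auto
  qed (use Fz R in auto)
  finally have "\<Phi> lo < \<Phi> (\<theta> (q * r))" "\<Phi> (\<theta> (q * r)) < \<Phi> hi" using \<Phi>lo \<Phi>hi by auto
  then have "lo < \<theta> (q * r)" "\<theta> (q * r) < hi" using mono\<Phi> by (auto simp: strict_mono_less)
  then show False using q(1) by (auto simp: S_def)
qed

text \<open>Shooting with initial velocities \<open>w\<close> between \<open>-W\<close> and
  \<open>W\<close>. For the two extreme velocities the motion is so fast that at \<open>L\<close> it
  has reached or passed \<open>\<theta>2\<close> upwards and downwards, respectively; by continuous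
  dependence, some velocity in between hits \<open>\<theta>2\<close>.\<close>

lemma boundary_value_problem:
  "\<exists>\<theta> \<omega> d. \<theta> 0 = \<theta>1 \<and> \<theta> L = \<theta>2 \<and> (\<forall>r. \<bar>r\<bar> < L + 1 \<longrightarrow>
     (\<theta> has_field_derivative \<omega> r) (at r) \<and> (\<omega> has_field_derivative d * F1 (\<theta> r) / 2) (at r) \<and>
     (\<omega> r)\<^sup>2 = s + d * F (\<theta> r))"
proof -
  have cF: "continuous_on A F" and cF1: "continuous_on A F1" for A
    using dF dF1 by (meson DERIV_isCont continuous_at_imp_continuous_on)+
  define I where "I = {min \<theta>1 \<theta>2..max \<theta>1 \<theta>2}"
  have "compact I" "I \<noteq> {}" by (auto simp: I_def)
  then obtain x0 where x0: "x0 \<in> I" "\<And>x. x \<in> I \<Longrightarrow> F x0 \<le> F x"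
    using continuous_attains_inf[of I F] cF[of I] by blast
  define m where "m = F x0"
  have m: "m > 0" "\<And>x. x \<in> I \<Longrightarrow> m \<le> F x" using x0 F_pos by (auto simp: m_def)
  \<comment> \<open>By the energy relation, \<open>\<omega>\<^sup>2 \<ge> D0 * m\<close> between
    \<open>\<theta>1\<close> and \<open>\<theta>2\<close>, which is fast enough to cover their
    distance within \<open>L\<close>. The summand 1 keeps \<open>D0\<close> positive if they
    coincide.\<close>
  define D0 where "D0 = (\<theta>2 - \<theta>1)\<^sup>2 / (L\<^sup>2 * m) + 1"
  have D0: "D0 > 0" using m(1) L by (simp add: D0_def add_nonneg_pos)
  define W where "W = sqrt (s + D0 * F \<theta>1)"
  have W2: "W\<^sup>2 = s + D0 * F \<theta>1" and W0: "W > 0"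
    using s D0 F_pos[of \<theta>1] by (simp_all add: W_def add_nonneg_pos)
  have DW: "D W = D0" "D (- W) = D0" using W2 F_pos[of \<theta>1] by (simp_all add: D_def)
  \<comment> \<open>Clamping: \<open>ode_with_parameter\<close> ranges over all real parameters with
    uniform bounds, but only velocities with \<open>\<bar>w\<bar> \<le> W\<close> are of
    interest.\<close>
  define cl where "cl w = max (- W) (min W w)" for w
  have cl: "\<bar>cl w\<bar> \<le> W" and cl_id: "\<bar>w\<bar> \<le> W \<Longrightarrow> cl w = w" for w using W0 by (auto simp: cl_def)
  define Dm where "Dm = (W\<^sup>2 + s) / F \<theta>1"
  have Dm: "Dm \<ge> 0" using s F_pos[of \<theta>1] by (simp add: Dm_def)
  have D_le: "\<bar>D w\<bar> \<le> Dm" if "\<bar>w\<bar> \<le> W" for w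
  proof -
    have "w\<^sup>2 \<le> W\<^sup>2" using that by (metis abs_le_square_iff abs_of_pos W0)
    then have "\<bar>w\<^sup>2 - s\<bar> \<le> W\<^sup>2 + s" using s by (simp add: abs_le_iff)
    then show ?thesis using F_pos[of \<theta>1] by (simp add: D_def Dm_def divide_right_mono)
  qed
  \<comment> \<open>\<open>c\<^sup>2\<close> bounds both \<open>s\<close> and \<open>D w\<close>, so
    that the squared velocity \<open>s + D w * F\<close> is at most
    \<open>c\<^sup>2 * (1 + F)\<close>.\<close>
  define c where "c = sqrt (max s Dm)"
  have c: "c \<ge> 0" "s \<le> c\<^sup>2" "Dm \<le> c\<^sup>2" using s Dm by (auto simp: c_def)
  \<comment> \<open>Larger than \<open>L\<close>, as the equation is to hold on a neighbourhood of
    the end points.\<close>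
  define R where "R = L + 1"
  have R: "R > 0" using L by (simp add: R_def)
  obtain lo where lo: "\<Phi> lo = \<Phi> \<theta>1 - R * c - 1" using surj\<Phi> by (metis UNIV_I imageE)
  obtain hi where hi: "\<Phi> hi = \<Phi> \<theta>1 + R * c + 1" using surj\<Phi> by (metis UNIV_I imageE)
  have "R * c \<ge> 0" using R c(1) by simp
  then have "\<Phi> lo < \<Phi> \<theta>1" "\<Phi> \<theta>1 < \<Phi> hi" using lo hi by linarith+
  then have lohi: "lo < \<theta>1" "\<theta>1 < hi" using mono\<Phi> by (auto simp: strict_mono_less)
  \<comment> \<open>\<open>F1\<close> with its argument clamped to \<open>{lo..hi}\<close>; the
    global Lipschitz constant comes from a bound of \<open>F2\<close> on this compact
    interval.\<close>
  define G where "G x = F1 (max lo (min hi x))" for x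
  have G: "G x = F1 x" if "lo \<le> x" "x \<le> hi" for x using that by (simp add: G_def)
  obtain B where B: "\<And>x. x \<in> {lo..hi} \<Longrightarrow> \<bar>F2 x\<bar> \<le> B" and B0: "B \<ge> 0"
  proof -
    have "compact (F2 ` {lo..hi})"
      using compact_continuous_image[OF continuous_on_subset[OF cF2]] by blast
    then obtain B where B: "\<And>x. x \<in> {lo..hi} \<Longrightarrow> norm (F2 x) \<le> B"
      using compact_imp_bounded bounded_iff by (metis imageI)
    have "lo \<in> {lo..hi}" using lohi by simp
    from order_trans[OF norm_ge_zero B[OF this]] have "B \<ge> 0" .
    then show ?thesis using that[of B] B by simp
  qed
  have lipG: "\<bar>G x - G y\<bar> \<le> B * \<bar>x - y\<bar>" for x y
  proof -
    define a where "a = max lo (min hi x)"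
    define b where "b = max lo (min hi y)"
    have ab: "a \<in> {lo..hi}" "b \<in> {lo..hi}" "\<bar>a - b\<bar> \<le> \<bar>x - y\<bar>" using lohi by (auto simp: a_def b_def)
    have "norm (F1 a - F1 b) \<le> B * norm (a - b)"
      by (rule field_differentiable_bound[of "{lo..hi}" F1 F2])
         (use ab B dF1 in \<open>auto intro: has_field_derivative_at_within\<close>)
    also have "\<dots> \<le> B * \<bar>x - y\<bar>" using ab B0 by (simp add: mult_left_mono)
    finally show ?thesis by (simp add: G_def a_def b_def)
  qed
  have cG: "continuous_on A G" for A unfolding G_def[abs_def]
    by (intro continuous_on_compose2[OF cF1[of UNIV]] continuous_intros) auto
  define X :: "real \<Rightarrow> real \<times> real \<Rightarrow> real \<times> real" where "X w z = (snd z, D (cl w) * G (fst z) / 2)" for w z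
  have cX: "continuous_on UNIV (\<lambda>p. X (fst p) (snd p))"
    unfolding X_def D_def cl_def using F_pos[of \<theta>1]
    by (auto intro!: continuous_intros continuous_on_compose2[OF cG[of UNIV]])
  have np: "norm (fst p) \<le> norm p" "norm (snd p) \<le> norm p" for p :: "real \<times> real"
    by (metis norm_fst_le prod.collapse) (metis norm_snd_le prod.collapse)
  have lipX: "norm (X w z - X w z') \<le> (1 + Dm * B) * norm (z - z')" for w z z'
  proof -
    have "norm (X w z - X w z') \<le> \<bar>snd z - snd z'\<bar> + \<bar>D (cl w) * G (fst z) / 2 - D (cl w) * G (fst z') / 2\<bar>"
      unfolding X_def using norm_Pair_le[of "snd z - snd z'" "D (cl w) * G (fst z) / 2 - D (cl w) * G (fst z') / 2"] by simp
    also have "\<dots> = \<bar>snd (z - z')\<bar> + \<bar>D (cl w)\<bar> * \<bar>G (fst z) - G (fst z')\<bar> / 2"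
      by (simp add: abs_mult flip: right_diff_distrib diff_divide_distrib)
    also have "\<dots> \<le> norm (z - z') + Dm * (B * norm (z - z'))"
    proof (rule add_mono)
      show "\<bar>snd (z - z')\<bar> \<le> norm (z - z')" using np(2)[of "z - z'"] by simp
      have "\<bar>fst z - fst z'\<bar> \<le> norm (z - z')" using np(1)[of "z - z'"] by simp
      then have "\<bar>G (fst z) - G (fst z')\<bar> \<le> B * norm (z - z')"
        using lipG[of "fst z" "fst z'"] B0 by (meson mult_left_mono order_trans)
      then have "\<bar>D (cl w)\<bar> * \<bar>G (fst z) - G (fst z')\<bar> \<le> Dm * (B * norm (z - z'))"
        using D_le[OF cl] Dm by (intro mult_mono) auto
      then show "\<bar>D (cl w)\<bar> * \<bar>G (fst z) - G (fst z')\<bar> / 2 \<le> Dm * (B * norm (z - z'))"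
        using mult_nonneg_nonneg[of "\<bar>D (cl w)\<bar>" "\<bar>G (fst z) - G (fst z')\<bar>"] by linarith
    qed
    finally show ?thesis by (simp add: algebra_simps)
  qed
  define C where "C = Dm * \<bar>G 0\<bar> + \<bar>\<theta>1\<bar> + W"
  obtain u where cu: "continuous_on UNIV (\<lambda>p. u (fst p) (snd p))" and u0: "\<And>w. u w 0 = (\<theta>1, cl w)"
    and du: "\<And>w r. (u w has_vector_derivative X w (u w r)) (at r)"
  proof (rule ode_with_parameter[OF cX lipX, of C "\<lambda>w. (\<theta>1, cl w)"])
    show "1 + Dm * B > 0" using Dm B0 by (simp add: add_pos_nonneg)
    show "norm (X w 0) \<le> C" for w
    proof -
      have "norm (X w 0) = \<bar>D (cl w)\<bar> * \<bar>G 0\<bar> / 2" by (simp add: X_def abs_mult)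
      also have "\<dots> \<le> Dm * \<bar>G 0\<bar>"
        using mult_right_mono[OF D_le[OF cl], of "\<bar>G 0\<bar>" w] mult_nonneg_nonneg[OF Dm abs_ge_zero, of "G 0"] by linarith
      finally show ?thesis using W0 by (simp add: C_def)
    qed
    show "continuous_on UNIV (\<lambda>w. (\<theta>1, cl w))" unfolding cl_def by (intro continuous_intros)
    show "norm (\<theta>1, cl w) \<le> C" for w
      using norm_Pair_le[of \<theta>1 "cl w"] cl[of w] Dm by (simp add: C_def) (smt (verit) mult_nonneg_nonneg abs_ge_zero)
  qed (rule that)
  define \<theta> where "\<theta> w r = fst (u w r)" for w r
  define \<omega> where "\<omega> w r = snd (u w r)" for w r
  have d\<theta>: "(\<theta> w has_field_derivative \<omega> w r) (at r)" for w r
    using bounded_linear.has_vector_derivative[OF bounded_linear_fst du[of w r]]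
    by (simp add: \<theta>_def[abs_def] \<omega>_def X_def has_real_derivative_iff_has_vector_derivative)
  have d\<omega>: "(\<omega> w has_field_derivative D (cl w) * G (\<theta> w r) / 2) (at r)" for w r
    using bounded_linear.has_vector_derivative[OF bounded_linear_snd du[of w r]]
    by (simp add: \<theta>_def \<omega>_def[abs_def] X_def has_real_derivative_iff_has_vector_derivative)
  have inside: "lo < \<theta> w r \<and> \<theta> w r < hi" if "\<bar>w\<bar> \<le> W" "\<bar>r\<bar> \<le> R" for w r
  proof (rule a_priori_bound[OF lohi _ _ _ G d\<theta> _ _ _ c(1,2) _ that(2)])
    show "(\<omega> w has_field_derivative D w * G (\<theta> w r) / 2) (at r)" for r using d\<omega>[of w r] cl_id[OF that(1)] by simp
    show "D w \<le> c\<^sup>2" using D_le[OF that(1)] c(3) by linarith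
  qed (use R lo hi u0 cl_id[OF that(1)] in \<open>auto simp: \<theta>_def \<omega>_def\<close>)
  have energy: "(\<omega> w r)\<^sup>2 = s + D w * F (\<theta> w r)" if w: "\<bar>w\<bar> \<le> W" and r: "\<bar>r\<bar> \<le> R" for w r
  proof -
    have "(\<omega> w r)\<^sup>2 - D w * F (\<theta> w r) = (\<omega> w 0)\<^sup>2 - D w * F (\<theta> w 0)"
    proof (rule has_real_derivative_zero_constant_on[of "{-R..R}" "\<lambda>r. (\<omega> w r)\<^sup>2 - D w * F (\<theta> w r)"])
      fix r assume r: "r \<in> {-R..R}"
      have "((\<lambda>r. (\<omega> w r)\<^sup>2 - D w * F (\<theta> w r)) has_field_derivative
          2 * \<omega> w r * (D (cl w) * G (\<theta> w r) / 2) - D w * (F1 (\<theta> w r) * \<omega> w r)) (at r)"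
        by (auto intro!: derivative_eq_intros d\<omega> DERIV_chain2[OF dF d\<theta>])
      then show "((\<lambda>r. (\<omega> w r)\<^sup>2 - D w * F (\<theta> w r)) has_field_derivative 0) (at r)"
        using G inside[OF w, of r] r cl_id[OF w] by (simp add: abs_le_iff)
    qed (use r R in auto)
    then show ?thesis using F_pos[of \<theta>1] u0[of w] cl_id[OF w] by (simp add: \<theta>_def \<omega>_def D_def)
  qed
  \<comment> \<open>The velocity has no zero before \<open>L\<close>, since its square is at least
    \<open>D0 * F > 0\<close>; so the motion is monotone. If it fell short of
    \<open>\<theta>2\<close>, it would stay in \<open>I\<close>, where by the choice of
    \<open>D0\<close> it is fast enough to arrive.\<close>
  have reach: "e * \<theta>2 \<le> e * \<theta> (e * W) L" if e: "e = 1 \<or> e = - 1" for e :: real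
  proof (rule ccontr)
    assume n: "\<not> ?thesis"
    have w: "\<bar>e * W\<bar> \<le> W" "D (e * W) = D0" using e W0 DW by auto
    have pos: "e * \<omega> (e * W) r > 0" if r: "0 \<le> r" "r \<le> L" for r
    proof (rule ccontr)
      assume "\<not> e * \<omega> (e * W) r > 0"
      moreover have "e * \<omega> (e * W) 0 = W" using u0[of "e * W"] cl_id[OF w(1)] e by (auto simp: \<omega>_def)
      moreover have "continuous_on {0..r} (\<lambda>r. e * \<omega> (e * W) r)"
        using d\<omega> by (intro continuous_intros continuous_at_imp_continuous_on ballI) (blast intro: DERIV_isCont)
      ultimately obtain z where z: "0 \<le> z" "z \<le> r" "e * \<omega> (e * W) z = 0"
        using IVT2'[of "\<lambda>r. e * \<omega> (e * W) r" r 0 0] r W0 by auto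
      have "(\<omega> (e * W) z)\<^sup>2 > 0"
        using energy[OF w(1), of z] z r s D0 F_pos[of "\<theta> (e * W) z"] w(2) by (simp add: R_def add_nonneg_pos)
      then show False using z(3) e by auto
    qed
    have mono: "e * \<theta> (e * W) r \<le> e * \<theta> (e * W) r'" if "0 \<le> r" "r \<le> r'" "r' \<le> L" for r r'
      by (rule DERIV_nonneg_imp_nondecreasing[OF that(2)])
         (use that pos in \<open>auto intro!: exI DERIV_cmult[OF d\<theta>] less_imp_le\<close>)
    have \<theta>0: "\<theta> (e * W) 0 = \<theta>1" using u0 by (simp add: \<theta>_def)
    have inI: "\<theta> (e * W) r \<in> I" if "0 \<le> r" "r \<le> L" for r
      using mono[of 0 r] mono[of r L] that n \<theta>0 e by (auto simp: I_def)
    have "\<exists>z>0. z < L \<and> \<theta> (e * W) L - \<theta> (e * W) 0 = (L - 0) * \<omega> (e * W) z"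
      by (rule MVT2[OF L]) (rule d\<theta>)
    then obtain z where z: "0 < z" "z < L" "\<theta> (e * W) L - \<theta>1 = L * \<omega> (e * W) z" using \<theta>0 by auto
    have "(\<theta>2 - \<theta>1)\<^sup>2 = (D0 - 1) * (L\<^sup>2 * m)" using m(1) L by (simp add: D0_def)
    also have "\<dots> \<le> D0 * (L\<^sup>2 * m)" using m(1) by (intro mult_right_mono) auto
    also have "\<dots> = L\<^sup>2 * (D0 * m)" by simp
    also have "\<dots> \<le> L\<^sup>2 * (\<omega> (e * W) z)\<^sup>2"
    proof (rule mult_left_mono)
      have "D0 * m \<le> D0 * F (\<theta> (e * W) z)" using m(2)[OF inI[of z]] z D0 by simp
      then show "D0 * m \<le> (\<omega> (e * W) z)\<^sup>2" using energy[OF w(1), of z] z s w(2) L by (simp add: R_def)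
    qed simp
    also have "\<dots> = (\<theta> (e * W) L - \<theta>1)\<^sup>2" unfolding z(3) by (simp add: power_mult_distrib)
    finally have "\<bar>\<theta>2 - \<theta>1\<bar> \<le> \<bar>\<theta> (e * W) L - \<theta>1\<bar>" by (simp add: abs_le_square_iff)
    then show False using n mono[of 0 L] \<theta>0 L e by auto
  qed
  have "continuous_on {-W..W} (\<lambda>w. \<theta> w L)"
    unfolding \<theta>_def by (intro continuous_on_fst continuous_on_compose2[OF cu, of _ "\<lambda>w. (w, L)", simplified] continuous_intros)
  then obtain w where w: "-W \<le> w" "w \<le> W" "\<theta> w L = \<theta>2"
    using IVT'[of "\<lambda>w. \<theta> w L" "-W" \<theta>2 W] reach[of 1] reach[of "-1"] W0 by auto
  then have wW: "\<bar>w\<bar> \<le> W" by simp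
  show ?thesis
  proof (rule exI[of _ "\<theta> w"], rule exI[of _ "\<omega> w"], rule exI[of _ "D w"], intro conjI allI impI)
    show "\<theta> w 0 = \<theta>1" using u0 by (simp add: \<theta>_def)
    show "\<theta> w L = \<theta>2" by (rule w(3))
    fix r assume "\<bar>r\<bar> < L + 1"
    then have r: "\<bar>r\<bar> \<le> R" by (simp add: R_def)
    show "(\<theta> w has_field_derivative \<omega> w r) (at r)" by (rule d\<theta>)
    show "(\<omega> w has_field_derivative D w * F1 (\<theta> w r) / 2) (at r)"
      using d\<omega>[of w r] cl_id[OF wW] G inside[OF wW r] by simp
    show "(\<omega> w r)\<^sup>2 = s + D w * F (\<theta> w r)" by (rule energy[OF wW r])
  qed
qed

end

section \<open>Maximal extension of geodesics\<close>

text \<open>Apart from the shape of the domain, being a geodesic is a property of germs. This glues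
  the members of a chain of extensions.\<close>

lemma geodesic_locally:
  assumes M: "connection_mfd M" and J: "open J" "connected J" "J \<noteq> {}"
    and loc: "\<And>t. t \<in> J \<Longrightarrow> \<exists>\<sigma> K. geodesic M \<sigma> K \<and> t \<in> K \<and> K \<subseteq> J \<and> (\<forall>r\<in>K. \<sigma> r = \<gamma> r)"
  shows "geodesic M \<gamma> J"
proof -
  have pt: "isCont \<gamma> t \<and> \<gamma> t \<in> points M \<and>
     (\<forall>i\<in>idx M. \<gamma> t \<in> patch M i \<longrightarrow> coord M i (\<gamma> t) \<in> chart_image M i \<and>
        ((\<lambda>t. coord M i (\<gamma> t)) has_vector_derivative velocity M \<gamma> i t) (at t) \<and>
       (velocity M \<gamma> i has_vector_derivative - christoffel M i (coord M i (\<gamma> t)) (velocity M \<gamma> i t) (velocity M \<gamma> i t)) (at t))"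
    if tJ: "t \<in> J" for t
  proof -
    obtain \<sigma> K where geo: "geodesic M \<sigma> K" and t: "t \<in> K" and eq: "\<And>r. r \<in> K \<Longrightarrow> \<sigma> r = \<gamma> r"
      using loc[OF tJ] by blast
    have K: "open K" "continuous_on K \<sigma>" "\<sigma> ` K \<subseteq> points M" using geo by (auto simp: geodesic_def)
    have "continuous_on K \<gamma>" by (rule continuous_on_eq[OF K(2)]) (rule eq)
    then have "isCont \<gamma> t" using K(1) t continuous_on_eq_continuous_at by blast
    moreover have "\<gamma> t \<in> points M" using subsetD[OF K(3) imageI[OF t]] unfolding eq[OF t] .
    moreover have "coord M i (\<gamma> t) \<in> chart_image M i \<and>
        ((\<lambda>t. coord M i (\<gamma> t)) has_vector_derivative velocity M \<gamma> i t) (at t) \<and>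
       (velocity M \<gamma> i has_vector_derivative - christoffel M i (coord M i (\<gamma> t)) (velocity M \<gamma> i t) (velocity M \<gamma> i t)) (at t)"
      if i: "i \<in> idx M" and p: "\<gamma> t \<in> patch M i" for i
    proof -
      interpret connection_chart "chart_image M i" "christoffel M i"
        using M i by (auto simp: connection_mfd_def)
      have v: "velocity M \<gamma> i r = velocity M \<sigma> i r" if "r \<in> K" for r
        unfolding velocity_def
      proof (rule vector_derivative_cong_eq)
        show "\<forall>\<^sub>F x in nhds r. x \<in> UNIV \<longrightarrow> (coord M i \<circ> \<gamma>) x = (coord M i \<circ> \<sigma>) x"
          unfolding eventually_nhds using K(1) that eq by (intro exI[of _ K]) auto
      qed auto
      have g: "coord M i (\<sigma> t) \<in> chart_image M i"
        "((\<lambda>t. coord M i (\<sigma> t)) has_vector_derivative velocity M \<sigma> i t) (at t)"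
        "(velocity M \<sigma> i has_vector_derivative - christoffel M i (coord M i (\<sigma> t)) (velocity M \<sigma> i t) (velocity M \<sigma> i t)) (at t)"
      proof -
        have "\<forall>i\<in>idx M. connection_chart.geodesic_on (chart_image M i) (christoffel M i)
          (\<lambda>t. coord M i (\<sigma> t)) (velocity M \<sigma> i) (times_in M \<sigma> K i)"
          using geo unfolding geodesic_iff[OF M] by (elim conjE)
        from bspec[OF this i] have "geodesic_on (\<lambda>t. coord M i (\<sigma> t)) (velocity M \<sigma> i) (times_in M \<sigma> K i)" .
        moreover have "t \<in> times_in M \<sigma> K i" using t p eq[OF t] by (simp add: times_in_def)
        ultimately show "coord M i (\<sigma> t) \<in> chart_image M i"
          "((\<lambda>t. coord M i (\<sigma> t)) has_vector_derivative velocity M \<sigma> i t) (at t)"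
          "(velocity M \<sigma> i has_vector_derivative - christoffel M i (coord M i (\<sigma> t)) (velocity M \<sigma> i t) (velocity M \<sigma> i t)) (at t)"
          unfolding geodesic_on_def by blast+
      qed
      have "((\<lambda>t. coord M i (\<gamma> t)) has_vector_derivative velocity M \<sigma> i t) (at t)"
        by (rule has_vector_derivative_transform_within_open[OF g(2) K(1) t]) (simp add: eq)
      moreover have "(velocity M \<gamma> i has_vector_derivative - christoffel M i (coord M i (\<sigma> t)) (velocity M \<sigma> i t) (velocity M \<sigma> i t)) (at t)"
        by (rule has_vector_derivative_transform_within_open[OF g(3) K(1) t]) (simp add: v)
      ultimately show ?thesis using g(1) v[OF t] eq[OF t] by simp
    qed
    ultimately show ?thesis by blast
  qed
  show ?thesis
  proof (rule geodesicI(1)[OF M J])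
    show "continuous_on J \<gamma>" using pt by (intro continuous_at_imp_continuous_on) blast
    show "\<gamma> ` J \<subseteq> points M" using pt by blast
    fix i assume i: "i \<in> idx M"
    interpret connection_chart "chart_image M i" "christoffel M i"
      using M i by (auto simp: connection_mfd_def)
    show "geodesic_on (\<lambda>t. coord M i (\<gamma> t)) (velocity M \<gamma> i) (times_in M \<gamma> J i)"
      unfolding geodesic_on_def times_in_def using pt i by blast
  qed
qed

text \<open>Zorn's lemma, applied to graphs instead of pairs of a curve and a domain: inclusion is
  then the extension order, and the values outside the domain do not interfere.\<close>

lemma geodesic_extends_to_inextendible:
  assumes M: "connection_mfd M" and geo: "geodesic M \<gamma> J"
  obtains \<gamma>' J' where "inextendible_geodesic M \<gamma>' J'" "J \<subseteq> J'" "\<And>t. t \<in> J \<Longrightarrow> \<gamma>' t = \<gamma> t"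
proof -
  define gr where "gr \<sigma> K = (\<lambda>t. (t, \<sigma> t)) ` K" for \<sigma> :: "real \<Rightarrow> 'b" and K :: "real set"
  have gr_mem: "(t, p) \<in> gr \<sigma> K \<longleftrightarrow> t \<in> K \<and> p = \<sigma> t" for t p \<sigma> K by (auto simp: gr_def)
  define A where "A = {gr \<sigma> K | \<sigma> K. geodesic M \<sigma> K \<and> J \<subseteq> K \<and> (\<forall>t\<in>J. \<sigma> t = \<gamma> t)}"
  obtain t0 where t0: "t0 \<in> J" using geo by (auto simp: geodesic_def)
  have "\<exists>X\<in>A. \<forall>Y\<in>A. X \<subseteq> Y \<longrightarrow> Y = X"
  proof (rule subset_Zorn_nonempty)
    show "A \<noteq> {}" using geo by (auto simp: A_def)
    fix C assume C: "C \<noteq> {}" "subset.chain A C"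
    then have CA: "C \<subseteq> A" and ch: "\<And>X Y. X \<in> C \<Longrightarrow> Y \<in> C \<Longrightarrow> X \<subseteq> Y \<or> Y \<subseteq> X"
      by (auto simp: subset_chain_def)
    define K where "K = fst ` \<Union>C"
    define \<sigma> where "\<sigma> t = (SOME p. (t, p) \<in> \<Union>C)" for t
    \<comment> \<open>Any two members of the chain are comparable, so that the union of the graphs
      is again a graph.\<close>
    have func: "p = q" if pq: "(t, p) \<in> \<Union>C" "(t, q) \<in> \<Union>C" for t p q
    proof -
      obtain X Y where XY: "X \<in> C" "(t, p) \<in> X" "Y \<in> C" "(t, q) \<in> Y" using pq by blast
      then obtain Z where "Z \<in> C" "(t, p) \<in> Z" "(t, q) \<in> Z" using ch by blast
      moreover obtain \<sigma>' K' where "Z = gr \<sigma>' K'" using \<open>Z \<in> C\<close> CA by (auto simp: A_def)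
      ultimately show ?thesis by (simp add: gr_mem)
    qed
    have \<sigma>: "\<sigma> t = p" if "(t, p) \<in> \<Union>C" for t p
      unfolding \<sigma>_def using func[OF _ that] someI[of "\<lambda>p. (t, p) \<in> \<Union>C", OF that] by blast
    have U: "\<Union>C = gr \<sigma> K"
    proof (intro set_eqI iffI)
      fix z assume "z \<in> \<Union>C"
      then show "z \<in> gr \<sigma> K" using \<sigma>[of "fst z" "snd z"] by (cases z) (force simp: gr_mem K_def)
    next
      fix z assume "z \<in> gr \<sigma> K"
      then obtain t where t: "z = (t, \<sigma> t)" "t \<in> K" by (auto simp: gr_def)
      then obtain p where "(t, p) \<in> \<Union>C" by (force simp: K_def)
      then show "z \<in> \<Union>C" using \<sigma> t by metis
    qed
    have mem: "\<exists>\<sigma>' K'. X = gr \<sigma>' K' \<and> geodesic M \<sigma>' K' \<and> J \<subseteq> K' \<and> (\<forall>t\<in>J. \<sigma>' t = \<gamma> t) \<and>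
        K' \<subseteq> K \<and> (\<forall>t\<in>K'. \<sigma>' t = \<sigma> t)" if X: "X \<in> C" for X
    proof -
      obtain \<sigma>' K' where X': "X = gr \<sigma>' K'" "geodesic M \<sigma>' K'" "J \<subseteq> K'" "\<forall>t\<in>J. \<sigma>' t = \<gamma> t"
        using X CA by (auto simp: A_def)
      moreover have "t \<in> K \<and> \<sigma>' t = \<sigma> t" if "t \<in> K'" for t
      proof -
        have "(t, \<sigma>' t) \<in> \<Union>C" using X X'(1) that gr_mem by blast
        then have "(t, \<sigma>' t) \<in> gr \<sigma> K" using U by simp
        then show ?thesis by (simp add: gr_mem)
      qed
      ultimately show ?thesis by blast
    qed
    then obtain Kf \<sigma>f where Kf: "\<And>X. X \<in> C \<Longrightarrow> X = gr (\<sigma>f X) (Kf X) \<and> geodesic M (\<sigma>f X) (Kf X) \<and> J \<subseteq> Kf X \<and>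
       (\<forall>t\<in>J. \<sigma>f X t = \<gamma> t) \<and> Kf X \<subseteq> K \<and> (\<forall>t\<in>Kf X. \<sigma>f X t = \<sigma> t)" by metis
    have KU: "K = (\<Union>X\<in>C. Kf X)"
    proof (intro set_eqI iffI)
      fix t assume "t \<in> K"
      then obtain X p where X: "X \<in> C" "(t, p) \<in> X" unfolding K_def by auto
      then have "(t, p) \<in> gr (\<sigma>f X) (Kf X)" using Kf[OF X(1)] by simp
      then show "t \<in> (\<Union>X\<in>C. Kf X)" using X(1) by (auto simp: gr_mem)
    next
      fix t assume "t \<in> (\<Union>X\<in>C. Kf X)"
      then obtain X where "X \<in> C" "t \<in> Kf X" by blast
      then show "t \<in> K" using Kf[of X] by blast
    qed
    have "geodesic M \<sigma> K"
    proof (rule geodesic_locally[OF M])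
      show "open K" unfolding KU using Kf by (intro open_UN) (auto simp: geodesic_def)
      have "connected (\<Union> (Kf ` C))"
      proof (rule connected_Union)
        show "connected S" if "S \<in> Kf ` C" for S using that Kf by (auto simp: geodesic_def)
        have "t0 \<in> \<Inter> (Kf ` C)" using Kf t0 by blast
        then show "\<Inter> (Kf ` C) \<noteq> {}" by blast
      qed
      then show "connected K" by (simp add: KU)
      show "K \<noteq> {}" using C(1) Kf t0 by (auto simp: KU)
      fix t assume "t \<in> K"
      then obtain X where "X \<in> C" "t \<in> Kf X" by (auto simp: KU)
      then show "\<exists>\<sigma>' K'. geodesic M \<sigma>' K' \<and> t \<in> K' \<and> K' \<subseteq> K \<and> (\<forall>r\<in>K'. \<sigma>' r = \<sigma> r)"
        using Kf by blast
    qed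
    moreover have "J \<subseteq> K"
    proof -
      obtain X where "X \<in> C" using C(1) by blast
      then show ?thesis using Kf[of X] by blast
    qed
    moreover have "\<forall>t\<in>J. \<sigma> t = \<gamma> t"
    proof
      fix t assume t: "t \<in> J"
      obtain X where "X \<in> C" using C(1) by blast
      then show "\<sigma> t = \<gamma> t" using Kf[of X] t by (metis subsetD)
    qed
    ultimately show "\<Union>C \<in> A" unfolding U A_def by blast
  qed
  then obtain X where X: "X \<in> A" "\<And>Y. Y \<in> A \<Longrightarrow> X \<subseteq> Y \<Longrightarrow> Y = X" by blast
  then obtain \<gamma>' J' where g: "X = gr \<gamma>' J'" "geodesic M \<gamma>' J'" "J \<subseteq> J'" "\<forall>t\<in>J. \<gamma>' t = \<gamma> t"
    by (auto simp: A_def)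
  have "K = J'" if "geodesic M \<sigma> K" "J' \<subseteq> K" "\<forall>t\<in>J'. \<sigma> t = \<gamma>' t" for \<sigma> K
  proof -
    have "gr \<sigma> K \<in> A" unfolding A_def using that g by (smt (verit) mem_Collect_eq subset_iff)
    moreover have "X \<subseteq> gr \<sigma> K" unfolding g(1) using that by (auto simp: gr_def)
    ultimately have eq: "gr \<sigma> K = gr \<gamma>' J'" using X(2) g(1) by simp
    have "fst ` gr \<sigma> K = K" for \<sigma> :: "real \<Rightarrow> 'b" and K by (force simp: gr_def)
    then show ?thesis using eq by metis
  qed
  then have "inextendible_geodesic M \<gamma>' J'" unfolding inextendible_geodesic_def using g(2) by blast
  then show ?thesis using that g(3,4) by blast
qed

section \<open>Divergent integrals\<close>

text \<open>If all increments of \<open>Q\<close> were at most \<open>B\<close>, so would be the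
  integrals over an increasing sequence of compact intervals; by continuity from below of the
  measure with density \<open>q\<close>, they converge to the integral over the whole
  interval.\<close>

lemma infinite_integral_imp_unbounded:
  fixes q Q :: "real \<Rightarrow> real" and a b :: ereal
  assumes "a < b" and E: "einterval a b \<subseteq> I" and "open I" and cq: "continuous_on I q"
    and nn: "\<And>y. y \<in> I \<Longrightarrow> 0 \<le> q y" and dQ: "\<And>y. y \<in> I \<Longrightarrow> (Q has_field_derivative q y) (at y)"
    and inf: "(\<integral>\<^sup>+y\<in>einterval a b. ennreal (q y) \<partial>lborel) = \<infinity>"
  shows "\<exists>y\<in>einterval a b. \<exists>z\<in>einterval a b. y < z \<and> Q z - Q y > B"
proof (rule ccontr)
  assume n: "\<not> ?thesis"
  obtain u l :: "nat \<Rightarrow> real" where ul: "einterval a b = (\<Union>i. {l i .. u i})"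
    "incseq u" "decseq l" "\<And>i. l i < u i" "\<And>i. a < l i" "\<And>i. u i < b"
    by (rule einterval_Icc_approximation[OF \<open>a < b\<close>]) (rule that)
  \<comment> \<open>Extended by \<open>0\<close>, so as to be measurable on the whole line and serve
    as a density.\<close>
  define q' where "q' y = q y * indicator I y" for y
  have q'_meas: "q' \<in> borel_measurable borel"
    using borel_measurable_continuous_on_indicator[OF _ cq] \<open>open I\<close>
    by (simp add: q'_def[abs_def] mult.commute)
  define D where "D = density lborel (\<lambda>y. ennreal (q' y))"
  have em: "emeasure D A = (\<integral>\<^sup>+y\<in>A. ennreal (q' y) \<partial>lborel)" if "A \<in> sets borel" for A
    unfolding D_def using q'_meas that by (subst emeasure_density) auto
  have sub: "{l i .. u i} \<subseteq> I" for i using ul(1) E by blast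
  have "emeasure D {l i .. u i} \<le> ennreal B" for i
  proof -
    have "emeasure D {l i .. u i} = (\<integral>\<^sup>+y\<in>{l i .. u i}. ennreal (q' y) \<partial>lborel)" by (rule em) simp
    also have "\<dots> = ennreal (Q (u i) - Q (l i))"
    proof (rule nn_integral_FTC_Icc[OF q'_meas])
      fix y assume y: "y \<in> {l i .. u i}"
      then have "y \<in> I" using sub[of i] by auto
      then show "(Q has_real_derivative q' y) (at y)" "0 \<le> q' y" using dQ nn by (simp_all add: q'_def)
    qed (use ul(4)[of i] in simp)
    also have "\<dots> \<le> ennreal B"
    proof (rule ennreal_leI)
      have "l i \<in> einterval a b" "u i \<in> einterval a b" using ul(1) ul(4)[of i] by force+
      then show "Q (u i) - Q (l i) \<le> B" using n ul(4)[of i] by force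
    qed
    finally show ?thesis .
  qed
  note le_B = this
  have "(SUP i. emeasure D {l i .. u i}) = emeasure D (\<Union>i. {l i .. u i})"
  proof (rule SUP_emeasure_incseq)
    show "range (\<lambda>i. {l i..u i}) \<subseteq> sets D" by (auto simp: D_def)
    show "incseq (\<lambda>i. {l i..u i})"
      using ul(2,3) by (auto simp: incseq_def decseq_def intro: order_trans)
  qed
  then have "emeasure D (einterval a b) = (SUP i. emeasure D {l i .. u i})" unfolding ul(1) by (rule sym)
  also have "\<dots> \<le> ennreal B" by (rule SUP_least) (rule le_B)
  finally have "emeasure D (einterval a b) \<le> ennreal B" .
  moreover have "emeasure D (einterval a b) = (\<integral>\<^sup>+y\<in>einterval a b. ennreal (q y) \<partial>lborel)"
    unfolding em[OF borel_einterval]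
    by (intro nn_integral_cong) (use E in \<open>auto simp: q'_def indicator_def\<close>)
  ultimately show False using inf by (simp add: top_unique)
qed

text \<open>By comparison of derivatives, the increments of \<open>H\<close> dominate
  \<open>\<kappa>\<close> times those of an antiderivative \<open>Q\<close> of the weight.
  Divergence on both sides of \<open>c\<close> makes \<open>H\<close> unbounded in both directions,
  and its image is an interval.\<close>

lemma non_escapingI:
  fixes a b :: ereal and f :: "real \<Rightarrow> real"
  assumes cf: "continuous_on (einterval a b) f" and f_pos: "\<And>y. y \<in> einterval a b \<Longrightarrow> f y > 0"
    and conn: "connected (einterval a b)" and c: "c \<in> einterval a b"
    and inf1: "(\<integral>\<^sup>+\<tau>\<in>einterval a (ereal c). ennreal (1 / (f \<tau>)\<^sup>2 * (1 / (f \<tau>)\<^sup>2 + 1) powr (- 1 / 2)) \<partial>lborel) = \<infinity>"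
    and inf2: "(\<integral>\<^sup>+\<tau>\<in>einterval (ereal c) b. ennreal (1 / (f \<tau>)\<^sup>2 * (1 / (f \<tau>)\<^sup>2 + 1) powr (- 1 / 2)) \<partial>lborel) = \<infinity>"
  shows "non_escaping (einterval a b) f"
  unfolding non_escaping_def
proof (intro allI impI)
  let ?I = "einterval a b"
  define q where "q y = 1 / (f y)\<^sup>2 * (1 / (f y)\<^sup>2 + 1) powr (- 1 / 2)" for y
  fix H H' :: "real \<Rightarrow> real" and \<kappa> :: real
  assume \<kappa>: "0 < \<kappa>" and H: "\<forall>y\<in>?I. (H has_field_derivative H' y) (at y) \<and>
     H' y \<ge> \<kappa> * (1 / (f y)\<^sup>2 * (1 / (f y)\<^sup>2 + 1) powr (- 1 / 2))"
  have p: "1 / (f y)\<^sup>2 + 1 \<noteq> 0" "f y \<noteq> 0" if "y \<in> ?I" for y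
    using f_pos[OF that] add_pos_pos[of "1 / (f y)\<^sup>2" 1] by auto
  have cq: "continuous_on ?I q" unfolding q_def[abs_def]
    by (intro continuous_intros cf) (use p in auto)
  have q0: "0 \<le> q y" for y by (simp add: q_def)
  from open_interval_antiderivative[OF open_einterval conn cq] obtain Q
    where Q: "\<forall>y\<in>?I. (Q has_field_derivative q y) (at y)" ..
  have mono: "\<kappa> * (Q z - Q y) \<le> H z - H y" if yz: "y \<in> ?I" "z \<in> ?I" "y < z" for y z
  proof -
    have "H y - \<kappa> * Q y \<le> H z - \<kappa> * Q z"
    proof (rule DERIV_nonneg_imp_nondecreasing[of y z "\<lambda>y. H y - \<kappa> * Q y"])
      fix x assume "y \<le> x" "x \<le> z"
      then have "x \<in> ?I" using connected_contains_Icc[OF conn yz(1,2)] by auto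
      then show "\<exists>D. ((\<lambda>y. H y - \<kappa> * Q y) has_real_derivative D) (at x) \<and> 0 \<le> D"
        using H Q by (intro exI[of _ "H' x - \<kappa> * q x"]) (auto intro!: derivative_eq_intros simp: q_def)
    qed (use yz in simp)
    then show ?thesis by (simp add: algebra_simps)
  qed
  have Hmono: "H y \<le> H z" if "y \<in> ?I" "z \<in> ?I" "y < z" for y z
  proof -
    have "Q y \<le> Q z"
    proof (rule DERIV_nonneg_imp_nondecreasing[of y z Q])
      fix x assume "y \<le> x" "x \<le> z"
      then have "x \<in> ?I" using connected_contains_Icc[OF conn that(1,2)] by auto
      then show "\<exists>D. (Q has_real_derivative D) (at x) \<and> 0 \<le> D" using Q q0 by blast
    qed (use that in simp)
    then show ?thesis using mono[OF that] \<kappa> mult_nonneg_nonneg[of \<kappa> "Q z - Q y"] by linarith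
  qed
  have sub: "einterval a (ereal c) \<subseteq> ?I" "einterval (ereal c) b \<subseteq> ?I"
    and lt: "a < ereal c" "ereal c < b"
  proof -
    show lt: "a < ereal c" "ereal c < b" using c by (auto simp: einterval_iff)
    show "einterval a (ereal c) \<subseteq> ?I"
    proof
      fix x assume "x \<in> einterval a (ereal c)"
      then show "x \<in> ?I" using less_trans[of "ereal x" "ereal c" b] lt by (simp add: einterval_iff)
    qed
    show "einterval (ereal c) b \<subseteq> ?I"
    proof
      fix x assume "x \<in> einterval (ereal c) b"
      then show "x \<in> ?I" using less_trans[of a "ereal c" "ereal x"] lt by (simp add: einterval_iff)
    qed
  qed
  have cH: "continuous_on ?I H"
    by (rule DERIV_continuous_on[of _ _ H']) (use H in \<open>auto intro: has_field_derivative_at_within\<close>)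
  have connH: "connected (H ` ?I)" by (rule connected_continuous_image[OF cH conn])
  have upper: "\<exists>z\<in>?I. H z > B" for B
  proof -
    obtain y z where yz: "y \<in> einterval c b" "z \<in> einterval c b" "y < z" "Q z - Q y > (B - H c) / \<kappa>"
      using infinite_integral_imp_unbounded[OF lt(2) sub(2) open_einterval cq q0 Q[rule_format] inf2[folded q_def]] by blast
    then have "B - H c < \<kappa> * (Q z - Q y)" using \<kappa> by (simp add: pos_divide_less_eq mult.commute)
    moreover have "\<kappa> * (Q z - Q y) \<le> H z - H y" using mono yz sub by blast
    moreover have "H c \<le> H y" using Hmono[OF c, of y] yz sub by (auto simp: einterval_iff)
    ultimately have "B < H z" by linarith
    then show ?thesis using yz sub by blast
  qed
  have lower: "\<exists>z\<in>?I. H z < B" for B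
  proof -
    obtain y z where yz: "y \<in> einterval a c" "z \<in> einterval a c" "y < z" "Q z - Q y > (H c - B) / \<kappa>"
      using infinite_integral_imp_unbounded[OF lt(1) sub(1) open_einterval cq q0 Q[rule_format] inf1[folded q_def]] by blast
    then have "H c - B < \<kappa> * (Q z - Q y)" using \<kappa> by (simp add: pos_divide_less_eq mult.commute)
    moreover have "\<kappa> * (Q z - Q y) \<le> H z - H y" using mono yz sub by blast
    moreover have "H z \<le> H c" using Hmono[of z c] c yz sub by (auto simp: einterval_iff)
    ultimately have "H y < B" by linarith
    then show ?thesis using yz sub by blast
  qed
  show "H ` ?I = UNIV"
  proof (intro set_eqI iffI UNIV_I)
    fix r :: real
    obtain y z where yz: "y \<in> ?I" "H y < r" "z \<in> ?I" "H z > r" using upper lower by meson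
    then have "{H y..H z} \<subseteq> H ` ?I" by (intro connected_contains_Icc[OF connH]) auto
    then show "r \<in> H ` ?I" using yz by auto
  qed
qed

section \<open>Geodesic connectedness\<close>

lemma connected_affine_vimage:
  fixes I :: "real set"
  assumes "connected I"
  shows "connected {t. a + b * t \<in> I}"
proof -
  have "is_interval {t. a + b * t \<in> I}" unfolding is_interval_1
  proof (intro ballI allI impI)
    fix x z y assume xz: "x \<in> {t. a + b * t \<in> I}" "z \<in> {t. a + b * t \<in> I}" "x \<le> y \<and> y \<le> z"
    have "a + b * y \<in> {a + b * x..a + b * z} \<or> a + b * y \<in> {a + b * z..a + b * x}"
      using xz(3) by (cases "b \<ge> 0") (auto intro: mult_left_mono mult_left_mono_neg)
    moreover have "{a + b * x..a + b * z} \<subseteq> I" "{a + b * z..a + b * x} \<subseteq> I"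
      using xz(1,2) connected_contains_Icc[OF assms] by blast+
    ultimately show "y \<in> {t. a + b * t \<in> I}" by blast
  qed
  then show ?thesis by (simp add: is_interval_connected_1)
qed

context grw_spacetime
begin

lemma f_has_derivative: "y \<in> I \<Longrightarrow> (f has_field_derivative deriv f y) (at y)"
  "y \<in> I \<Longrightarrow> (deriv f has_field_derivative deriv (deriv f) y) (at y)"
  using smooth_on_real_has_field_derivative f_smooth smooth_on_deriv[OF f_smooth open_I] by blast+

text \<open>The case \<open>l = 0\<close> of \<open>grw_geodesicI\<close>, in which the time
  component is affine. If the times coincide as well, the curve is constant.\<close>

lemma connect_vertical:
  assumes fgeo: "geodesic F \<sigma> K" and r0: "r0 \<in> K" and \<tau>: "\<tau>1 \<in> I" "\<tau>2 \<in> I"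
  shows "\<exists>\<gamma> J. geodesic M \<gamma> J \<and> (\<exists>t1\<in>J. \<exists>t2\<in>J. \<gamma> t1 = (\<tau>1, \<sigma> r0) \<and> \<gamma> t2 = (\<tau>2, \<sigma> r0))"
proof -
  define J where "J = {t. \<tau>1 + (\<tau>2 - \<tau>1) * t \<in> I}"
  have J: "0 \<in> J" "1 \<in> J" using \<tau> by (simp_all add: J_def)
  obtain s where s: "\<And>i r. i \<in> idx F \<Longrightarrow> r \<in> times_in F \<sigma> K i \<Longrightarrow>
       metric F i (coord F i (\<sigma> r)) (velocity F \<sigma> i r) (velocity F \<sigma> i r) = s"
    using speed_const[OF fgeo] by metis
  have "geodesic M (\<lambda>t. (\<tau>1 + (\<tau>2 - \<tau>1) * t, \<sigma> r0)) J"
  proof (rule grw_geodesicI[where ?\<tau>1.0 = "\<lambda>t. \<tau>2 - \<tau>1" and l = 0 and s = s and K = K and \<rho> = "\<lambda>t. r0"])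
    have "J = (\<lambda>t. \<tau>1 + (\<tau>2 - \<tau>1) * t) -` I" by (auto simp: J_def)
    then show "open J" using open_I by (auto intro!: open_vimage continuous_intros)
    show "connected J" unfolding J_def by (rule connected_affine_vimage[OF conn_I])
    show "J \<noteq> {}" using J by blast
  qed (use r0 fgeo s in \<open>auto intro!: derivative_eq_intros simp: J_def\<close>)
  then show ?thesis using J
    by (intro exI[of _ "\<lambda>t. (\<tau>1 + (\<tau>2 - \<tau>1) * t, \<sigma> r0)"] exI[of _ J] conjI bexI[of _ 0] bexI[of _ 1]) auto
qed

text \<open>In terms of \<open>\<theta>\<close> with \<open>d\<theta> = d\<tau> / f\<close>, and of the parameter of the fiber geodesic, the geodesic
  equation becomes the boundary value problem above, for \<open>F = f\<^sup>2\<close>.\<close>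

lemma connect_oblique:
  assumes ne: "non_escaping I f"
    and fgeo: "geodesic F \<sigma> K" and r: "r0 \<in> K" "r1 \<in> K" "r0 < r1" and \<tau>: "\<tau>1 \<in> I" "\<tau>2 \<in> I"
  shows "\<exists>\<gamma> J. geodesic M \<gamma> J \<and> (\<exists>t1\<in>J. \<exists>t2\<in>J. \<gamma> t1 = (\<tau>1, \<sigma> r0) \<and> \<gamma> t2 = (\<tau>2, \<sigma> r1))"
proof -
  obtain s where s0: "s \<ge> 0" and s: "\<And>i r. i \<in> idx F \<Longrightarrow> r \<in> times_in F \<sigma> K i \<Longrightarrow>
       metric F i (coord F i (\<sigma> r)) (velocity F \<sigma> i r) (velocity F \<sigma> i r) = s"
    using speed_const[OF fgeo] by metis
  have cf: "continuous_on I f" and cf1: "continuous_on I (deriv f)" and cf2: "continuous_on I (deriv (deriv f))"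
    using smooth_on_imp_continuous_on f_smooth smooth_on_deriv[OF f_smooth open_I]
      smooth_on_deriv[OF smooth_on_deriv[OF f_smooth open_I] open_I] by blast+
  have f0: "f y \<noteq> 0" if "y \<in> I" for y using f_pos[OF that] by simp
  have s1: "1 + (f y)\<^sup>2 > 0" for y using zero_le_power2[of "f y"] by linarith
  have c1: "continuous_on I (\<lambda>y. 1 / f y)" and c2: "continuous_on I (\<lambda>y. 1 / (f y * sqrt (1 + (f y)\<^sup>2)))"
    using f0 s1 by (auto intro!: continuous_intros cf simp: less_imp_neq[symmetric])
  from open_interval_antiderivative[OF open_I conn_I c1] obtain \<Theta>
    where \<Theta>: "\<forall>y\<in>I. (\<Theta> has_field_derivative 1 / f y) (at y)" ..
  from open_interval_antiderivative[OF open_I conn_I c2] obtain H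
    where H: "\<forall>y\<in>I. (H has_field_derivative 1 / (f y * sqrt (1 + (f y)\<^sup>2))) (at y)" ..
  \<comment> \<open>Relative to \<open>\<Theta>\<close>, whose derivative is \<open>1 / f\<close>,
    the weight becomes \<open>1 / sqrt (1 + f\<^sup>2)\<close>: the derivative of
    \<open>\<Phi>\<close> in \<open>newton_equation\<close>.\<close>
  have weight: "1 / (f y)\<^sup>2 * (1 / (f y)\<^sup>2 + 1) powr (- 1 / 2) = 1 / (f y * sqrt (1 + (f y)\<^sup>2))" if y: "y \<in> I" for y
  proof -
    have fy: "f y > 0" by (rule f_pos[OF y])
    have e: "1 / (f y)\<^sup>2 + 1 = (1 + (f y)\<^sup>2) / (f y)\<^sup>2" using fy by (simp add: field_simps)
    have "(1 / (f y)\<^sup>2 + 1) powr (- 1 / 2) = 1 / sqrt ((1 + (f y)\<^sup>2) / (f y)\<^sup>2)"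
      unfolding e using s1[of y] fy by (simp add: powr_minus_divide powr_half_sqrt)
    also have "\<dots> = f y / sqrt (1 + (f y)\<^sup>2)" using fy by (simp add: real_sqrt_divide)
    finally show ?thesis using fy by (simp add: power2_eq_square)
  qed
  have surjH: "H ` I = UNIV"
    using ne[unfolded non_escaping_def, THEN spec, THEN spec, THEN spec, THEN mp, THEN mp,
        of 1 H "\<lambda>y. 1 / (f y * sqrt (1 + (f y)\<^sup>2))"] H weight by simp
  \<comment> \<open>As the weight is at most \<open>1 / f\<close>, the new time variable also takes
    all real values, so that the Newton equation lives on the whole line.\<close>
  have surj\<Theta>: "\<Theta> ` I = UNIV"
  proof -
    have "1 / (f y * sqrt (1 + (f y)\<^sup>2)) \<le> 1 / f y" if "y \<in> I" for y
    proof (rule divide_left_mono)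
      show "f y \<le> f y * sqrt (1 + (f y)\<^sup>2)" using f_pos[OF that] by simp
      show "0 < f y * sqrt (1 + (f y)\<^sup>2) * f y" using f_pos[OF that] s1[of y] by simp
    qed simp
    then show ?thesis
      using ne[unfolded non_escaping_def, THEN spec, THEN spec, THEN spec, THEN mp, THEN mp,
          of 1 \<Theta> "\<lambda>y. 1 / f y"] \<Theta> weight by simp
  qed
  have mono\<Theta>: "\<Theta> y < \<Theta> z" if "y \<in> I" "z \<in> I" "y < z" for y z
  proof (rule DERIV_pos_imp_increasing[OF that(3)])
    fix x assume "y \<le> x" "x \<le> z"
    then have "x \<in> I" using connected_contains_Icc[OF conn_I that(1,2)] by auto
    then show "\<exists>D. (\<Theta> has_real_derivative D) (at x) \<and> 0 < D" using \<Theta> f_pos[of x] by (intro exI[of _ "1 / f x"]) auto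
  qed
  have inj\<Theta>: "inj_on \<Theta> I"
    by (rule inj_onI) (metis mono\<Theta> linorder_neqE_linordered_idom less_irrefl)
  define \<Xi> where "\<Xi> = inv_into I \<Theta>"
  have \<Xi>\<Theta>: "\<Xi> (\<Theta> y) = y" if "y \<in> I" for y using inj\<Theta> that by (simp add: \<Xi>_def)
  have \<Xi>I: "\<Xi> x \<in> I" and \<Theta>\<Xi>: "\<Theta> (\<Xi> x) = x" for x
    using surj\<Theta> inv_into_into[of x \<Theta> I] f_inv_into_f[of x \<Theta> I] by (auto simp: \<Xi>_def)
  have d\<Xi>: "(\<Xi> has_field_derivative f (\<Xi> x)) (at x)" for x
    using real_inverse_derivative[OF open_I \<Theta>[rule_format] \<Xi>\<Theta> \<Xi>I, of x] f0[OF \<Xi>I[of x]] by (simp add: \<Theta>\<Xi>)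
  have c\<Xi>: "continuous_on A \<Xi>" for A using d\<Xi> by (meson DERIV_isCont continuous_at_imp_continuous_on)
  \<comment> \<open>\<open>F1\<close> and \<open>F2\<close> are the derivatives of \<open>Fh\<close>
    with respect to \<open>\<theta>\<close>, each of which contributes a factor \<open>f\<close>
    because of \<open>d\<tau> = f d\<theta>\<close>.\<close>
  define Fh where "Fh x = (f (\<Xi> x))\<^sup>2" for x
  define F1 where "F1 x = 2 * (f (\<Xi> x))\<^sup>2 * deriv f (\<Xi> x)" for x
  define F2 where "F2 x = (4 * f (\<Xi> x) * deriv f (\<Xi> x) * deriv f (\<Xi> x) + 2 * (f (\<Xi> x))\<^sup>2 * deriv (deriv f) (\<Xi> x)) * f (\<Xi> x)" for x
  have df\<Xi>: "((\<lambda>x. f (\<Xi> x)) has_field_derivative deriv f (\<Xi> x) * f (\<Xi> x)) (at x)"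
    "((\<lambda>x. deriv f (\<Xi> x)) has_field_derivative deriv (deriv f) (\<Xi> x) * f (\<Xi> x)) (at x)" for x
    by (rule DERIV_chain2[OF f_has_derivative(1)[OF \<Xi>I] d\<Xi>], rule DERIV_chain2[OF f_has_derivative(2)[OF \<Xi>I] d\<Xi>])
  define L where "L = r1 - r0"
  interpret N: newton_equation Fh F1 F2 "\<lambda>x. H (\<Xi> x)" s L "\<Theta> \<tau>1"
  proof
    fix x
    show "0 < Fh x" using f_pos[OF \<Xi>I[of x]] by (simp add: Fh_def)
    show "(Fh has_field_derivative F1 x) (at x)" unfolding Fh_def[abs_def] F1_def
      by (auto intro!: derivative_eq_intros df\<Xi> simp: power2_eq_square)
    show "(F1 has_field_derivative F2 x) (at x)" unfolding F1_def[abs_def] F2_def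
      by (auto intro!: derivative_eq_intros df\<Xi> simp: power2_eq_square algebra_simps)
    have "((\<lambda>x. H (\<Xi> x)) has_field_derivative 1 / (f (\<Xi> x) * sqrt (1 + (f (\<Xi> x))\<^sup>2)) * f (\<Xi> x)) (at x)"
      by (rule DERIV_chain2[OF H[rule_format, OF \<Xi>I] d\<Xi>])
    then show "((\<lambda>x. H (\<Xi> x)) has_field_derivative 1 / sqrt (1 + Fh x)) (at x)"
      using f0[OF \<Xi>I[of x]] by (simp add: Fh_def)
  next
    have "continuous_on UNIV (\<lambda>x. g (\<Xi> x))" if "continuous_on I g" for g :: "real \<Rightarrow> real"
      by (rule continuous_on_compose2[OF that c\<Xi>]) (use \<Xi>I in auto)
    then show "continuous_on UNIV F2" unfolding F2_def[abs_def]
      using cf cf1 cf2 by (intro continuous_intros) auto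
    have "\<exists>x. H (\<Xi> x) = y" for y
    proof -
      obtain z where "z \<in> I" "H z = y" using surjH by (metis UNIV_I imageE)
      then show ?thesis using \<Xi>\<Theta> by (intro exI[of _ "\<Theta> z"]) simp
    qed
    then show "(\<lambda>x. H (\<Xi> x)) ` UNIV = UNIV" by (metis surj_def)
    show "0 \<le> s" by (rule s0)
    show "0 < L" using r by (simp add: L_def)
  qed
  obtain \<theta> \<omega> d where \<theta>0: "\<theta> 0 = \<Theta> \<tau>1" and \<theta>L: "\<theta> L = \<Theta> \<tau>2"
    and sol: "\<And>r. \<bar>r\<bar> < L + 1 \<Longrightarrow> (\<theta> has_field_derivative \<omega> r) (at r) \<and>
       (\<omega> has_field_derivative d * F1 (\<theta> r) / 2) (at r) \<and> (\<omega> r)\<^sup>2 = s + d * Fh (\<theta> r)"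
    using N.boundary_value_problem[of "\<Theta> \<tau>2"] by blast
  \<comment> \<open>Displacements from \<open>r0\<close> for which both the solution of the boundary
    value problem and \<open>\<sigma>\<close> are available: an open interval that contains
    \<open>0\<close> and \<open>L\<close>.\<close>
  define X where "X = {-(L + 1)<..<L + 1} \<inter> {r. r0 + 1 * r \<in> K}"
  have X_sol: "\<bar>r\<bar> < L + 1" "r0 + r \<in> K" if "r \<in> X" for r using that by (auto simp: X_def)
  have K: "open K" "connected K" using fgeo by (auto simp: geodesic_def)
  have oX: "open X"
  proof -
    have "{r. r0 + 1 * r \<in> K} = (\<lambda>r. r0 + 1 * r) -` K" by auto
    moreover have "open ((\<lambda>r. r0 + 1 * r) -` K)" using K(1) by (auto intro!: open_vimage continuous_intros)
    ultimately show ?thesis unfolding X_def by (intro open_Int) auto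
  qed
  have cX: "connected X"
  proof -
    have "is_interval ({-(L + 1)<..<L + 1} \<inter> {r. r0 + 1 * r \<in> K})"
      using connected_affine_vimage[OF K(2), of r0 1]
      by (intro is_interval_Int) (simp_all add: is_interval_connected_1)
    then show ?thesis by (simp add: X_def is_interval_connected_1)
  qed
  have "0 \<in> X" "L \<in> X" using r by (auto simp: X_def L_def)
  have c\<theta>: "continuous_on X \<theta>"
    by (rule DERIV_continuous_on) (use X_sol sol in \<open>blast intro: has_field_derivative_at_within\<close>)
  have "continuous_on X (\<lambda>r. Fh (\<theta> r))"
    by (rule continuous_on_compose2[OF _ c\<theta>, of UNIV])
       (auto intro!: continuous_at_imp_continuous_on DERIV_isCont[OF N.dF])
  \<comment> \<open>The affine parameter is recovered from \<open>dt = f\<^sup>2 dr\<close>, which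
    is the relation \<open>\<rho>' = l / f\<^sup>2\<close> with \<open>l = 1\<close>.\<close>
  from open_interval_antiderivative[OF oX cX this] obtain T
    where T: "\<forall>r\<in>X. (T has_field_derivative Fh (\<theta> r)) (at r)" ..
  have monoT: "T y < T z" if "y \<in> X" "z \<in> X" "y < z" for y z
  proof (rule DERIV_pos_imp_increasing[OF that(3)])
    fix x assume "y \<le> x" "x \<le> z"
    then have "x \<in> X" using connected_contains_Icc[OF cX that(1,2)] by auto
    then show "\<exists>D. (T has_real_derivative D) (at x) \<and> 0 < D" using T N.F_pos by blast
  qed
  have injT: "inj_on T X"
    by (rule inj_onI) (metis monoT linorder_neqE_linordered_idom less_irrefl)
  have cT: "continuous_on X T"
    by (rule DERIV_continuous_on) (use T in \<open>blast intro: has_field_derivative_at_within\<close>)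
  define J where "J = T ` X"
  define \<rho> where "\<rho> = inv_into X T"
  have \<rho>T: "\<rho> (T r) = r" if "r \<in> X" for r using injT that by (simp add: \<rho>_def)
  have \<rho>X: "\<rho> t \<in> X" "T (\<rho> t) = t" if "t \<in> J" for t using that \<rho>T by (auto simp: J_def)
  have Fh0: "Fh x \<noteq> 0" for x using N.F_pos[of x] by simp
  have d\<rho>: "(\<rho> has_field_derivative 1 / Fh (\<theta> (\<rho> t))) (at t)" if "t \<in> J" for t
    using real_inverse_derivative[OF oX T[rule_format] \<rho>T \<rho>X(1)[OF that] Fh0] \<rho>X(2)[OF that] by simp
  define \<tau> where "\<tau> t = \<Xi> (\<theta> (\<rho> t))" for t
  have Fh\<tau>: "Fh (\<theta> (\<rho> t)) = (f (\<tau> t))\<^sup>2" for t by (simp add: Fh_def \<tau>_def)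
  have \<tau>I: "\<tau> t \<in> I" for t by (simp add: \<tau>_def \<Xi>I)
  have d\<tau>: "(\<tau> has_field_derivative \<omega> (\<rho> t) / f (\<tau> t)) (at t)" if "t \<in> J" for t
  proof -
    have "(\<tau> has_field_derivative f (\<Xi> (\<theta> (\<rho> t))) * (\<omega> (\<rho> t) * (1 / Fh (\<theta> (\<rho> t))))) (at t)"
      unfolding \<tau>_def[abs_def]
      by (rule DERIV_chain2[OF d\<Xi> DERIV_chain2[OF _ d\<rho>[OF that]]]) (use sol X_sol \<rho>X[OF that] in blast)
    then show ?thesis using f0[OF \<tau>I[of t]] by (simp add: Fh\<tau> power2_eq_square \<tau>_def[symmetric])
  qed
  have "geodesic M (\<lambda>t. (\<tau> t, \<sigma> (r0 + \<rho> t))) J"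
  proof (rule grw_geodesicI[where ?\<tau>1.0 = "\<lambda>t. \<omega> (\<rho> t) / f (\<tau> t)" and l = 1 and s = s and K = K])
    show "open J" unfolding J_def by (rule invariance_of_domain[OF cT oX injT])
    show "connected J" unfolding J_def by (rule connected_continuous_image[OF cT cX])
    show "J \<noteq> {}" using \<open>0 \<in> X\<close> by (auto simp: J_def)
    show "geodesic F \<sigma> K" by (rule fgeo)
  next
    fix t assume t: "t \<in> J"
    have fp: "f (\<tau> t) > 0" using f_pos \<tau>I by blast
    have so: "(\<omega> has_field_derivative d * F1 (\<theta> (\<rho> t)) / 2) (at (\<rho> t))" "(\<omega> (\<rho> t))\<^sup>2 = s + d * (f (\<tau> t))\<^sup>2"
      using sol[OF X_sol(1)[OF \<rho>X(1)[OF t]]] Fh\<tau> by auto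
    show "\<tau> t \<in> I" by (rule \<tau>I)
    show "(\<tau> has_field_derivative \<omega> (\<rho> t) / f (\<tau> t)) (at t)" by (rule d\<tau>[OF t])
    have d1: "((\<lambda>t. \<omega> (\<rho> t)) has_field_derivative d * deriv f (\<tau> t)) (at t)"
    proof -
      have "((\<lambda>t. \<omega> (\<rho> t)) has_field_derivative d * F1 (\<theta> (\<rho> t)) / 2 * (1 / Fh (\<theta> (\<rho> t)))) (at t)"
        by (rule DERIV_chain2[OF so(1) d\<rho>[OF t]])
      moreover have "F1 (\<theta> (\<rho> t)) = 2 * (f (\<tau> t))\<^sup>2 * deriv f (\<tau> t)" by (simp add: F1_def \<tau>_def)
      ultimately show ?thesis using fp by (simp add: Fh\<tau>)
    qed
    have d2: "((\<lambda>t. f (\<tau> t)) has_field_derivative deriv f (\<tau> t) * (\<omega> (\<rho> t) / f (\<tau> t))) (at t)"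
      by (rule DERIV_chain2[OF f_has_derivative(1)[OF \<tau>I] d\<tau>[OF t]])
    have "((\<lambda>t. \<omega> (\<rho> t) / f (\<tau> t)) has_field_derivative
       (d * deriv f (\<tau> t) * f (\<tau> t) - \<omega> (\<rho> t) * (deriv f (\<tau> t) * (\<omega> (\<rho> t) / f (\<tau> t)))) / (f (\<tau> t) * f (\<tau> t))) (at t)"
      by (rule DERIV_divide[OF d1 d2]) (use fp in simp)
    moreover have "(d * deriv f (\<tau> t) * f (\<tau> t) - \<omega> (\<rho> t) * (deriv f (\<tau> t) * (\<omega> (\<rho> t) / f (\<tau> t)))) / (f (\<tau> t) * f (\<tau> t))
       = (d * deriv f (\<tau> t) * (f (\<tau> t))\<^sup>2 - (\<omega> (\<rho> t))\<^sup>2 * deriv f (\<tau> t)) / (f (\<tau> t))^3"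
      using fp by (simp add: field_simps eval_nat_numeral)
    \<comment> \<open>The energy relation replaces \<open>\<omega>\<^sup>2\<close> by
      \<open>s + d * f\<^sup>2\<close>, whereupon the terms with \<open>d\<close> cancel.\<close>
    moreover have "\<dots> = - (s * 1\<^sup>2 * deriv f (\<tau> t) / (f (\<tau> t))^3)"
      unfolding so(2) by (simp add: algebra_simps)
    ultimately show "((\<lambda>t. \<omega> (\<rho> t) / f (\<tau> t)) has_field_derivative - (s * 1\<^sup>2 * deriv f (\<tau> t) / (f (\<tau> t))^3)) (at t)"
      by simp
    show "r0 + \<rho> t \<in> K" using X_sol \<rho>X[OF t] by blast
    show "((\<lambda>t. r0 + \<rho> t) has_field_derivative 1 / (f (\<tau> t))\<^sup>2) (at t)"
      using DERIV_add[OF DERIV_const d\<rho>[OF t], of r0] by (simp add: Fh\<tau>)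
  qed (rule s)
  moreover have "T 0 \<in> J" "T L \<in> J" using \<open>0 \<in> X\<close> \<open>L \<in> X\<close> by (auto simp: J_def)
  moreover have "(\<tau> (T 0), \<sigma> (r0 + \<rho> (T 0))) = (\<tau>1, \<sigma> r0)"
    using \<rho>T[OF \<open>0 \<in> X\<close>] \<theta>0 \<Xi>\<Theta>[OF \<tau>(1)] by (simp add: \<tau>_def)
  moreover have "(\<tau> (T L), \<sigma> (r0 + \<rho> (T L))) = (\<tau>2, \<sigma> r1)"
    using \<rho>T[OF \<open>L \<in> X\<close>] \<theta>L \<Xi>\<Theta>[OF \<tau>(2)] by (simp add: \<tau>_def L_def)
  ultimately show ?thesis by blast
qed

text \<open>Weak convexity supplies the fiber geodesic, and equal parameters on it lead to the
  vertical case. The curves built above need not be maximal, so they are extended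
  afterwards.\<close>

lemma geodesically_connected_grw:
  assumes wc: "weakly_convex F" and ne: "non_escaping I f"
  shows "geodesically_connected M"
  unfolding geodesically_connected_def
proof (intro ballI)
  fix z1 z2 assume "z1 \<in> points M" "z2 \<in> points M"
  then obtain \<tau>1 p \<tau>2 q where z: "z1 = (\<tau>1, p)" "z2 = (\<tau>2, q)"
    and \<tau>: "\<tau>1 \<in> I" "\<tau>2 \<in> I" and pq: "p \<in> points F" "q \<in> points F"
    by (auto simp: grw_points)
  obtain \<sigma> K r0 r1 where \<sigma>: "geodesic F \<sigma> K" and r: "r0 \<in> K" "r1 \<in> K" "r0 \<le> r1" "\<sigma> r0 = p" "\<sigma> r1 = q"
    using wc pq unfolding weakly_convex_def inextendible_geodesic_def by meson
  have "\<exists>\<gamma> J. geodesic M \<gamma> J \<and> (\<exists>t1\<in>J. \<exists>t2\<in>J. \<gamma> t1 = z1 \<and> \<gamma> t2 = z2)"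
  proof (cases "r0 = r1")
    case True
    then show ?thesis using connect_vertical[OF \<sigma> r(1) \<tau>] r z by simp
  next
    case False
    then show ?thesis using connect_oblique[OF ne \<sigma> r(1,2) _ \<tau>] r z by simp
  qed
  then obtain \<gamma> J t1 t2 where g: "geodesic M \<gamma> J" "t1 \<in> J" "t2 \<in> J" "\<gamma> t1 = z1" "\<gamma> t2 = z2" by blast
  obtain \<gamma>' J' where "inextendible_geodesic M \<gamma>' J'" "J \<subseteq> J'" "\<And>t. t \<in> J \<Longrightarrow> \<gamma>' t = \<gamma> t"
    using geodesic_extends_to_inextendible[OF M_conn g(1)] by blast
  then show "\<exists>\<gamma> J. inextendible_geodesic M \<gamma> J \<and> (\<exists>s\<in>J. \<exists>t\<in>J. \<gamma> s = z1 \<and> \<gamma> t = z2)"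
    using g by (intro exI[of _ \<gamma>'] exI[of _ J'] conjI bexI[of _ t1] bexI[of _ t2]) auto
qed

end

theorem corollary1:
  fixes F :: "('i, 'p::{t2_space,second_countable_topology}, 'e::euclidean_space) mfd"
    and a b :: ereal and c :: real and f :: "real \<Rightarrow> real"
  assumes "riemannian_manifold F"
    and "connected (points F)"
    and "a < b"
    and "smooth_on (einterval a b) f"
    and "\<And>\<tau>. \<tau> \<in> einterval a b \<Longrightarrow> f \<tau> > 0"
    and "weakly_convex F"
    and "c \<in> einterval a b"
    and "(\<integral>\<^sup>+\<tau>\<in>einterval a (ereal c).
            ennreal (1 / (f \<tau>)\<^sup>2 * (1 / (f \<tau>)\<^sup>2 + 1) powr (- 1 / 2)) \<partial>lborel) = \<infinity>"
    and "(\<integral>\<^sup>+\<tau>\<in>einterval (ereal c) b.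
            ennreal (1 / (f \<tau>)\<^sup>2 * (1 / (f \<tau>)\<^sup>2 + 1) powr (- 1 / 2)) \<partial>lborel) = \<infinity>"
  shows "geodesically_connected (grw (einterval a b) f F) \<and>
    (\<forall>\<gamma> J t0 z0 \<sigma> K h.
       inextendible_geodesic (grw (einterval a b) f F) \<gamma> J \<and>
       causal_curve (grw (einterval a b) f F) \<gamma> J \<and>
       t0 \<in> J \<and> \<gamma> t0 = z0 \<and>
       fiber_geodesic_of F \<gamma> J \<sigma> K h \<longrightarrow>
       bij_betw h (conjugate_params (grw (einterval a b) f F) \<gamma> J t0)
                  (conjugate_params F \<sigma> K (h t0)) \<and>
       (\<forall>t\<in>conjugate_params (grw (einterval a b) f F) \<gamma> J t0.
          conjugate_multiplicity F \<sigma> K (h t0) (h t) =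
          conjugate_multiplicity (grw (einterval a b) f F) \<gamma> J t0 t))"
proof -
  let ?I = "einterval a b"
  have conn: "connected ?I"
  proof -
    have "is_interval ?I" unfolding is_interval_1
      by (auto simp: einterval_iff) (meson ereal_less_eq(3) le_less_trans less_le_trans)+
    then show ?thesis by (simp add: is_interval_connected_1)
  qed
  interpret grw_spacetime F ?I f
    by unfold_locales (use assms conn in auto)
  have ne: "non_escaping ?I f"
    by (rule non_escapingI[OF smooth_on_imp_continuous_on[OF assms(4)] assms(5) conn assms(7,8,9)])
  have "bij_betw h (conjugate_params M \<gamma> J t0) (conjugate_params F \<sigma> K (h t0)) \<and>
       (\<forall>t\<in>conjugate_params M \<gamma> J t0.
          conjugate_multiplicity F \<sigma> K (h t0) (h t) = conjugate_multiplicity M \<gamma> J t0 t)"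
    if H: "inextendible_geodesic M \<gamma> J" "causal_curve M \<gamma> J" "t0 \<in> J" "fiber_geodesic_of F \<gamma> J \<sigma> K h"
    for \<gamma> J t0 \<sigma> K h
  proof -
    interpret grw_geodesic F ?I f \<gamma> J \<sigma> K h
      using H by unfold_locales (auto simp: inextendible_geodesic_def fiber_geodesic_of_def)
    show ?thesis
    proof (cases "s = 0")
      \<comment> \<open>The fiber component is constant, and the bijection is one between empty
        sets.\<close>
      case True
      then show ?thesis
        using no_conjugate_params_spacetime[OF True H(3)] no_conjugate_params_fiber[OF True h_K[OF H(3)]]
        by (simp add: bij_betw_def)
    next
      case False
      then have s: "s > 0" using s_nonneg by simp
      have \<tau>1: "\<tau>1 t \<noteq> 0" if "t \<in> J" for t
      proof -
        have "(f (\<tau> t) * h1 t)\<^sup>2 * s > 0" using f_along(3)[OF that] h_pos[OF that] s by simp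
        then show ?thesis using causal_velocity[OF H(2) that] by auto
      qed
      have hJ: "h ` J = K" by (rule reparametrization_surj[OF H(1) s H(2) ne])
      \<comment> \<open>Parameters that are not after \<open>t0\<close> count on neither side, since
        \<open>h\<close> is increasing; for the others, \<open>lift\<close> identifies the spaces of
        Jacobi fields.\<close>
      have iff: "t \<in> conjugate_params M \<gamma> J t0 \<longleftrightarrow> h t \<in> conjugate_params F \<sigma> K (h t0)"
        if t: "t \<in> J" for t
      proof (cases "t0 < t")
        case True
        then show ?thesis using conjugate_params_iff[OF s \<tau>1 hJ H(3) t] by blast
      next
        case False
        then have "h t \<le> h t0" using h_mono[OF t H(3)] by (cases "t = t0") auto
        then show ?thesis using False by (auto simp: conjugate_params_def)
      qed
      have sub: "conjugate_params M \<gamma> J t0 \<subseteq> J" "conjugate_params F \<sigma> K (h t0) \<subseteq> K"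
        by (auto simp: conjugate_params_def)
      have "h ` conjugate_params M \<gamma> J t0 = conjugate_params F \<sigma> K (h t0)"
        using iff sub hJ by (auto 0 3)
      then have "bij_betw h (conjugate_params M \<gamma> J t0) (conjugate_params F \<sigma> K (h t0))"
        using inj_on_subset[OF h_inj sub(1)] by (simp add: bij_betw_def)
      moreover have "conjugate_multiplicity F \<sigma> K (h t0) (h t) = conjugate_multiplicity M \<gamma> J t0 t"
        if "t \<in> conjugate_params M \<gamma> J t0" for t
        using that by (intro conjugate_multiplicity_eq[OF s \<tau>1 hJ H(3)]) (auto simp: conjugate_params_def)
      ultimately show ?thesis by blast
    qed
  qed
  then show ?thesis using geodesically_connected_grw[OF assms(6) ne] by blast
qed

end
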